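(* Assume that conditions $\mathcal{C}_2(\boldsymbol{\gamma},\boldsymbol{\rho},\boldsymbol{A})$ and $\mathcal{J}(\boldsymbol{R})$ (stated in the context) hold with $\boldsymbol{\gamma}=\gamma\boldsymbol{1}$, $\rho_j<0$ and $A_j(t)=\gamma\beta_jt^{\rho_j}$ for all $j$. Suppose that $n_1\leq\cdots\leq n_m$ and that, for any $j\in\{1,\ldots,m\}$, as $n\to\infty$: $k_j=k_j(n)\to\infty$, $k_j/n_j\to0$, $n_1/n_j\to b_j\in(0,1]$, $k_1/k_j\to c_j\in(0,\infty)$ and $\sqrt{k_j}A_j(n_j/k_j)\to\lambda_j\in\mathbb{R}$. Assume that the matrix $\mathbf{V}_{\boldsymbol{c}}$ defined in the context is positive definite. Assume further that, for all $j$, $\widehat{\beta}_j$ is a consistent estimator of $\beta_j$ and $(\widehat{\rho}_j-\rho_j)\log n_j=\operatorname{o}_{\mathbb{P}}(1)$. Let $k=\sum_{j=1}^mk_j$ and define the bias-reduced estimators $$\overline{\gamma}_n(\widehat{\boldsymbol{\omega}}_n^{(\mathrm{Var})})=\widehat{\gamma}_n(\widehat{\boldsymbol{\omega}}_n^{(\mathrm{Var})})-\frac{1}{\sqrt{k}}(\widehat{\boldsymbol{\omega}}_n^{(\mathrm{Var})})^\top\widehat{\boldsymbol{B}}_{\boldsymbol{c}},\qquad \overline{\gamma}_n(\widehat{\boldsymbol{\omega}}_n^{(\mathrm{AMSE})})=\widehat{\gamma}_n(\widehat{\boldsymbol{\omega}}_n^{(\mathrm{AMSE})})-\frac{1}{\sqrt{k}}(\widehat{\boldsymbol{\omega}}_n^{(\mathrm{AMSE})})^\top\widehat{\boldsymbol{B}}_{\boldsymbol{c}}.$$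 Then $\sqrt{k}(\overline{\gamma}_n(\widehat{\boldsymbol{\omega}}_n^{(\mathrm{Var})})-\gamma)\stackrel{d}{\longrightarrow}\mathcal{N}(0,1/(\boldsymbol{1}^\top\mathbf{V}_{\boldsymbol{c}}^{-1}\boldsymbol{1}))$ and $$\sqrt{k}(\overline{\gamma}_n(\widehat{\boldsymbol{\omega}}_n^{(\mathrm{AMSE})})-\gamma)\stackrel{d}{\longrightarrow}\mathcal{N}\left(0,\frac{(1+\boldsymbol{B}_{\boldsymbol{c}}^\top\mathbf{V}_{\boldsymbol{c}}^{-1}\boldsymbol{B}_{\boldsymbol{c}})^2(\boldsymbol{1}^\top\mathbf{V}_{\boldsymbol{c}}^{-1}\boldsymbol{1})-(2+\boldsymbol{B}_{\boldsymbol{c}}^\top\mathbf{V}_{\boldsymbol{c}}^{-1}\boldsymbol{B}_{\boldsymbol{c}})(\boldsymbol{1}^\top\mathbf{V}_{\boldsymbol{c}}^{-1}\boldsymbol{B}_{\boldsymbol{c}})^2}{[(1+\boldsymbol{B}_{\boldsymbol{c}}^\top\mathbf{V}_{\boldsymbol{c}}^{-1}\boldsymbol{B}_{\boldsymbol{c}})(\boldsymbol{1}^\top\mathbf{V}_{\boldsymbol{c}}^{-1}\boldsymbol{1})-(\boldsymbol{1}^\top\mathbf{V}_{\boldsymbol{c}}^{-1}\boldsymbol{B}_{\boldsymbol{c}})^2]^2}\right).$$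
   Context: Setting: $m$ is a fixed integer, $\boldsymbol{X}=(X_1,\ldots,X_m)^\top$ is a random vector and $\boldsymbol{X}_i=(X_{i,1},\ldots,X_{i,m})^\top$, $i\geq1$, are independent copies of $\boldsymbol{X}$. The data are the $X_{i,j}$ for $1\leq j\leq m$, $1\leq i\leq n_j=n_j(n)$, with $n=\sum_{j=1}^m n_j$ and $n_j\to\infty$ as $n\to\infty$. Each $X_j$ has a continuous distribution function $F_j$, $\overline{F}_j=1-F_j$, and tail quantile function $U_j(t)=\inf\{x\in\mathbb{R}:1/\overline{F}_j(x)\geq t\}$. Condition $\mathcal{C}_2(\boldsymbol{\gamma},\boldsymbol{\rho},\boldsymbol{A})$: for every $j$, $\gamma_j>0$, $\rho_j\leq0$, $A_j$ has constant sign and converges to $0$ at infinity, and for all $x>0$, $\lim_{t\to\infty}\frac{1}{A_j(t)}\left[\frac{U_j(tx)}{U_j(t)}-x^{\gamma_j}\right]=x^{\gamma_j}\frac{x^{\rho_j}-1}{\rho_j}$ (read as $x^{\gamma_j}\log x$ if $\rho_j=0$). Condition $\mathcal{J}(\boldsymbol{R})$: with $\overline{C}_{j,\ell}(u,v)=\mathbb{P}(\overline{F}_j(X_j)\leq u,\overline{F}_\ell(X_\ell)\leq v)$, for any $j\neq\ell$ there is a function $R_{j,\ell}$ on $[0,\infty]^2\setminus\{(\infty,\infty)\}$ such that $\lim_{s\to\infty}s\,\overline{C}_{j,\ell}(x_j/s,x_\ell/s)=R_{j,\ell}(x_j,x_\ell)$ for all $(x_j,x_\ell)$ in this set. Hill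 estimators: with $X_{1:n_j,j}\leq\cdots\leq X_{n_j:n_j,j}$ the order statistics of the $j$th sample, $\widehat{\gamma}_j(k_j)=k_j^{-1}\sum_{i=1}^{k_j}\log(X_{n_j-i+1:n_j,j}/X_{n_j-k_j:n_j,j})$, and $\widehat{\gamma}_n(\boldsymbol{\omega})=\sum_{j=1}^m\omega_j\widehat{\gamma}_j(k_j)$ for $\boldsymbol{\omega}\in\mathbb{R}^m$. $\boldsymbol{1}$ is the vector of ones in $\mathbb{R}^m$. Asymptotic bias and variance: $\boldsymbol{B}_{\boldsymbol{c}}=\sqrt{\sum_{i=1}^mc_i^{-1}}\left(\sqrt{c_1}\frac{\lambda_1}{1-\rho_1},\ldots,\sqrt{c_m}\frac{\lambda_m}{1-\rho_m}\right)^\top$, and $\mathbf{V}_{\boldsymbol{c}}$ is the symmetric matrix with $[\mathbf{V}_{\boldsymbol{c}}]_{j,j}=(\sum_{i=1}^mc_i^{-1})\gamma^2c_j$ and $[\mathbf{V}_{\boldsymbol{c}}]_{j,\ell}=(\sum_{i=1}^mc_i^{-1})\gamma^2c_jR_{j,\ell}(c_\ell/c_j,b_\ell/b_j)$ for $j<\ell$. Estimated quantities: let $\boldsymbol{\omega}_0\in\mathbb{R}^m$ be an arbitrary fixed (pilot) vector with $\boldsymbol{\omega}_0^\top\boldsymbol{1}=1$, and $\widehat{\lambda}_j=\sqrt{k_j}\,\widehat{\gamma}_n(\boldsymbol{\omega}_0)\widehat{\beta}_j(n_j/k_j)^{\widehat{\rho}_j}$. Let $n_{j,\ell}=\min(n_j,n_\ell)$,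 $k_{j,\ell}=k_j$ if $n_j<n_\ell$ and $k_{j,\ell}=k_\ell$ otherwise, and $$\widehat{R}_{j,\ell}(u,v)=\frac{1}{k_{j,\ell}}\sum_{i=1}^{n_{j,\ell}}\mathbb{1}\left\{\frac{n_{j,\ell}+1-r_{n_{j,\ell},i,j}}{k_{j,\ell}(n_{j,\ell}+1)/n_{j,\ell}}\leq u,\ \frac{n_{j,\ell}+1-r_{n_{j,\ell},i,\ell}}{k_{j,\ell}(n_{j,\ell}+1)/n_{j,\ell}}\leq v\right\},$$ where $r_{n_{j,\ell},i,j}$ (resp. $r_{n_{j,\ell},i,\ell}$) is the rank of $X_{i,j}$ among $X_{1,j},\ldots,X_{n_{j,\ell},j}$ (resp. of $X_{i,\ell}$ among $X_{1,\ell},\ldots,X_{n_{j,\ell},\ell}$). Set $$\widehat{\boldsymbol{B}}_{\boldsymbol{c}}=\sqrt{k}\left(\frac{\widehat{\lambda}_1/\sqrt{k_1}}{1-\widehat{\rho}_1},\ldots,\frac{\widehat{\lambda}_m/\sqrt{k_m}}{1-\widehat{\rho}_m}\right)^\top,$$ and let $\widehat{\mathbf{V}}_{\boldsymbol{c}}$ be the symmetric matrix with $[\widehat{\mathbf{V}}_{\boldsymbol{c}}]_{j,j}=k\,\widehat{\gamma}_n^2(\boldsymbol{\omega}_0)/k_j$ and $[\widehat{\mathbf{V}}_{\boldsymbol{c}}]_{j,\ell}=k\,\widehat{\gamma}_n^2(\boldsymbol{\omega}_0)\,k_j^{-1}\widehat{R}_{j,\ell}(k_j/k_\ell,n_j/n_\ell)$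 for $j<\ell$. Then $\widehat{\boldsymbol{\omega}}_n^{(\mathrm{Var})}=\widehat{\mathbf{V}}_{\boldsymbol{c}}^{-1}\boldsymbol{1}/(\boldsymbol{1}^\top\widehat{\mathbf{V}}_{\boldsymbol{c}}^{-1}\boldsymbol{1})$ and $$\widehat{\boldsymbol{\omega}}_n^{(\mathrm{AMSE})}=\frac{(1+\widehat{\boldsymbol{B}}_{\boldsymbol{c}}^\top\widehat{\mathbf{V}}_{\boldsymbol{c}}^{-1}\widehat{\boldsymbol{B}}_{\boldsymbol{c}})\widehat{\mathbf{V}}_{\boldsymbol{c}}^{-1}\boldsymbol{1}-(\boldsymbol{1}^\top\widehat{\mathbf{V}}_{\boldsymbol{c}}^{-1}\widehat{\boldsymbol{B}}_{\boldsymbol{c}})\widehat{\mathbf{V}}_{\boldsymbol{c}}^{-1}\widehat{\boldsymbol{B}}_{\boldsymbol{c}}}{(1+\widehat{\boldsymbol{B}}_{\boldsymbol{c}}^\top\widehat{\mathbf{V}}_{\boldsymbol{c}}^{-1}\widehat{\boldsymbol{B}}_{\boldsymbol{c}})(\boldsymbol{1}^\top\widehat{\mathbf{V}}_{\boldsymbol{c}}^{-1}\boldsymbol{1})-(\boldsymbol{1}^\top\widehat{\mathbf{V}}_{\boldsymbol{c}}^{-1}\widehat{\boldsymbol{B}}_{\boldsymbol{c}})^2}$$ (defined with probability tending to 1). *)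

theory Defs
  imports "HOL-Probability.Probability"
begin

(* Vectors in R^m are indexed by a finite linearly ordered type 'm, so 'm plays the
   role of {1,...,m} with its order. *)

type_synonym 'm rvec = "(real, 'm) vec"
type_synonym 'm rmat = "((real, 'm) vec, 'm) vec"

definition first_idx :: "'m::{finite,linorder}" where
  "first_idx = Min UNIV"

definition marg_df :: "'w measure \<Rightarrow> ('w \<Rightarrow> 'm rvec) \<Rightarrow> 'm::finite \<Rightarrow> real \<Rightarrow> real" where
  "marg_df M X j = cdf (distr M borel (\<lambda>w. X w $ j))"

definition marg_sf :: "'w measure \<Rightarrow> ('w \<Rightarrow> 'm rvec) \<Rightarrow> 'm::finite \<Rightarrow> real \<Rightarrow> real" where
  "marg_sf M X j x = 1 - marg_df M X j x"

(* The quotient is taken in the extended reals so that 1/0 is infinite. *)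
definition tail_quantile :: "'w measure \<Rightarrow> ('w \<Rightarrow> 'm rvec) \<Rightarrow> 'm::finite \<Rightarrow> real \<Rightarrow> real" where
  "tail_quantile M X j t = Inf {x::real. 1 / ereal (marg_sf M X j x) \<ge> ereal t}"

definition condition_C2 ::
  "'w measure \<Rightarrow> ('w \<Rightarrow> 'm rvec) \<Rightarrow> 'm rvec \<Rightarrow> 'm rvec \<Rightarrow> ('m::finite \<Rightarrow> real \<Rightarrow> real) \<Rightarrow> bool" where
  "condition_C2 M X \<gamma> \<rho> A \<longleftrightarrow>
    (\<forall>j. \<gamma> $ j > 0 \<and> \<rho> $ j \<le> 0 \<and>
      ((\<forall>t>0. A j t > 0) \<or> (\<forall>t>0. A j t < 0)) \<and> (A j \<longlongrightarrow> 0) at_top \<and>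
      (\<forall>x>0. ((\<lambda>t. 1 / A j t *
                (tail_quantile M X j (t * x) / tail_quantile M X j t - x powr (\<gamma> $ j)))
              \<longlongrightarrow> x powr (\<gamma> $ j) *
                (if \<rho> $ j = 0 then ln x else (x powr (\<rho> $ j) - 1) / \<rho> $ j)) at_top))"

(* Arguments in [0,\<infinity>]: an infinite argument imposes no constraint on its coordinate. *)
definition surv_copula ::
  "'w measure \<Rightarrow> ('w \<Rightarrow> 'm rvec) \<Rightarrow> 'm::finite \<Rightarrow> 'm \<Rightarrow> ennreal \<Rightarrow> ennreal \<Rightarrow> real" where
  "surv_copula M X j l u v =
    measure M {w \<in> space M. ennreal (marg_sf M X j (X w $ j)) \<le> u \<and>
                            ennreal (marg_sf M X l (X w $ l)) \<le> v}"

definition condition_J ::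
  "'w measure \<Rightarrow> ('w \<Rightarrow> 'm rvec) \<Rightarrow> ('m::finite \<Rightarrow> 'm \<Rightarrow> ennreal \<Rightarrow> ennreal \<Rightarrow> real) \<Rightarrow> bool" where
  "condition_J M X R \<longleftrightarrow>
    (\<forall>j l. j \<noteq> l \<longrightarrow>
      (\<forall>x y. (x, y) \<noteq> (\<infinity>, \<infinity>) \<longrightarrow>
        ((\<lambda>s::real. s * surv_copula M X j l (x / ennreal s) (y / ennreal s))
          \<longlongrightarrow> R j l x y) at_top))"

definition sym_matrix :: "('m \<Rightarrow> real) \<Rightarrow> ('m \<Rightarrow> 'm \<Rightarrow> real) \<Rightarrow> ('m::{finite,linorder}) rmat" where
  "sym_matrix d f = (\<chi> j l. if j = l then d j else if j < l then f j l else f l j)"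

definition pos_definite :: "('m::finite) rmat \<Rightarrow> bool" where
  "pos_definite V \<longleftrightarrow> transpose V = V \<and> (\<forall>x. x \<noteq> 0 \<longrightarrow> x \<bullet> (V *v x) > 0)"

definition weights_Var :: "('m::finite) rmat \<Rightarrow> 'm rvec" where
  "weights_Var V = (matrix_inv V *v 1) /\<^sub>R (1 \<bullet> (matrix_inv V *v 1))"

definition weights_AMSE :: "'m rvec \<Rightarrow> ('m::finite) rmat \<Rightarrow> 'm rvec" where
  "weights_AMSE B V =
    ((1 + B \<bullet> (matrix_inv V *v B)) *\<^sub>R (matrix_inv V *v 1)
       - (1 \<bullet> (matrix_inv V *v B)) *\<^sub>R (matrix_inv V *v B))
    /\<^sub>R ((1 + B \<bullet> (matrix_inv V *v B)) * (1 \<bullet> (matrix_inv V *v 1))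
       - (1 \<bullet> (matrix_inv V *v B))\<^sup>2)"

definition B_asym :: "'m rvec \<Rightarrow> 'm rvec \<Rightarrow> 'm rvec \<Rightarrow> ('m::finite) rvec" where
  "B_asym c lam \<rho> =
    (\<chi> j. sqrt (\<Sum>i\<in>UNIV. 1 / c $ i) * (sqrt (c $ j) * (lam $ j / (1 - \<rho> $ j))))"

definition V_asym ::
  "real \<Rightarrow> 'm rvec \<Rightarrow> 'm rvec \<Rightarrow> ('m \<Rightarrow> 'm \<Rightarrow> ennreal \<Rightarrow> ennreal \<Rightarrow> real)
    \<Rightarrow> ('m::{finite,linorder}) rmat" where
  "V_asym \<gamma> c b R = sym_matrix
    (\<lambda>j. (\<Sum>i\<in>UNIV. 1 / c $ i) * \<gamma>\<^sup>2 * c $ j)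
    (\<lambda>j l. (\<Sum>i\<in>UNIV. 1 / c $ i) * \<gamma>\<^sup>2 * c $ j *
             R j l (ennreal (c $ l / c $ j)) (ennreal (b $ l / b $ j)))"

(* All statistics are functions of the data x, where x i $ j is the i-th observation
   (i \<ge> 1) in the j-th sample; nn j and kk j are the sample size and the number of
   upper order statistics used in the j-th sample. *)

definition order_stat :: "(nat \<Rightarrow> real) \<Rightarrow> nat \<Rightarrow> nat \<Rightarrow> real" where
  "order_stat y n i = sort (map y [1..<Suc n]) ! (i - 1)"

definition rank :: "(nat \<Rightarrow> real) \<Rightarrow> nat \<Rightarrow> nat \<Rightarrow> nat" where
  "rank y n i = card {p \<in> {1..n}. y p \<le> y i}"

definition hill :: "(nat \<Rightarrow> real) \<Rightarrow> nat \<Rightarrow> nat \<Rightarrow> real" where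
  "hill y n k =
    1 / real k * (\<Sum>i=1..k. ln (order_stat y n (n - i + 1) / order_stat y n (n - k)))"

definition gamma_hat ::
  "('m \<Rightarrow> nat) \<Rightarrow> ('m \<Rightarrow> nat) \<Rightarrow> (nat \<Rightarrow> 'm rvec) \<Rightarrow> ('m::finite) rvec \<Rightarrow> real" where
  "gamma_hat nn kk x \<omega> = (\<Sum>j\<in>UNIV. \<omega> $ j * hill (\<lambda>i. x i $ j) (nn j) (kk j))"

definition k_pair :: "('m \<Rightarrow> nat) \<Rightarrow> ('m \<Rightarrow> nat) \<Rightarrow> 'm \<Rightarrow> 'm \<Rightarrow> nat" where
  "k_pair nn kk j l = (if nn j < nn l then kk j else kk l)"

definition R_hat ::
  "('m \<Rightarrow> nat) \<Rightarrow> ('m \<Rightarrow> nat) \<Rightarrow> (nat \<Rightarrow> 'm rvec) \<Rightarrow> 'm::finite \<Rightarrow> 'm \<Rightarrow> real \<Rightarrow> real \<Rightarrow> real" where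
  "R_hat nn kk x j l u v =
    (let n = min (nn j) (nn l); k = k_pair nn kk j l;
         r = (\<lambda>q i. (real n + 1 - real (rank (\<lambda>p. x p $ q) n i))
                      / (real k * (real n + 1) / real n))
     in 1 / real k * real (card {i \<in> {1..n}. r j i \<le> u \<and> r l i \<le> v}))"

definition k_total :: "('m::finite \<Rightarrow> nat) \<Rightarrow> real" where
  "k_total kk = real (\<Sum>j\<in>UNIV. kk j)"

(* From here on the arguments \<beta> and \<rho> are the values of the estimators of the
   second-order parameters. On the asymptotically negligible event where V_hat is
   singular or a denominator vanishes, the weights take HOL's conventional values. *)
definition lambda_hat ::
  "('m \<Rightarrow> nat) \<Rightarrow> ('m \<Rightarrow> nat) \<Rightarrow> (nat \<Rightarrow> 'm rvec) \<Rightarrow> 'm rvec \<Rightarrow> 'm rvec \<Rightarrow> 'm rvec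
    \<Rightarrow> 'm::finite \<Rightarrow> real" where
  "lambda_hat nn kk x \<omega>0 \<beta> \<rho> j =
    sqrt (real (kk j)) * gamma_hat nn kk x \<omega>0 * \<beta> $ j
      * (real (nn j) / real (kk j)) powr (\<rho> $ j)"

definition B_hat ::
  "('m \<Rightarrow> nat) \<Rightarrow> ('m \<Rightarrow> nat) \<Rightarrow> (nat \<Rightarrow> 'm rvec) \<Rightarrow> 'm rvec \<Rightarrow> 'm rvec \<Rightarrow> 'm rvec
    \<Rightarrow> ('m::finite) rvec" where
  "B_hat nn kk x \<omega>0 \<beta> \<rho> =
    (\<chi> j. sqrt (k_total kk) *
      ((lambda_hat nn kk x \<omega>0 \<beta> \<rho> j / sqrt (real (kk j))) / (1 - \<rho> $ j)))"

definition V_hat ::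
  "('m \<Rightarrow> nat) \<Rightarrow> ('m \<Rightarrow> nat) \<Rightarrow> (nat \<Rightarrow> 'm rvec) \<Rightarrow> 'm rvec \<Rightarrow> ('m::{finite,linorder}) rmat" where
  "V_hat nn kk x \<omega>0 = sym_matrix
    (\<lambda>j. k_total kk * (gamma_hat nn kk x \<omega>0)\<^sup>2 / real (kk j))
    (\<lambda>j l. k_total kk * (gamma_hat nn kk x \<omega>0)\<^sup>2 * (1 / real (kk j)) *
             R_hat nn kk x j l (real (kk j) / real (kk l)) (real (nn j) / real (nn l)))"

definition omega_hat_Var ::
  "('m \<Rightarrow> nat) \<Rightarrow> ('m \<Rightarrow> nat) \<Rightarrow> (nat \<Rightarrow> 'm rvec) \<Rightarrow> 'm rvec \<Rightarrow> ('m::{finite,linorder}) rvec" where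
  "omega_hat_Var nn kk x \<omega>0 = weights_Var (V_hat nn kk x \<omega>0)"

definition omega_hat_AMSE ::
  "('m \<Rightarrow> nat) \<Rightarrow> ('m \<Rightarrow> nat) \<Rightarrow> (nat \<Rightarrow> 'm rvec) \<Rightarrow> 'm rvec \<Rightarrow> 'm rvec \<Rightarrow> 'm rvec
    \<Rightarrow> ('m::{finite,linorder}) rvec" where
  "omega_hat_AMSE nn kk x \<omega>0 \<beta> \<rho> =
    weights_AMSE (B_hat nn kk x \<omega>0 \<beta> \<rho>) (V_hat nn kk x \<omega>0)"

definition gamma_bar ::
  "('m \<Rightarrow> nat) \<Rightarrow> ('m \<Rightarrow> nat) \<Rightarrow> (nat \<Rightarrow> 'm rvec) \<Rightarrow> 'm rvec \<Rightarrow> 'm rvec \<Rightarrow> 'm rvec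
    \<Rightarrow> ('m::finite) rvec \<Rightarrow> real" where
  "gamma_bar nn kk x \<omega>0 \<beta> \<rho> \<omega> =
    gamma_hat nn kk x \<omega> - 1 / sqrt (k_total kk) * (\<omega> \<bullet> B_hat nn kk x \<omega>0 \<beta> \<rho>)"

definition tendsto_in_prob :: "'w measure \<Rightarrow> (nat \<Rightarrow> 'w \<Rightarrow> real) \<Rightarrow> real \<Rightarrow> bool" where
  "tendsto_in_prob M Y a \<longleftrightarrow>
    (\<forall>\<epsilon>>0. (\<lambda>n. measure M {w \<in> space M. \<bar>Y n w - a\<bar> > \<epsilon>}) \<longlonglongrightarrow> 0)"

(* The parameter v is the variance; a genuine density requires v > 0. *)
definition normal_law :: "real \<Rightarrow> real \<Rightarrow> real measure" where
  "normal_law \<mu> v = density lborel (\<lambda>x. ennreal (normal_density \<mu> (sqrt v) x))"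

definition tendsto_in_distr :: "'w measure \<Rightarrow> (nat \<Rightarrow> 'w \<Rightarrow> real) \<Rightarrow> real measure \<Rightarrow> bool" where
  "tendsto_in_distr M Y \<mu> \<longleftrightarrow> weak_conv_m (\<lambda>n. distr M borel (Y n)) \<mu>"

end

theory Submission
  imports Defs
begin

text \<open>
  On the scale \<open>E\<^sub>i\<^sub>j = - ln (1 - F\<^sub>j X\<^sub>i\<^sub>j)\<close> all margins are standard exponential and
  \<open>X\<^sub>i\<^sub>j\<close> is almost surely a nondecreasing function of \<open>E\<^sub>i\<^sub>j\<close>, whose logarithm is affine up to
  a term \<open>a exp (\<rho> e) (1 + o(1))\<close>. With \<open>s = ln (n/k)\<close>, linearising the random threshold by
  Ghosh's argument turns each Hill estimator into the sum of \<open>(E - s - 1) 1{E > s}\<close> over the sample,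
  plus a deterministic bias and a negligible term. Linear combinations of these sums are row-wise
  independent arrays, so Lyapunov's theorem applies; the tail copula enters only through the limit of
  the covariances. The estimated weights and biases converge in probability, so the bias cancels and
  Slutsky's lemma, carried out on characteristic functions, finishes the proof.
\<close>

section \<open>Convergence in probability as convergence along a filter\<close>

text \<open>The Hill estimator averages over a random level T, the (k+1)-st largest value. Ghosh's
  argument avoids uniform convergence over levels: the counts at finitely many deterministic levels
  s + y / sqrt k differ from the count at s by -y sqrt k up to a smaller error, and this alone
  locates T. Moving the level from s to T then changes the excess sum by about -k (T - s),
  asymptotically the negative centred count at s; the 1 in E - s - 1 is its trace, and it centres
  the summand. Homogeneity of the tail copula does the work twice. The covariance of two summands
  contains integrals of the copula, which cancel because excesses scale by exp (- h) when both
  levels rise by h, and a single value remains. The bounds on the empirical copula, at levels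
  shifted by \<delta>, are exp \<delta> and exp (- \<delta>) times one value, so they close up.
  Weights and biases are nonlinear in the estimated quantities, through inverse matrices and
  quotients. Encoding convergence in probability as a filter on pairs (n, w) lets the ordinary
  calculus of limits handle them.\<close>

definition prob_filter :: "'w measure \<Rightarrow> (nat \<times> 'w) filter" where
  "prob_filter M = Abs_filter (\<lambda>P. \<forall>\<delta>>0. \<forall>\<^sub>F n in sequentially.
     \<exists>A\<in>sets M. measure M A \<le> \<delta> \<and> {w\<in>space M. \<not> P (n, w)} \<subseteq> A)"

context prob_space
begin

text \<open>The bad set need only lie inside a small event, so it may itself fail to be measurable.
  Closure under conjunction gives each bad set half of \<delta> and takes the union of the two
  covering events.\<close>

lemma eventually_prob_filter:
  "eventually P (prob_filter M) \<longleftrightarrow> (\<forall>\<delta>>0. \<forall>\<^sub>F n in sequentially.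
     \<exists>A\<in>sets M. measure M A \<le> \<delta> \<and> {w\<in>space M. \<not> P (n, w)} \<subseteq> A)"
  unfolding prob_filter_def
proof (rule eventually_Abs_filter, rule is_filter.intro)
  show "\<forall>\<delta>>0. \<forall>\<^sub>F n in sequentially.
     \<exists>A\<in>sets M. measure M A \<le> \<delta> \<and> {w\<in>space M. \<not> True} \<subseteq> A"
    by (intro allI impI always_eventually bexI[of _ "{}"]) auto
next
  fix P Q :: "nat \<times> 'a \<Rightarrow> bool"
  assume P: "\<forall>\<delta>>0. \<forall>\<^sub>F n in sequentially. \<exists>A\<in>sets M. measure M A \<le> \<delta> \<and> {w\<in>space M. \<not> P (n, w)} \<subseteq> A"
    and Q: "\<forall>\<delta>>0. \<forall>\<^sub>F n in sequentially. \<exists>A\<in>sets M. measure M A \<le> \<delta> \<and> {w\<in>space M. \<not> Q (n, w)} \<subseteq> A"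
  show "\<forall>\<delta>>0. \<forall>\<^sub>F n in sequentially.
     \<exists>A\<in>sets M. measure M A \<le> \<delta> \<and> {w\<in>space M. \<not> (P (n, w) \<and> Q (n, w))} \<subseteq> A"
  proof (intro allI impI)
    fix \<delta> :: real assume "\<delta> > 0"
    then have "\<delta> / 2 > 0" by simp
    from P[rule_format, OF this] Q[rule_format, OF this]
    show "\<forall>\<^sub>F n in sequentially.
       \<exists>A\<in>sets M. measure M A \<le> \<delta> \<and> {w\<in>space M. \<not> (P (n, w) \<and> Q (n, w))} \<subseteq> A"
    proof eventually_elim
      case (elim n)
      then obtain A B where "A \<in> sets M" "measure M A \<le> \<delta> / 2" "{w\<in>space M. \<not> P (n, w)} \<subseteq> A"
        "B \<in> sets M" "measure M B \<le> \<delta> / 2" "{w\<in>space M. \<not> Q (n, w)} \<subseteq> B" by blast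
      moreover from this have "measure M (A \<union> B) \<le> \<delta>"
        using measure_Un_le[of A M B] by simp
      ultimately show ?case by (intro bexI[of _ "A \<union> B"]) auto
    qed
  qed
next
  fix P Q :: "nat \<times> 'a \<Rightarrow> bool"
  assume "\<forall>x. P x \<longrightarrow> Q x"
    and P: "\<forall>\<delta>>0. \<forall>\<^sub>F n in sequentially. \<exists>A\<in>sets M. measure M A \<le> \<delta> \<and> {w\<in>space M. \<not> P (n, w)} \<subseteq> A"
  then have "\<And>n. {w\<in>space M. \<not> Q (n, w)} \<subseteq> {w\<in>space M. \<not> P (n, w)}" by auto
  with P show "\<forall>\<delta>>0. \<forall>\<^sub>F n in sequentially.
      \<exists>A\<in>sets M. measure M A \<le> \<delta> \<and> {w\<in>space M. \<not> Q (n, w)} \<subseteq> A"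
    by (smt (verit, best) eventually_mono subset_trans)
qed

text \<open>Once n is large the empty event covers all failures, so deterministic and random limits
  can be mixed in one expression.\<close>

lemma filterlim_fst_prob_filter: "filterlim fst sequentially (prob_filter M)"
  unfolding filterlim_iff eventually_prob_filter
proof (intro allI impI)
  fix P :: "nat \<Rightarrow> bool" and \<delta> :: real
  assume "eventually P sequentially" "\<delta> > 0"
  then show "\<forall>\<^sub>F n in sequentially.
      \<exists>A\<in>events. prob A \<le> \<delta> \<and> {w \<in> space M. \<not> P (fst (n, w))} \<subseteq> A"
    by (auto elim!: eventually_mono intro!: bexI[of _ "{}"])
qed

lemmas tendsto_fst_prob_filter = filterlim_compose[OF _ filterlim_fst_prob_filter]

lemma eventually_fst_prob_filter:
  "eventually P sequentially \<Longrightarrow> \<forall>\<^sub>F z in prob_filter M. P (fst z)"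
  using filterlim_fst_prob_filter by (auto simp: filterlim_iff)

text \<open>One null set, the same for every n, covers all failures. Almost sure facts about the
  sample enter the limit arguments this way.\<close>

lemma AE_imp_eventually_prob_filter:
  assumes "AE w in M. \<forall>n. P n w"
  shows "\<forall>\<^sub>F z in prob_filter M. P (fst z) (snd z)"
proof -
  from assms obtain A where A: "{w\<in>space M. \<not> (\<forall>n. P n w)} \<subseteq> A" "A \<in> sets M" "emeasure M A = 0"
    by (rule AE_E)
  then show ?thesis
    unfolding eventually_prob_filter
    by (intro allI impI always_eventually bexI[of _ A]) (auto simp: measure_def)
qed

lemma tendsto_in_prob_imp_prob_filter:
  assumes "tendsto_in_prob M Y a" and meas: "\<And>n. Y n \<in> borel_measurable M"
  shows "((\<lambda>z. Y (fst z) (snd z)) \<longlongrightarrow> a) (prob_filter M)"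
  unfolding tendsto_iff eventually_prob_filter
proof (intro allI impI)
  fix e \<delta> :: real assume "e > 0" "\<delta> > 0"
  \<comment> \<open>Failure of \<open>dist < e\<close> is a deviation of at least e, whereas
    \<open>tendsto_in_prob\<close> measures strict exceedances; halving e bridges the two.\<close>
  then have "(\<lambda>n. measure M {w \<in> space M. \<bar>Y n w - a\<bar> > e / 2}) \<longlonglongrightarrow> 0"
    using assms(1) unfolding tendsto_in_prob_def by (meson half_gt_zero)
  from order_tendstoD(2)[OF this \<open>\<delta> > 0\<close>]
  show "\<forall>\<^sub>F n in sequentially. \<exists>A\<in>sets M. measure M A \<le> \<delta> \<and>
      {w \<in> space M. \<not> dist (Y (fst (n, w)) (snd (n, w))) a < e} \<subseteq> A"
  proof eventually_elim
    case (elim n)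
    note meas[measurable]
    show ?case
      using elim \<open>e > 0\<close>
      by (intro bexI[of _ "{w \<in> space M. \<bar>Y n w - a\<bar> > e / 2}"]) (auto simp: dist_real_def)
  qed
qed

lemma second_moment_inequality:
  fixes Y :: "'a \<Rightarrow> real"
  assumes Y: "Y \<in> borel_measurable M" "integrable M (\<lambda>w. (Y w)\<^sup>2)" and "a > 0"
  shows "prob {w\<in>space M. \<bar>Y w\<bar> \<ge> a} \<le> expectation (\<lambda>w. (Y w)\<^sup>2) / a\<^sup>2"
proof -
  have "{w\<in>space M. \<bar>Y w\<bar> \<ge> a} = {w\<in>space M. (Y w)\<^sup>2 \<ge> a\<^sup>2}"
    using \<open>a > 0\<close> by (auto simp: abs_le_square_iff[symmetric])
  also have "prob \<dots> \<le> expectation (\<lambda>w. (Y w)\<^sup>2) / a\<^sup>2"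
    using \<open>a > 0\<close> by (intro integral_Markov_inequality_measure[OF Y(2), where A="{}"]) auto
  finally show ?thesis .
qed

text \<open>A bounded second moment makes W tight, so by Chebyshev an asymptotic statement needs
  checking only where |W| stays below a fixed level L.\<close>

lemma tight_eventuallyI:
  fixes W :: "nat \<Rightarrow> 'a \<Rightarrow> real"
  assumes W: "\<And>n. W n \<in> borel_measurable M" "\<And>n. integrable M (\<lambda>w. (W n w)\<^sup>2)"
    and bd: "\<forall>\<^sub>F n in sequentially. expectation (\<lambda>w. (W n w)\<^sup>2) \<le> C"
    and ev: "\<And>L. L > 0 \<Longrightarrow> \<forall>\<^sub>F z in prob_filter M. \<bar>W (fst z) (snd z)\<bar> < L \<longrightarrow> P z"
  shows "eventually P (prob_filter M)"
  unfolding eventually_prob_filter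
proof (intro allI impI)
  fix \<delta> :: real assume "\<delta> > 0"
  \<comment> \<open>Chebyshev at this L leaves at most \<delta> / 2 for the event |W| >= L; the
    summand 1 keeps L positive whatever the value of C.\<close>
  define L where "L = sqrt (2 * (\<bar>C\<bar> + 1) / \<delta>)"
  have L: "L > 0" "L\<^sup>2 = 2 * (\<bar>C\<bar> + 1) / \<delta>"
    using \<open>\<delta> > 0\<close> by (auto simp: L_def)
  have "\<delta> / 2 > 0" using \<open>\<delta> > 0\<close> by simp
  from ev[OF L(1), unfolded eventually_prob_filter, rule_format, OF this] bd
  show "\<forall>\<^sub>F n in sequentially. \<exists>A\<in>sets M. measure M A \<le> \<delta> \<and> {w\<in>space M. \<not> P (n, w)} \<subseteq> A"
  proof eventually_elim
    case (elim n)
    then obtain A where A: "A \<in> events" "prob A \<le> \<delta> / 2"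
      "{w \<in> space M. \<not> (\<bar>W n w\<bar> < L \<longrightarrow> P (n, w))} \<subseteq> A" by auto
    let ?B = "{w\<in>space M. \<bar>W n w\<bar> \<ge> L}"
    note W(1)[measurable]
    have LL: "L\<^sup>2 \<ge> 0" by simp
    have "prob ?B \<le> expectation (\<lambda>w. (W n w)\<^sup>2) / L\<^sup>2"
      by (rule second_moment_inequality[OF W L(1)])
    also have "\<dots> \<le> (\<bar>C\<bar> + 1) / L\<^sup>2"
      using elim LL by (intro divide_right_mono) linarith+
    also have "\<dots> = \<delta> / 2"
      using \<open>\<delta> > 0\<close> unfolding L(2) by (simp add: field_simps add_eq_0_iff)
    finally have "prob (A \<union> ?B) \<le> \<delta>"
      using measure_Un_le[of A M ?B] A by simp
    with A show ?case
      by (intro bexI[of _ "A \<union> ?B"]) (force simp: not_less)+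
  qed
qed

text \<open>Where |W| < L it is enough that the other factor is below e / L.\<close>

lemma tight_mult_tendsto_0:
  fixes W :: "nat \<Rightarrow> 'a \<Rightarrow> real"
  assumes W: "\<And>n. W n \<in> borel_measurable M" "\<And>n. integrable M (\<lambda>w. (W n w)\<^sup>2)"
    and bd: "\<forall>\<^sub>F n in sequentially. expectation (\<lambda>w. (W n w)\<^sup>2) \<le> C"
    and D: "(D \<longlongrightarrow> 0) (prob_filter M)"
  shows "((\<lambda>z. D z * W (fst z) (snd z)) \<longlongrightarrow> 0) (prob_filter M)"
  unfolding tendsto_iff
proof (intro allI impI, rule tight_eventuallyI[OF W bd])
  fix e L :: real assume "e > 0" "L > 0"
  then have "\<forall>\<^sub>F z in prob_filter M. dist (D z) 0 < e / L"
    using D by (auto simp: tendsto_iff)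
  then show "\<forall>\<^sub>F z in prob_filter M. \<bar>W (fst z) (snd z)\<bar> < L \<longrightarrow>
      dist (D z * W (fst z) (snd z)) 0 < e"
  proof eventually_elim
    case (elim z)
    show ?case
    proof
      assume "\<bar>W (fst z) (snd z)\<bar> < L"
      then have "\<bar>D z\<bar> * \<bar>W (fst z) (snd z)\<bar> \<le> \<bar>D z\<bar> * L" by (intro mult_left_mono) auto
      also have "\<dots> < e" using elim \<open>L > 0\<close> by (simp add: field_simps)
      finally show "dist (D z * W (fst z) (snd z)) 0 < e" by (simp add: abs_mult)
    qed
  qed
qed

lemma second_moment_tendsto_0:
  fixes W :: "nat \<Rightarrow> 'a \<Rightarrow> real"
  assumes W: "\<And>n. W n \<in> borel_measurable M" "\<And>n. integrable M (\<lambda>w. (W n w)\<^sup>2)"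
    and bd: "(\<lambda>n. expectation (\<lambda>w. (W n w)\<^sup>2)) \<longlonglongrightarrow> 0"
  shows "((\<lambda>z. W (fst z) (snd z)) \<longlongrightarrow> 0) (prob_filter M)"
  unfolding tendsto_iff eventually_prob_filter
proof (intro allI impI)
  fix e \<delta> :: real assume "e > 0" "\<delta> > 0"
  have "(\<lambda>n. expectation (\<lambda>w. (W n w)\<^sup>2) / e\<^sup>2) \<longlonglongrightarrow> 0 / e\<^sup>2"
    using \<open>e > 0\<close> by (intro tendsto_divide bd) auto
  then have "\<forall>\<^sub>F n in sequentially. expectation (\<lambda>w. (W n w)\<^sup>2) / e\<^sup>2 < \<delta>"
    using \<open>\<delta> > 0\<close> by (intro order_tendstoD(2)) auto
  then show "\<forall>\<^sub>F n in sequentially. \<exists>A\<in>sets M. measure M A \<le> \<delta> \<and>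
      {w \<in> space M. \<not> dist (W (fst (n, w)) (snd (n, w))) 0 < e} \<subseteq> A"
  proof eventually_elim
    case (elim n)
    note W(1)[measurable]
    show ?case
      using elim second_moment_inequality[OF W \<open>e > 0\<close>, of n]
      by (intro bexI[of _ "{w \<in> space M. \<bar>W n w\<bar> \<ge> e}"]) auto
  qed
qed

text \<open>Slutsky's lemma at a single frequency: outside the bad event the two exponentials differ
  by at most |t| e, and on it by at most 2.\<close>

lemma char_slutsky:
  fixes Y S :: "nat \<Rightarrow> 'a \<Rightarrow> real"
  assumes Y: "\<And>n. Y n \<in> borel_measurable M" and S: "\<And>n. S n \<in> borel_measurable M"
    and D: "((\<lambda>z. Y (fst z) (snd z) - S (fst z) (snd z)) \<longlongrightarrow> 0) (prob_filter M)"
    and lim: "(\<lambda>n. char (distr M borel (S n)) t) \<longlonglongrightarrow> l"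
  shows "(\<lambda>n. char (distr M borel (Y n)) t) \<longlonglongrightarrow> l"
proof -
  note Y[measurable] S[measurable]
  have "(\<lambda>n. char (distr M borel (Y n)) t - char (distr M borel (S n)) t) \<longlonglongrightarrow> 0"
  proof (rule LIMSEQ_I)
    fix r :: real assume "r > 0"
    \<comment> \<open>With this e the good part contributes at most r / 4, and a bad event of
      probability at most r / 8 contributes at most another r / 4.\<close>
    define e where "e = r / (4 * (\<bar>t\<bar> + 1))"
    have e: "e > 0" using \<open>r > 0\<close> by (simp add: e_def add_nonneg_pos)
    have te: "\<bar>t\<bar> * e \<le> r / 4" using \<open>r > 0\<close> by (simp add: e_def field_simps)
    have "r / 8 > 0" using \<open>r > 0\<close> by simp
    from D[unfolded tendsto_iff eventually_prob_filter, rule_format, OF e this]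
    have "\<forall>\<^sub>F n in sequentially. norm (char (distr M borel (Y n)) t - char (distr M borel (S n)) t - 0) < r"
    proof eventually_elim
      case (elim n)
      then obtain A where A: "A \<in> events" "prob A \<le> r / 8"
        "{w \<in> space M. \<not> \<bar>Y n w - S n w\<bar> < e} \<subseteq> A" by (auto simp: dist_real_def)
      have int: "integrable M (\<lambda>w. iexp (t * Y n w))" "integrable M (\<lambda>w. iexp (t * S n w))"
        by (intro integrable_iexp; simp)+
      have iA: "integrable M (\<lambda>w. r / 4 + 2 * indicator A w :: real)"
        using A by (intro Bochner_Integration.integrable_add integrable_mult_right) (auto simp: less_top[symmetric])
      have "char (distr M borel (Y n)) t - char (distr M borel (S n)) t =
          (CLINT w|M. iexp (t * Y n w) - iexp (t * S n w))"
        unfolding char_def using int by (simp add: integral_distr)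
      also have "norm \<dots> \<le> (LINT w|M. norm (iexp (t * Y n w) - iexp (t * S n w)))"
        by (rule integral_norm_bound)
      also have "\<dots> \<le> (LINT w|M. r / 4 + 2 * indicator A w)"
      proof (rule integral_mono[OF _ iA])
        show "integrable M (\<lambda>w. norm (iexp (t * Y n w) - iexp (t * S n w)))"
          using int by (intro integrable_norm Bochner_Integration.integrable_diff)
        fix w assume w: "w \<in> space M"
        show "norm (iexp (t * Y n w) - iexp (t * S n w)) \<le> r / 4 + 2 * indicator A w"
        proof (cases "w \<in> A")
          case True
          have "norm (iexp (t * Y n w) - iexp (t * S n w)) \<le> norm (iexp (t * Y n w)) + norm (iexp (t * S n w))"
            by (rule norm_triangle_ineq4)
          then show ?thesis using True \<open>r > 0\<close> by simp
        next
          case False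
          have "iexp (t * Y n w) - iexp (t * S n w) =
              iexp (t * S n w) * (iexp (t * (Y n w - S n w)) - 1)"
            by (simp add: algebra_simps flip: exp_add)
          then have "norm (iexp (t * Y n w) - iexp (t * S n w)) = norm (iexp (t * (Y n w - S n w)) - 1)"
            by (simp add: norm_mult)
          also have "\<dots> \<le> \<bar>t * (Y n w - S n w)\<bar>"
            using iexp_approx1[of "t * (Y n w - S n w)" 0] by simp
          also have "\<dots> \<le> \<bar>t\<bar> * e"
            using False A(3) w unfolding abs_mult by (intro mult_left_mono) (auto simp: not_less)
          finally show ?thesis using te False by simp
        qed
      qed
      also have "\<dots> = r / 4 + 2 * prob A"
        using A by (subst Bochner_Integration.integral_add)
          (auto simp: prob_space less_top[symmetric])
      also have "\<dots> < r" using A \<open>r > 0\<close> by simp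
      finally show ?case by simp
    qed
    then show "\<exists>no. \<forall>n\<ge>no. norm (char (distr M borel (Y n)) t - char (distr M borel (S n)) t - 0) < r"
      by (simp add: eventually_sequentially)
  qed
  from tendsto_add[OF this lim] show ?thesis by simp
qed

section \<open>The Lyapunov central limit theorem for triangular arrays\<close>

text \<open>In the induction the new variable is independent of the sum of the others and both are
  centred, so the cross term has mean zero.\<close>

lemma expectation_sum_squares_indep:
  fixes \<xi> :: "'i \<Rightarrow> 'a \<Rightarrow> real"
  assumes "finite I" "indep_vars (\<lambda>_. borel) \<xi> I"
    and "\<And>i. i \<in> I \<Longrightarrow> integrable M (\<lambda>w. (\<xi> i w)\<^sup>2)"
    and "\<And>i. i \<in> I \<Longrightarrow> expectation (\<xi> i) = 0"
  shows "integrable M (\<lambda>w. (\<Sum>i\<in>I. \<xi> i w)\<^sup>2) \<and>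
    expectation (\<lambda>w. (\<Sum>i\<in>I. \<xi> i w)\<^sup>2) = (\<Sum>i\<in>I. expectation (\<lambda>w. (\<xi> i w)\<^sup>2))"
  using assms
proof (induction I rule: finite_induct)
  case (insert x F)
  have sq: "integrable M (\<lambda>w. (\<xi> x w)\<^sup>2)" "integrable M (\<lambda>w. (\<Sum>i\<in>F. \<xi> i w)\<^sup>2)"
    and eqF: "expectation (\<lambda>w. (\<Sum>i\<in>F. \<xi> i w)\<^sup>2) = (\<Sum>i\<in>F. expectation (\<lambda>w. (\<xi> i w)\<^sup>2))"
    using insert indep_vars_subset[of "\<lambda>_. borel" \<xi> "insert x F" F] by auto
  have [measurable]: "\<xi> i \<in> borel_measurable M" if "i \<in> insert x F" for i
    using insert.prems(1) that by (auto simp: indep_vars_def2)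
  have i1: "integrable M (\<xi> x)" "integrable M (\<lambda>w. \<Sum>i\<in>F. \<xi> i w)"
    using sq by (auto intro!: square_integrable_imp_integrable)
  have ind: "indep_var borel (\<xi> x) borel (\<lambda>w. \<Sum>i\<in>F. \<xi> i w)"
    by (rule indep_vars_sum) (use insert in auto)
  note ip = indep_var_integrable[OF ind i1] indep_var_lebesgue_integral[OF ind i1]
  have "(\<lambda>w. (\<Sum>i\<in>insert x F. \<xi> i w)\<^sup>2) =
      (\<lambda>w. (\<xi> x w)\<^sup>2 + 2 * (\<xi> x w * (\<Sum>i\<in>F. \<xi> i w)) + (\<Sum>i\<in>F. \<xi> i w)\<^sup>2)"
    using insert.hyps by (auto simp: power2_eq_square algebra_simps fun_eq_iff)
  then show ?case
    using sq ip eqF insert by simp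
qed auto

text \<open>The tangent at 0 bounds exp (- a) from below. For the upper bound, the third-order
  Lagrange remainder is negative when a > 0.\<close>

lemma norm_one_minus_exp_neg_le:
  fixes a :: real assumes "a \<ge> 0"
  shows "\<bar>1 - a - exp (- a)\<bar> \<le> a\<^sup>2 / 2"
proof -
  have 1: "1 - a \<le> exp (-a)" using exp_ge_add_one_self[of "-a"] by simp
  have "exp (-a) \<le> 1 - a + a\<^sup>2 / 2"
  proof (cases "a = 0")
    case False
    then have "a > 0" using assms by simp
    have "(\<Sum>m<3. (-a)^m / fact m) = 1 - a + a\<^sup>2 / 2"
      by (simp add: numeral_3_eq_3 power2_eq_square)
    moreover obtain u where "\<bar>u\<bar> \<le> \<bar>-a\<bar>" "exp (-a) = (\<Sum>m<3. (-a)^m / fact m) + exp u / fact 3 * (-a)^3"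
      using Maclaurin_exp_le[of "-a" 3] by blast
    ultimately show ?thesis using \<open>a > 0\<close> by (simp add: mult_nonneg_nonneg)
  qed auto
  with 1 show ?thesis by simp
qed

text \<open>Each characteristic function is compared with that of a centred Gaussian of the same
  variance, and the difference of products is bounded by the sum of differences. The conclusion
  stays at the level of characteristic functions because \<open>char_slutsky\<close> consumes it
  there.\<close>

theorem lyapunov_clt_char:
  fixes \<xi> :: "nat \<Rightarrow> nat \<Rightarrow> 'a \<Rightarrow> real" and I :: "nat \<Rightarrow> nat set"
  assumes ind: "\<And>n. indep_vars (\<lambda>_. borel) (\<xi> n) (I n)"
    and fin: "\<And>n. finite (I n)"
    and int4: "\<And>n i. i \<in> I n \<Longrightarrow> integrable M (\<lambda>w. (\<xi> n i w)^4)"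
    and mean: "\<And>n i. i \<in> I n \<Longrightarrow> expectation (\<xi> n i) = 0"
    and var: "(\<lambda>n. \<Sum>i\<in>I n. expectation (\<lambda>w. (\<xi> n i w)\<^sup>2)) \<longlonglongrightarrow> v"
    and m4: "(\<lambda>n. \<Sum>i\<in>I n. expectation (\<lambda>w. (\<xi> n i w)^4)) \<longlonglongrightarrow> 0"
  shows "(\<lambda>n. char (distr M borel (\<lambda>w. \<Sum>i\<in>I n. \<xi> n i w)) t) \<longlonglongrightarrow> of_real (exp (- (t\<^sup>2 * v / 2)))"
proof -
  define s2 where "s2 n i = expectation (\<lambda>w. (\<xi> n i w)\<^sup>2)" for n i
  define s4 where "s4 n i = expectation (\<lambda>w. (\<xi> n i w)^4)" for n i
  define S4 where "S4 n = (\<Sum>i\<in>I n. s4 n i)" for n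
  define S2 where "S2 n = (\<Sum>i\<in>I n. s2 n i)" for n
  \<comment> \<open>Weight for splitting a third moment between the second and the fourth. The value
    sqrt S4 balances the two error terms, since then S4 / \<eta> is at most sqrt S4; the summand 1 /
    Suc n keeps \<eta> positive when S4 vanishes.\<close>
  define \<eta> where "\<eta> n = sqrt (S4 n) + 1 / real (Suc n)" for n
  have meas[measurable]: "\<xi> n i \<in> borel_measurable M" if "i \<in> I n" for n i
    using ind[of n] that by (auto simp: indep_vars_def2)
  have int2: "integrable M (\<lambda>w. (\<xi> n i w)\<^sup>2)" if "i \<in> I n" for n i
    using int4[OF that] meas[OF that]
    by (intro square_integrable_imp_integrable[of "\<lambda>w. (\<xi> n i w)\<^sup>2"]) (auto simp: power_mult[symmetric])
  have int1: "integrable M (\<xi> n i)" if "i \<in> I n" for n i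
    using int2[OF that] meas[OF that] by (rule square_integrable_imp_integrable[rotated])
  have s2_nn: "s2 n i \<ge> 0" "s4 n i \<ge> 0" for n i by (auto simp: s2_def s4_def)
  have S4_nn: "S4 n \<ge> 0" for n by (auto simp: S4_def s2_nn sum_nonneg)
  have \<eta>: "\<eta> n > 0" for n using S4_nn[of n] by (simp add: \<eta>_def add_nonneg_pos)
  have s2s4: "(s2 n i)\<^sup>2 \<le> s4 n i" if "i \<in> I n" for n i
  proof -
    \<comment> \<open>Jensen's inequality for squares, read off from the nonnegative variance of the
      squared variable.\<close>
    have "0 \<le> variance (\<lambda>w. (\<xi> n i w)\<^sup>2)" by (rule variance_positive)
    also have "\<dots> = s4 n i - (s2 n i)\<^sup>2"
      using int2[OF that] int4[OF that] by (subst variance_eq) (auto simp: s2_def s4_def power_mult[symmetric])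
    finally show ?thesis by simp
  qed
  have one: "norm (char (distr M borel (\<xi> n i)) t - of_real (exp (- (t\<^sup>2 * s2 n i / 2))))
     \<le> t^2 * \<bar>t\<bar> / 12 * (\<eta> n * s2 n i + s4 n i / \<eta> n) + t^4 / 8 * s4 n i" if i: "i \<in> I n" for n i
  proof -
    have "norm (char (distr M borel (\<xi> n i)) t - (1 - t\<^sup>2 * s2 n i / 2))
        \<le> (t^2 / 6) * expectation (\<lambda>w. min (6 * (\<xi> n i w)^2) (\<bar>t\<bar> * \<bar>\<xi> n i w\<bar>^3))"
      using i int1 int2 mean by (intro char_approx3') (auto simp: s2_def)
    also have "\<dots> \<le> (t^2 / 6) * expectation (\<lambda>w. \<bar>t\<bar> / 2 * (\<eta> n * (\<xi> n i w)\<^sup>2 + (\<xi> n i w)^4 / \<eta> n))"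
    proof (intro mult_left_mono integral_mono)
      show "integrable M (\<lambda>w. \<bar>t\<bar> / 2 * (\<eta> n * (\<xi> n i w)\<^sup>2 + (\<xi> n i w)^4 / \<eta> n))"
        using int2[OF i] int4[OF i] by auto
      show "integrable M (\<lambda>w. min (6 * (\<xi> n i w)^2) (\<bar>t\<bar> * \<bar>\<xi> n i w\<bar>^3))"
      proof (rule Bochner_Integration.integrable_bound)
        show "integrable M (\<lambda>w. 6 * (\<xi> n i w)^2)" using int2[OF i] by simp
        show "(\<lambda>w. min (6 * (\<xi> n i w)^2) (\<bar>t\<bar> * \<bar>\<xi> n i w\<bar>^3)) \<in> borel_measurable M"
          using meas[OF i] by measurable
        have "\<bar>min (6 * x^2) (\<bar>t\<bar> * \<bar>x\<bar>^3)\<bar> \<le> \<bar>6 * x^2\<bar>" for x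
        proof -
          have "0 \<le> 6 * x^2" "0 \<le> \<bar>t\<bar> * \<bar>x\<bar>^3" by simp_all
          then show ?thesis by linarith
        qed
        then show "AE w in M. norm (min (6 * (\<xi> n i w)^2) (\<bar>t\<bar> * \<bar>\<xi> n i w\<bar>^3)) \<le> norm (6 * (\<xi> n i w)^2)"
          unfolding real_norm_def by (intro AE_I2)
      qed
      fix w
      let ?x = "\<xi> n i w"
      \<comment> \<open>Expanding this square gives 2 |x|^3 <= \<eta> x^2 + x^4 / \<eta>, which
        trades the cubic error for second and fourth moments.\<close>
      have "0 \<le> (\<eta> n - \<bar>?x\<bar>)\<^sup>2 * ?x\<^sup>2 / \<eta> n" using \<eta>[of n] by simp
      also have "\<dots> = \<eta> n * ?x\<^sup>2 + ?x^4 / \<eta> n - 2 * \<bar>?x\<bar>^3"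
        using \<eta>[of n] by (simp add: field_simps power2_diff power4_eq_xxxx power3_eq_cube power2_eq_square abs_if)
      finally have "\<bar>t\<bar> * (2 * \<bar>?x\<bar>^3) \<le> \<bar>t\<bar> * (\<eta> n * ?x\<^sup>2 + ?x^4 / \<eta> n)"
        by (intro mult_left_mono) auto
      then show "min (6 * ?x^2) (\<bar>t\<bar> * \<bar>?x\<bar>^3) \<le> \<bar>t\<bar> / 2 * (\<eta> n * ?x\<^sup>2 + ?x^4 / \<eta> n)"
        by (simp add: field_simps)
    qed auto
    also have "\<dots> = t^2 * \<bar>t\<bar> / 12 * (\<eta> n * s2 n i + s4 n i / \<eta> n)"
      using int2[OF i] int4[OF i] by (simp add: s2_def s4_def)
    finally have 1: "norm (char (distr M borel (\<xi> n i)) t - complex_of_real (1 - t\<^sup>2 * s2 n i / 2))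
       \<le> t^2 * \<bar>t\<bar> / 12 * (\<eta> n * s2 n i + s4 n i / \<eta> n)" by simp
    have "norm (complex_of_real (1 - t\<^sup>2 * s2 n i / 2) - complex_of_real (exp (- (t\<^sup>2 * s2 n i / 2))))
       = \<bar>(1 - t\<^sup>2 * s2 n i / 2) - exp (- (t\<^sup>2 * s2 n i / 2))\<bar>"
      unfolding norm_of_real[symmetric, where 'a=complex] by simp
    also have "\<dots> \<le> (t\<^sup>2 * s2 n i / 2)\<^sup>2 / 2"
      using s2_nn by (intro norm_one_minus_exp_neg_le) auto
    also have "\<dots> = t^4 / 8 * (s2 n i)\<^sup>2" by (simp add: field_simps power2_eq_square power4_eq_xxxx)
    also have "\<dots> \<le> t^4 / 8 * s4 n i" using s2s4[OF i] by (intro mult_left_mono) auto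
    finally show ?thesis
      by (rule norm_diff_triangle_le[OF 1])
  qed
  have bound: "norm (char (distr M borel (\<lambda>w. \<Sum>i\<in>I n. \<xi> n i w)) t - of_real (exp (- (t\<^sup>2 * S2 n / 2))))
      \<le> t^2 * \<bar>t\<bar> / 12 * (\<eta> n * S2 n + sqrt (S4 n)) + t^4 / 8 * S4 n" for n
  proof -
    have "char (distr M borel (\<lambda>w. \<Sum>i\<in>I n. \<xi> n i w)) t = (\<Prod>i\<in>I n. char (distr M borel (\<xi> n i)) t)"
      by (rule char_distr_sum[OF ind])
    moreover have "(of_real (exp (- (t\<^sup>2 * S2 n / 2))) :: complex) = (\<Prod>i\<in>I n. of_real (exp (- (t\<^sup>2 * s2 n i / 2))))"
      using fin[of n] by (simp add: S2_def sum_distrib_left exp_sum sum_divide_distrib flip: sum_negf of_real_prod)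
    ultimately have "norm (char (distr M borel (\<lambda>w. \<Sum>i\<in>I n. \<xi> n i w)) t - of_real (exp (- (t\<^sup>2 * S2 n / 2))))
       \<le> (\<Sum>i\<in>I n. norm (char (distr M borel (\<xi> n i)) t - of_real (exp (- (t\<^sup>2 * s2 n i / 2)))))"
      using s2_nn by (auto intro!: norm_prod_diff real_distribution.cmod_char_le_1 real_distribution_distr)
    also have "\<dots> \<le> (\<Sum>i\<in>I n. t^2 * \<bar>t\<bar> / 12 * (\<eta> n * s2 n i + s4 n i / \<eta> n) + t^4 / 8 * s4 n i)"
      by (intro sum_mono one)
    also have "\<dots> = t^2 * \<bar>t\<bar> / 12 * (\<eta> n * S2 n + S4 n / \<eta> n) + t^4 / 8 * S4 n"
      by (simp add: S2_def S4_def sum.distrib sum_distrib_left sum_divide_distrib sum_distrib_right algebra_simps add_divide_distrib)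
    also have "S4 n / \<eta> n \<le> sqrt (S4 n)"
    proof -
      have "S4 n = sqrt (S4 n) * sqrt (S4 n)" using S4_nn by simp
      also have "\<dots> \<le> sqrt (S4 n) * \<eta> n" using S4_nn by (intro mult_left_mono) (auto simp: \<eta>_def)
      finally show ?thesis using \<eta>[of n] by (simp add: field_simps)
    qed
    finally show ?thesis by (simp add: mult_left_mono)
  qed
  have S4: "S4 \<longlonglongrightarrow> 0" and S2: "S2 \<longlonglongrightarrow> v"
    using m4 var by (simp_all add: S4_def[abs_def] S2_def[abs_def] s4_def s2_def)
  have "(\<lambda>n. t^2 * \<bar>t\<bar> / 12 * (\<eta> n * S2 n + sqrt (S4 n)) + t^4 / 8 * S4 n) \<longlonglongrightarrow>
      t^2 * \<bar>t\<bar> / 12 * ((sqrt 0 + 0) * v + sqrt 0) + t^4 / 8 * 0"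
    unfolding \<eta>_def using LIMSEQ_Suc[OF lim_const_over_n[of 1]]
    by (intro tendsto_intros S4 S2) auto
  then have "(\<lambda>n. char (distr M borel (\<lambda>w. \<Sum>i\<in>I n. \<xi> n i w)) t - of_real (exp (- (t\<^sup>2 * S2 n / 2)))) \<longlonglongrightarrow> 0"
    by (intro Lim_null_comparison[OF always_eventually[OF allI[OF bound]]]) simp
  moreover have "(\<lambda>n. of_real (exp (- (t\<^sup>2 * S2 n / 2))) :: complex) \<longlonglongrightarrow> of_real (exp (- (t\<^sup>2 * v / 2)))"
    by (intro tendsto_intros S2) auto
  ultimately show ?thesis using tendsto_add by fastforce
qed

end

section \<open>Order statistics\<close>

text \<open>The entries with property P form a final segment of the sorted list, so P reaches
  position i exactly when this segment has more than n - i entries. An abstract upward closed P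
  covers strict and weak exceedance of a level at once.\<close>

lemma order_stat_pred_iff:
  fixes P :: "real \<Rightarrow> bool"
  assumes P: "\<And>x y. P x \<Longrightarrow> x \<le> y \<Longrightarrow> P y" and i: "1 \<le> i" "i \<le> n"
  shows "P (order_stat y n i) \<longleftrightarrow> n - i < card {p\<in>{1..n}. P (y p)}"
proof -
  define xs where "xs = sort (map y [1..<Suc n])"
  have len: "length xs = n" and srt: "sorted xs" by (auto simp: xs_def)
  have "card {p\<in>{1..n}. P (y p)} = length (filter (\<lambda>p. P (y p)) [1..<Suc n])"
    by (subst distinct_card[symmetric]) (auto intro!: arg_cong[where f=card])
  also have "\<dots> = length (filter P (map y [1..<Suc n]))" by (simp add: filter_map comp_def)
  also have "\<dots> = length (filter P xs)"
    unfolding xs_def by (metis mset_filter mset_sort size_mset)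
  also have "\<dots> = card {j. j < n \<and> P (xs ! j)}"
    by (simp add: length_filter_conv_card len)
  finally have c: "card {p\<in>{1..n}. P (y p)} = card {j. j < n \<and> P (xs ! j)}" .
  have mono: "a \<le> b \<Longrightarrow> b < n \<Longrightarrow> xs ! a \<le> xs ! b" for a b
    using srt len by (simp add: sorted_iff_nth_mono)
  have "P (xs ! (i - 1)) \<longleftrightarrow> n - i < card {j. j < n \<and> P (xs ! j)}"
  proof
    assume Pi: "P (xs ! (i - 1))"
    have "{i - 1..<n} \<subseteq> {j. j < n \<and> P (xs ! j)}"
      using mono P[OF Pi] by auto
    then have "card {i - 1..<n} \<le> card {j. j < n \<and> P (xs ! j)}"
      by (intro card_mono) auto
    then show "n - i < card {j. j < n \<and> P (xs ! j)}" using i by simp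
  next
    assume less: "n - i < card {j. j < n \<and> P (xs ! j)}"
    show "P (xs ! (i - 1))"
    proof (rule ccontr)
      assume nP: "\<not> P (xs ! (i - 1))"
      have "j \<ge> i" if "j < n" "P (xs ! j)" for j
      proof (rule ccontr)
        assume "\<not> j \<ge> i"
        then have "xs ! j \<le> xs ! (i - 1)" using i by (intro mono) auto
        with P that nP show False by blast
      qed
      then have "{j. j < n \<and> P (xs ! j)} \<subseteq> {i..<n}" by auto
      then have "card {j. j < n \<and> P (xs ! j)} \<le> card {i..<n}" by (intro card_mono) auto
      with less show False by simp
    qed
  qed
  then show ?thesis unfolding c order_stat_def xs_def[symmetric] .
qed

text \<open>Since f vanishes at and below the threshold, the n - k lower entries add nothing. This
  leaves the threshold as the only order statistic in the Hill estimator.\<close>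

lemma sum_upper_order_stats:
  fixes f :: "real \<Rightarrow> real"
  assumes k: "k < n" and f: "\<And>x. x \<le> order_stat y n (n - k) \<Longrightarrow> f x = 0"
  shows "(\<Sum>i=1..k. f (order_stat y n (n - i + 1))) = (\<Sum>i\<in>{1..n}. f (y i))"
proof -
  define xs where "xs = sort (map y [1..<Suc n])"
  have len: "length xs = n" and srt: "sorted xs" by (auto simp: xs_def)
  have "(\<Sum>i=1..k. f (order_stat y n (n - i + 1))) = (\<Sum>i=1..k. f (xs ! (n - i)))"
    by (simp add: order_stat_def xs_def)
  also have "\<dots> = (\<Sum>j\<in>{n - k..<n}. f (xs ! j))"
    using k by (intro sum.reindex_bij_witness[of _ "\<lambda>j. n - j" "\<lambda>i. n - i"]) auto
  also have "\<dots> = (\<Sum>j\<in>{0..<n}. f (xs ! j))"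
  proof (intro sum.mono_neutral_left ballI)
    fix j assume j: "j \<in> {0..<n} - {n - k..<n}"
    then have "xs ! j \<le> xs ! (n - k - 1)"
      using srt len k by (auto simp: sorted_iff_nth_mono)
    then show "f (xs ! j) = 0" by (intro f) (simp add: order_stat_def xs_def)
  qed auto
  also have "\<dots> = sum_list (map f xs)" by (simp add: sum_list_sum_nth len)
  also have "\<dots> = sum_mset (image_mset f (mset (map y [1..<Suc n])))"
    unfolding xs_def sum_mset_sum_list[symmetric] mset_map[of f] mset_sort ..
  also have "\<dots> = sum_list (map (\<lambda>i. f (y i)) [1..<Suc n])"
    unfolding mset_map[symmetric] sum_mset_sum_list by (simp add: comp_def del: upt_Suc)
  also have "\<dots> = (\<Sum>i\<in>{1..n}. f (y i))"
    by (simp add: interv_sum_list_conv_sum_set_nat atLeastLessThanSuc_atLeastAtMost del: upt_Suc)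
  finally show ?thesis .
qed

text \<open>A nondecreasing map keeps a sorted list sorted. Monotonicity is asked only on S because
  the quantile transform is applied on the positive half-line.\<close>

lemma order_stat_image:
  assumes q: "\<And>a b. a \<in> S \<Longrightarrow> b \<in> S \<Longrightarrow> a \<le> b \<Longrightarrow> q a \<le> (q b :: real)"
    and e: "\<And>p. p \<in> {1..n} \<Longrightarrow> e p \<in> S" and y: "\<And>p. p \<in> {1..n} \<Longrightarrow> y p = q (e p)"
    and i: "1 \<le> i" "i \<le> n"
  shows "order_stat y n i = q (order_stat e n i)"
proof -
  have "sort (map y [1..<Suc n]) = map q (sort (map e [1..<Suc n]))"
  proof (rule properties_for_sort)
    have "map y [1..<Suc n] = map q (map e [1..<Suc n])" using y by (simp del: upt_Suc)
    then show "mset (map q (sort (map e [1..<Suc n]))) = mset (map y [1..<Suc n])"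
      by (metis mset_map mset_sort)
    have "set (sort (map e [1..<Suc n])) \<subseteq> S" using e by (auto simp del: upt_Suc)
    moreover have "sorted (sort (map e [1..<Suc n]))" by simp
    ultimately show "sorted (map q (sort (map e [1..<Suc n])))"
      unfolding sorted_map by (rule_tac sorted_wrt_mono_rel[of _ "(\<le>)"]) (auto intro!: q)
  qed
  then show ?thesis using i by (simp add: order_stat_def del: upt_Suc)
qed

lemma card_eq_sum_indicator:
  assumes "finite I" shows "real (card {p\<in>I. y p \<in> A}) = (\<Sum>p\<in>I. indicator A (y p))"
proof -
  have "(\<Sum>p\<in>I. indicator A (y p)) = real (card (I \<inter> {p. y p \<in> A}))"
    using assms by (simp add: indicator_def sum.If_cases)
  also have "I \<inter> {p. y p \<in> A} = {p\<in>I. y p \<in> A}" by auto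
  finally show ?thesis ..
qed

lemma order_stat_gt_iff:
  fixes y :: "nat \<Rightarrow> real"
  assumes "k < n"
  shows "s < order_stat y n (n - k) \<longleftrightarrow> real k < (\<Sum>p\<in>{1..n}. indicator {s<..} (y p))"
proof -
  have "(\<Sum>p\<in>{1..n}. indicator {s<..} (y p)) = real (card {p\<in>{1..n}. s < y p})"
    by (simp flip: card_eq_sum_indicator)
  then show ?thesis using order_stat_pred_iff[of "\<lambda>x. s < x" "n - k" n y] assms by simp
qed

lemma order_stat_ge_iff:
  fixes y :: "nat \<Rightarrow> real"
  assumes "k < n"
  shows "s \<le> order_stat y n (n - k) \<longleftrightarrow> real k < (\<Sum>p\<in>{1..n}. indicator {s..} (y p))"
proof -
  have "(\<Sum>p\<in>{1..n}. indicator {s..} (y p)) = real (card {p\<in>{1..n}. s \<le> y p})"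
    by (simp flip: card_eq_sum_indicator)
  then show ?thesis using order_stat_pred_iff[of "\<lambda>x. s \<le> x" "n - k" n y] assms by simp
qed

text \<open>The total excess over a level is convex and piecewise linear in the level, with slope
  minus the number of points above it. The hypotheses make -k a subgradient at T, so using the slope
  -k all the way from s to T costs at most |T - s| times the discrepancy between k and the count at
  s.\<close>

lemma sum_excess_expansion:
  fixes y :: "'i \<Rightarrow> real"
  assumes up: "(\<Sum>i\<in>I. indicator {T<..} (y i)) \<le> k" and lo: "k \<le> (\<Sum>i\<in>I. indicator {T..} (y i))"
  shows "\<bar>(\<Sum>i\<in>I. max 0 (y i - T)) - (\<Sum>i\<in>I. max 0 (y i - s)) + k * (T - s)\<bar>
    \<le> \<bar>T - s\<bar> * \<bar>(\<Sum>i\<in>I. indicator {s<..} (y i)) - k\<bar>"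
proof (cases "s \<le> T")
  case True
  have "(\<Sum>i\<in>I. (T - s) * indicator {T..} (y i)) \<le> (\<Sum>i\<in>I. max 0 (y i - s) - max 0 (y i - T))"
    using True by (intro sum_mono) (auto simp: indicator_def)
  then have 1: "(T - s) * (\<Sum>i\<in>I. indicator {T..} (y i)) \<le> (\<Sum>i\<in>I. max 0 (y i - s)) - (\<Sum>i\<in>I. max 0 (y i - T))"
    by (simp add: sum_distrib_left sum_subtractf)
  have "(\<Sum>i\<in>I. max 0 (y i - s) - max 0 (y i - T)) \<le> (\<Sum>i\<in>I. (T - s) * indicator {s<..} (y i))"
    using True by (intro sum_mono) (auto simp: indicator_def)
  then have 2: "(\<Sum>i\<in>I. max 0 (y i - s)) - (\<Sum>i\<in>I. max 0 (y i - T)) \<le> (T - s) * (\<Sum>i\<in>I. indicator {s<..} (y i))"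
    by (simp add: sum_distrib_left sum_subtractf)
  have 3: "(T - s) * k \<le> (T - s) * (\<Sum>i\<in>I. indicator {T..} (y i))"
    using lo True by (intro mult_left_mono) auto
  have "\<bar>(\<Sum>i\<in>I. max 0 (y i - T)) - (\<Sum>i\<in>I. max 0 (y i - s)) + k * (T - s)\<bar>
     \<le> (T - s) * ((\<Sum>i\<in>I. indicator {s<..} (y i)) - k)"
    using 1 2 3 by (simp add: algebra_simps)
  also have "\<dots> \<le> \<bar>T - s\<bar> * \<bar>(\<Sum>i\<in>I. indicator {s<..} (y i)) - k\<bar>"
    unfolding abs_mult[symmetric] by simp
  finally show ?thesis .
next
  case False
  have "(\<Sum>i\<in>I. (s - T) * indicator {s<..} (y i)) \<le> (\<Sum>i\<in>I. max 0 (y i - T) - max 0 (y i - s))"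
    using False by (intro sum_mono) (auto simp: indicator_def)
  then have 1: "(s - T) * (\<Sum>i\<in>I. indicator {s<..} (y i)) \<le> (\<Sum>i\<in>I. max 0 (y i - T)) - (\<Sum>i\<in>I. max 0 (y i - s))"
    by (simp add: sum_distrib_left sum_subtractf)
  have "(\<Sum>i\<in>I. max 0 (y i - T) - max 0 (y i - s)) \<le> (\<Sum>i\<in>I. (s - T) * indicator {T<..} (y i))"
    using False by (intro sum_mono) (auto simp: indicator_def)
  then have 2: "(\<Sum>i\<in>I. max 0 (y i - T)) - (\<Sum>i\<in>I. max 0 (y i - s)) \<le> (s - T) * (\<Sum>i\<in>I. indicator {T<..} (y i))"
    by (simp add: sum_distrib_left sum_subtractf)
  have 3: "(s - T) * (\<Sum>i\<in>I. indicator {T<..} (y i)) \<le> (s - T) * k"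
    using up False by (intro mult_left_mono) auto
  have "\<bar>(\<Sum>i\<in>I. max 0 (y i - T)) - (\<Sum>i\<in>I. max 0 (y i - s)) + k * (T - s)\<bar>
     \<le> (s - T) * (k - (\<Sum>i\<in>I. indicator {s<..} (y i)))"
    using 1 2 3 by (simp add: algebra_simps)
  also have "\<dots> \<le> \<bar>s - T\<bar> * \<bar>k - (\<Sum>i\<in>I. indicator {s<..} (y i))\<bar>"
    unfolding abs_mult[symmetric] by simp
  finally show ?thesis by (simp add: abs_minus_commute)
qed

text \<open>Points at or below both levels contribute nothing; every other term moves by at most L
  |T - s| and is counted by at least one of the indicators.\<close>

lemma sum_lipschitz_excess:
  fixes y :: "'i \<Rightarrow> real" and f :: "real \<Rightarrow> real"
  assumes f0: "\<And>x. x \<le> 0 \<Longrightarrow> f x = 0" and lip: "\<And>x y. \<bar>f x - f y\<bar> \<le> L * \<bar>x - y\<bar>" and "L \<ge> 0"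
  shows "\<bar>(\<Sum>i\<in>I. f (y i - T)) - (\<Sum>i\<in>I. f (y i - s))\<bar>
    \<le> L * \<bar>T - s\<bar> * ((\<Sum>i\<in>I. indicator {s<..} (y i)) + (\<Sum>i\<in>I. indicator {T<..} (y i)))"
proof -
  have "\<bar>(\<Sum>i\<in>I. f (y i - T)) - (\<Sum>i\<in>I. f (y i - s))\<bar> \<le> (\<Sum>i\<in>I. \<bar>f (y i - T) - f (y i - s)\<bar>)"
    unfolding sum_subtractf[symmetric] by (rule sum_abs)
  also have "\<dots> \<le> (\<Sum>i\<in>I. L * \<bar>T - s\<bar> * (indicator {s<..} (y i) + indicator {T<..} (y i)))"
  proof (intro sum_mono)
    fix i
    have "\<bar>f (y i - T) - f (y i - s)\<bar> \<le> L * \<bar>T - s\<bar>"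
      using lip[of "y i - T" "y i - s"] by (simp add: abs_minus_commute)
    moreover have "0 \<le> L * \<bar>T - s\<bar>" using \<open>L \<ge> 0\<close> by simp
    ultimately show "\<bar>f (y i - T) - f (y i - s)\<bar> \<le> L * \<bar>T - s\<bar> * (indicator {s<..} (y i) + indicator {T<..} (y i))"
      using f0[of "y i - T"] f0[of "y i - s"] by (auto simp: indicator_def)
  qed
  finally show ?thesis by (simp add: sum_distrib_left sum.distrib distrib_left)
qed

section \<open>The standard exponential distribution\<close>

definition std_exp :: "real measure" where
  "std_exp = density lborel (exponential_density 1)"

lemma exp_density_1: "exponential_density 1 x = (if x < 0 then 0 else exp (- x))"
  by (simp add: exponential_density_def)

lemma sets_std_exp[simp, measurable_cong]: "sets std_exp = sets borel"
  and space_std_exp[simp]: "space std_exp = UNIV"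
  by (auto simp: std_exp_def)

lemma prob_space_std_exp: "prob_space std_exp"
  unfolding std_exp_def by (rule prob_space_exponential_density) simp

lemma AE_std_exp_pos: "AE x in std_exp. 0 < x"
proof -
  have "AE x in lborel. x \<noteq> (0::real)" by (rule AE_lborel_singleton)
  then show ?thesis
    unfolding std_exp_def by (subst AE_density) (auto simp: exp_density_1 elim!: eventually_mono)
qed

lemma has_bochner_integral_std_exp:
  fixes f :: "real \<Rightarrow> real"
  assumes [measurable]: "f \<in> borel_measurable borel"
  shows "has_bochner_integral std_exp f I \<longleftrightarrow> has_bochner_integral lborel (\<lambda>x. exponential_density 1 x * f x) I"
  unfolding has_bochner_integral_iff std_exp_def
  by (subst integrable_density, simp, simp, simp, subst integral_density) auto

text \<open>Memorylessness: beyond s the excess is again standard exponential, with total mass exp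
  (- s). Moments of single-sample tail sums reduce to moments of the unshifted law.\<close>

lemma std_exp_shift:
  fixes g :: "real \<Rightarrow> real"
  assumes g: "has_bochner_integral std_exp g I" and [measurable]: "g \<in> borel_measurable borel" and s: "s \<ge> 0"
  shows "has_bochner_integral std_exp (\<lambda>x. indicator {s<..} x * g (x - s)) (exp (- s) * I)"
proof -
  define h where "h x = exponential_density 1 x * (indicator {s<..} x * g (x - s))" for x
  have AE0: "AE x in lborel. x \<noteq> (0::real)" by (rule AE_lborel_singleton)
  have "has_bochner_integral lborel (\<lambda>x. exp (- s) * (exponential_density 1 x * g x)) (exp (- s) * I)"
    using g by (intro has_bochner_integral_mult_right) (simp_all add: has_bochner_integral_std_exp)
  then have "has_bochner_integral lborel (\<lambda>x. h (s + 1 * x)) (exp (- s) * I)"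
    by (subst has_bochner_integral_cong_AE[where g="\<lambda>x. exp (- s) * (exponential_density 1 x * g x)"])
       (use s AE0 in \<open>auto simp: h_def exp_density_1 indicator_def elim!: eventually_mono simp flip: exp_add\<close>)
  then have "has_bochner_integral lborel h (exp (- s) * I)"
    using lborel_has_bochner_integral_real_affine_iff[of 1 h "exp (- s) * I" s] by simp
  then show ?thesis
    by (subst has_bochner_integral_std_exp) (auto simp: h_def[abs_def])
qed

lemma std_exp_power: "has_bochner_integral std_exp (\<lambda>x. x ^ i) (fact i)"
proof (subst has_bochner_integral_std_exp)
  show "has_bochner_integral lborel (\<lambda>x. exponential_density 1 x * x ^ i) (fact i :: real)"
    using nn_integral_erlang_ith_moment[of 1 0 i]
    by (intro has_bochner_integral_nn_integral) (auto simp: exp_density_1 ennreal_fact)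
qed simp

lemma std_exp_const: fixes c :: real shows "has_bochner_integral std_exp (\<lambda>x. c) c"
  using has_bochner_integral_mult_right[of c std_exp "\<lambda>x. x ^ 0" "fact 0"] std_exp_power[of 0] by simp

lemma std_exp_exp:
  assumes "r < 0"
  shows "has_bochner_integral std_exp (\<lambda>x. exp (r * x)) (1 / (1 - r))"
proof (subst has_bochner_integral_std_exp)
  have "has_bochner_integral lborel (exponential_density (1 - r)) 1"
    using nn_integral_erlang_ith_moment[of "1 - r" 0 0] assms
    by (intro has_bochner_integral_nn_integral) (auto simp: exponential_density_def)
  then have "has_bochner_integral lborel (\<lambda>x. 1 / (1 - r) * exponential_density (1 - r) x) (1 / (1 - r) * 1)"
    by (intro has_bochner_integral_mult_right) auto
  then show "has_bochner_integral lborel (\<lambda>x. exponential_density 1 x * exp (r * x)) (1 / (1 - r))"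
    using assms by (elim has_bochner_integral_cong[THEN iffD1, rotated -1])
      (auto simp: exponential_density_def field_simps simp flip: exp_add)
qed simp

text \<open>After a shift, x - 1 becomes the summand of the linearised Hill estimator. The three
  moments provide its centring, its variance and the bound for Lyapunov's condition.\<close>

lemma std_exp_minus_one:
  "has_bochner_integral std_exp (\<lambda>x. x - 1) 0"
  "has_bochner_integral std_exp (\<lambda>x. (x - 1)\<^sup>2) 1"
  "has_bochner_integral std_exp (\<lambda>x. (x - 1)^4) 9"
proof -
  note p = std_exp_power
  note a = has_bochner_integral_add has_bochner_integral_diff has_bochner_integral_mult_right
  show "has_bochner_integral std_exp (\<lambda>x. x - 1) 0"
    using has_bochner_integral_diff[OF p[of 1] std_exp_const[of 1]] by simp
  have "has_bochner_integral std_exp (\<lambda>x. x^2 - 2 * x^1 + 1) (fact 2 - 2 * fact 1 + 1)"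
    by (intro a p std_exp_const)
  then show "has_bochner_integral std_exp (\<lambda>x. (x - 1)\<^sup>2) 1"
    by (simp add: power2_diff algebra_simps)
  have "has_bochner_integral std_exp (\<lambda>x. x^4 - 4 * x^3 + 6 * x^2 - 4 * x^1 + 1)
      (fact 4 - 4 * fact 3 + 6 * fact 2 - 4 * fact 1 + 1)"
    by (intro a p std_exp_const)
  moreover have "(\<lambda>x::real. x^4 - 4 * x^3 + 6 * x^2 - 4 * x^1 + 1) = (\<lambda>x. (x - 1)^4)"
    by (simp add: fun_eq_iff power4_eq_xxxx power3_eq_cube power2_eq_square algebra_simps)
  moreover have "fact 4 - 4 * fact 3 + 6 * fact 2 - 4 * fact 1 + 1 = (9::real)"
    by (simp add: fact_numeral)
  ultimately show "has_bochner_integral std_exp (\<lambda>x. (x - 1)^4) 9" by simp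
qed

text \<open>The maximum accounts for negative levels, which the exponential law exceeds with
  probability one.\<close>

lemma std_exp_tail: "has_bochner_integral std_exp (indicator {a<..}) (exp (- max 0 a))"
proof -
  have "has_bochner_integral std_exp (indicator {max 0 a<..}) (exp (- max 0 a))"
    using std_exp_shift[OF std_exp_const[of 1], of "max 0 a"] by simp
  moreover have "AE x in std_exp. indicator {max 0 a<..} x = (indicator {a<..} x :: real)"
    using AE_std_exp_pos by eventually_elim (auto simp: indicator_def)
  ultimately show ?thesis by (subst (asm) has_bochner_integral_cong_AE) auto
qed

section \<open>Sums over intermediate tails\<close>

context prob_space
begin

text \<open>The uncentred second moment dominates the variance. It is sharp enough here because
  functions supported on the tail have second moment of order k / n, which makes the bound of order
  k.\<close>

lemma iid_sum_second_moment:
  fixes X :: "nat \<Rightarrow> 'a \<Rightarrow> 'b::topological_space" and g :: "'b \<Rightarrow> real"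
  assumes ind: "indep_vars (\<lambda>_. borel) X {1..}"
    and D: "\<And>i. i \<ge> 1 \<Longrightarrow> distr M borel (X i) = D"
    and g[measurable]: "g \<in> borel_measurable borel" and g2: "integrable D (\<lambda>x. (g x)\<^sup>2)"
  shows "integrable M (\<lambda>w. (\<Sum>i\<in>{1..n}. g (X i w) - integral\<^sup>L D g)\<^sup>2)"
    and "expectation (\<lambda>w. (\<Sum>i\<in>{1..n}. g (X i w) - integral\<^sup>L D g)\<^sup>2) \<le> n * integral\<^sup>L D (\<lambda>x. (g x)\<^sup>2)"
proof -
  have X[measurable]: "X i \<in> measurable M borel" if "i \<ge> 1" for i
    using ind that by (auto simp: indep_vars_def2)
  have D1: "D = distr M borel (X 1)" using D[of 1] by simp
  have setsD: "sets D = sets borel" unfolding D1 by simp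
  interpret D: prob_space D unfolding D1 by (rule prob_space_distr) simp
  have gD: "g \<in> borel_measurable D" using g by (simp add: measurable_cong_sets[OF setsD refl])
  have g1: "integrable D g" by (rule D.square_integrable_imp_integrable[OF gD g2])
  define h where "h x = g x - integral\<^sup>L D g" for x
  have hm[measurable]: "h \<in> borel_measurable borel" unfolding h_def[abs_def] by measurable
  have h2: "integrable D (\<lambda>x. (h x)\<^sup>2)" unfolding h_def power2_diff using g1 g2 by auto
  have h1: "integrable D h" unfolding h_def[abs_def] using g1 by auto
  have Eh: "integral\<^sup>L D h = 0" unfolding h_def using g1 by (simp add: D.prob_space)
  have Eh2: "integral\<^sup>L D (\<lambda>x. (h x)\<^sup>2) \<le> integral\<^sup>L D (\<lambda>x. (g x)\<^sup>2)"
    unfolding h_def using g1 g2 by (subst D.variance_eq) auto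
  have tr: "integrable M (\<lambda>w. f (X i w)) = integrable D f" "expectation (\<lambda>w. f (X i w)) = integral\<^sup>L D f"
    if "i \<ge> 1" "f \<in> borel_measurable borel" for f :: "'b \<Rightarrow> real" and i
    using that X[OF that(1)] unfolding D[OF that(1), symmetric]
    by (simp_all add: integrable_distr_eq integral_distr)
  have "integrable M (\<lambda>w. (\<Sum>i\<in>{1..n}. h (X i w))\<^sup>2) \<and>
    expectation (\<lambda>w. (\<Sum>i\<in>{1..n}. h (X i w))\<^sup>2) = (\<Sum>i\<in>{1..n}. expectation (\<lambda>w. (h (X i w))\<^sup>2))"
  proof (rule expectation_sum_squares_indep)
    show "indep_vars (\<lambda>_. borel) (\<lambda>i w. h (X i w)) {1..n}"
      by (rule indep_vars_compose2[OF indep_vars_subset[OF ind]]) auto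
    show "integrable M (\<lambda>w. (h (X i w))\<^sup>2)" if "i \<in> {1..n}" for i
      using that h2 tr(1)[of i "\<lambda>x. (h x)\<^sup>2"] by simp
    show "expectation (\<lambda>w. h (X i w)) = 0" if "i \<in> {1..n}" for i
      using that Eh tr(2)[of i h] by simp
  qed simp
  moreover have "expectation (\<lambda>w. (h (X i w))\<^sup>2) = integral\<^sup>L D (\<lambda>x. (h x)\<^sup>2)" if "i \<in> {1..n}" for i
    using that tr(2)[of i "\<lambda>x. (h x)\<^sup>2"] by simp
  moreover have "n * integral\<^sup>L D (\<lambda>x. (h x)\<^sup>2) \<le> n * integral\<^sup>L D (\<lambda>x. (g x)\<^sup>2)"
    using Eh2 by (rule mult_left_mono) simp
  ultimately show "integrable M (\<lambda>w. (\<Sum>i\<in>{1..n}. g (X i w) - integral\<^sup>L D g)\<^sup>2)"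
    and "expectation (\<lambda>w. (\<Sum>i\<in>{1..n}. g (X i w) - integral\<^sup>L D g)\<^sup>2) \<le> n * integral\<^sup>L D (\<lambda>x. (g x)\<^sup>2)"
    by (simp_all add: h_def)
qed

text \<open>A weak law whose summand may change with n: Chebyshev applies once the normalised
  variance bound vanishes and the normalised mean converges.\<close>

lemma scaled_sum_lln:
  fixes X :: "nat \<Rightarrow> 'a \<Rightarrow> 'b::topological_space" and g :: "nat \<Rightarrow> 'b \<Rightarrow> real"
    and N :: "nat \<Rightarrow> nat" and \<kappa> :: "nat \<Rightarrow> real"
  assumes ind: "indep_vars (\<lambda>_. borel) X {1..}"
    and D: "\<And>i. i \<ge> 1 \<Longrightarrow> distr M borel (X i) = D"
    and g: "\<And>n. g n \<in> borel_measurable borel" and g2: "\<And>n. integrable D (\<lambda>x. (g n x)\<^sup>2)"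
    and var: "(\<lambda>n. N n * integral\<^sup>L D (\<lambda>x. (g n x)\<^sup>2) / (\<kappa> n)\<^sup>2) \<longlonglongrightarrow> 0"
    and mean: "(\<lambda>n. N n * integral\<^sup>L D (g n) / \<kappa> n) \<longlonglongrightarrow> a"
  shows "((\<lambda>z. (\<Sum>i\<in>{1..N (fst z)}. g (fst z) (X i (snd z))) / \<kappa> (fst z)) \<longlongrightarrow> a) (prob_filter M)"
proof -
  have X[measurable]: "X i \<in> measurable M borel" if "i \<ge> 1" for i
    using ind that by (auto simp: indep_vars_def2)
  note g[measurable]
  define W where "W n w = (\<Sum>i\<in>{1..N n}. g n (X i w) - integral\<^sup>L D (g n)) / \<kappa> n" for n w
  note s = iid_sum_second_moment[OF ind D g g2]
  have "((\<lambda>z. W (fst z) (snd z)) \<longlongrightarrow> 0) (prob_filter M)"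
  proof (rule second_moment_tendsto_0)
    show "W n \<in> borel_measurable M" for n unfolding W_def[abs_def] by measurable
    show "integrable M (\<lambda>w. (W n w)\<^sup>2)" for n
      using s(1)[of n "N n"] by (simp add: W_def power_divide)
    show "(\<lambda>n. expectation (\<lambda>w. (W n w)\<^sup>2)) \<longlonglongrightarrow> 0"
    proof (rule tendsto_sandwich[OF always_eventually always_eventually tendsto_const var]; intro allI)
      show "0 \<le> expectation (\<lambda>w. (W n w)\<^sup>2)" for n by simp
      show "expectation (\<lambda>w. (W n w)\<^sup>2) \<le> N n * integral\<^sup>L D (\<lambda>x. (g n x)\<^sup>2) / (\<kappa> n)\<^sup>2" for n
        using s(2)[of n "N n"] by (simp add: W_def power_divide divide_right_mono)
    qed
  qed
  from tendsto_add[OF this tendsto_fst_prob_filter[OF mean]]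
  show ?thesis by (simp add: W_def sum_subtractf diff_divide_distrib)
qed

end

section \<open>The intermediate tail of a single exponential sample\<close>

locale exp_tail = prob_space M for M :: "'w measure" +
  fixes e :: "nat \<Rightarrow> 'w \<Rightarrow> real" and N K :: "nat \<Rightarrow> nat"
  assumes ind: "indep_vars (\<lambda>_. borel) e {1..}"
    and dist: "\<And>i. i \<ge> 1 \<Longrightarrow> distr M borel (e i) = std_exp"
    and N_lim: "filterlim N at_top sequentially"
    and K_lim: "filterlim K at_top sequentially"
    and KN_lim: "(\<lambda>n. real (K n) / real (N n)) \<longlonglongrightarrow> 0"
begin

text \<open>Truncation at 0 makes \<open>std_exp_shift\<close> available for every n, including the
  finitely many with N n < K n.\<close>

definition s0 :: "nat \<Rightarrow> real" where
  "s0 n = max 0 (ln (real (N n) / real (K n)))"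

definition cnt :: "nat \<Rightarrow> real \<Rightarrow> 'w \<Rightarrow> real" where
  "cnt n a w = (\<Sum>i\<in>{1..N n}. indicator {a<..} (e i w))"

text \<open>Position N n - K n in ascending order is the (K n + 1)-st largest observation, the level
  that \<open>hill\<close> divides by.\<close>

definition thr :: "nat \<Rightarrow> 'w \<Rightarrow> real" where
  "thr n w = order_stat (\<lambda>i. e i w) (N n) (N n - K n)"

definition lin :: "nat \<Rightarrow> 'w \<Rightarrow> real" where
  "lin n w = (\<Sum>i\<in>{1..N n}. indicator {s0 n<..} (e i w) * (e i w - s0 n - 1)) / sqrt (K n)"

lemma s0_nonneg: "s0 n \<ge> 0" by (simp add: s0_def)

lemma K_lim_real: "filterlim (\<lambda>n. real (K n)) at_top sequentially"
  by (rule filterlim_compose[OF filterlim_real_sequentially K_lim])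

lemma sqrt_K_lim: "filterlim (\<lambda>n. sqrt (real (K n))) at_top sequentially"
  by (rule filterlim_compose[OF sqrt_at_top K_lim_real])

lemma eventually_K_N: "\<forall>\<^sub>F n in sequentially. 0 < K n \<and> K n < N n"
proof -
  have "\<forall>\<^sub>F n in sequentially. real (K n) / real (N n) < 1" by (rule order_tendstoD(2)[OF KN_lim]) simp
  moreover have "\<forall>\<^sub>F n in sequentially. 0 < K n" "\<forall>\<^sub>F n in sequentially. 0 < N n"
    using filterlim_at_top[THEN iffD1, OF K_lim, rule_format, of 1]
      filterlim_at_top[THEN iffD1, OF N_lim, rule_format, of 1] by (simp_all add: Suc_le_eq)
  ultimately show ?thesis by eventually_elim (auto simp: divide_less_eq)
qed

lemma eventually_s0: "\<forall>\<^sub>F n in sequentially. s0 n = ln (real (N n) / real (K n))"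
  using eventually_K_N
proof eventually_elim
  case (elim n)
  then have "ln (real (N n) / real (K n)) \<ge> 0" by (intro ln_ge_zero) auto
  then show "s0 n = ln (real (N n) / real (K n))" by (simp add: s0_def)
qed

lemma eventually_exp_s0: "\<forall>\<^sub>F n in sequentially. exp (- s0 n) = real (K n) / real (N n)"
  using eventually_K_N eventually_s0 by eventually_elim (simp add: exp_minus)

lemma s0_lim: "filterlim s0 at_top sequentially"
proof -
  have "filterlim (\<lambda>n. inverse (real (K n) / real (N n))) at_top sequentially"
    by (rule filterlim_inverse_at_top[OF KN_lim]) (use eventually_K_N in eventually_elim, auto)
  then have "filterlim (\<lambda>n. ln (inverse (real (K n) / real (N n)))) at_top sequentially"
    by (rule filterlim_compose[OF ln_at_top])
  then show ?thesis
    by (rule filterlim_cong[THEN iffD1, rotated -1]) (use eventually_s0 in \<open>auto elim!: eventually_mono\<close>)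
qed

text \<open>Eventually N exp (- s0) = K, so the sum has mean K I1 and variance at most K I2.\<close>

lemma tail_sum_lln:
  assumes g[measurable]: "g \<in> borel_measurable borel"
    and I1: "has_bochner_integral std_exp g I1" and I2: "has_bochner_integral std_exp (\<lambda>x. (g x)\<^sup>2) I2"
    and var: "(\<lambda>n. real (K n) / (\<kappa> n)\<^sup>2) \<longlonglongrightarrow> 0" and mean: "(\<lambda>n. real (K n) * I1 / \<kappa> n) \<longlonglongrightarrow> a"
  shows "((\<lambda>z. (\<Sum>i\<in>{1..N (fst z)}. indicator {s0 (fst z)<..} (e i (snd z)) * g (e i (snd z) - s0 (fst z)))
      / \<kappa> (fst z)) \<longlongrightarrow> a) (prob_filter M)"
proof (rule scaled_sum_lln[OF ind dist])
  fix n
  note h1 = std_exp_shift[OF I1 g s0_nonneg, of n]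
  have sq: "(\<lambda>x. (indicator {s0 n<..} x * g (x - s0 n))\<^sup>2) = (\<lambda>x. indicator {s0 n<..} x * (g (x - s0 n))\<^sup>2)" for n
    by (auto simp: indicator_def fun_eq_iff)
  have h2: "has_bochner_integral std_exp (\<lambda>x. (indicator {s0 n<..} x * g (x - s0 n))\<^sup>2) (exp (- s0 n) * I2)" for n
    unfolding sq by (rule std_exp_shift[OF I2 _ s0_nonneg]) measurable
  show "integrable std_exp (\<lambda>x. (indicator {s0 n<..} x * g (x - s0 n))\<^sup>2)"
    using h2 by (simp add: has_bochner_integral_iff)
  show "(\<lambda>n. real (N n) * (LINT x|std_exp. (indicator {s0 n<..} x * g (x - s0 n))\<^sup>2) / (\<kappa> n)\<^sup>2) \<longlonglongrightarrow> 0"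
  proof (rule Lim_transform_eventually)
    show "(\<lambda>n. I2 * (real (K n) / (\<kappa> n)\<^sup>2)) \<longlonglongrightarrow> 0" using tendsto_mult_left[OF var, of I2] by simp
    show "\<forall>\<^sub>F n in sequentially. I2 * (real (K n) / (\<kappa> n)\<^sup>2) =
      real (N n) * (LINT x|std_exp. (indicator {s0 n<..} x * g (x - s0 n))\<^sup>2) / (\<kappa> n)\<^sup>2"
      using eventually_exp_s0 eventually_K_N
      by eventually_elim (use h2 in \<open>auto simp: has_bochner_integral_iff\<close>)
  qed
  show "(\<lambda>n. real (N n) * (LINT x|std_exp. indicator {s0 n<..} x * g (x - s0 n)) / \<kappa> n) \<longlonglongrightarrow> a"
  proof (rule Lim_transform_eventually[OF mean])
    show "\<forall>\<^sub>F n in sequentially. real (K n) * I1 / \<kappa> n =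
      real (N n) * (LINT x|std_exp. indicator {s0 n<..} x * g (x - s0 n)) / \<kappa> n"
      using eventually_exp_s0 eventually_K_N
      by eventually_elim (use std_exp_shift[OF I1 g s0_nonneg] in \<open>auto simp: has_bochner_integral_iff\<close>)
  qed
qed measurable

lemma e_measurable: "i \<ge> 1 \<Longrightarrow> e i \<in> borel_measurable M"
  using ind by (auto simp: indep_vars_def2)

text \<open>This bound makes normalised tail sums tight. It is applied to the constant 1 for counts
  and to x - 1 for \<open>lin\<close>.\<close>

lemma tail_sum_second_moment:
  assumes g[measurable]: "g \<in> borel_measurable borel"
    and I1: "has_bochner_integral std_exp g I1" and I2: "has_bochner_integral std_exp (\<lambda>x. (g x)\<^sup>2) I2"
  defines "W \<equiv> \<lambda>n w. ((\<Sum>i\<in>{1..N n}. indicator {s0 n<..} (e i w) * g (e i w - s0 n)) - N n * exp (- s0 n) * I1) / sqrt (K n)"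
  shows "W n \<in> borel_measurable M" "integrable M (\<lambda>w. (W n w)\<^sup>2)"
    "\<forall>\<^sub>F n in sequentially. expectation (\<lambda>w. (W n w)\<^sup>2) \<le> I2"
proof -
  note e_measurable[measurable]
  note h1 = std_exp_shift[OF I1 g s0_nonneg]
  have sq: "(\<lambda>x. (indicator {s0 n<..} x * g (x - s0 n))\<^sup>2) = (\<lambda>x. indicator {s0 n<..} x * (g (x - s0 n))\<^sup>2)" for n
    by (auto simp: indicator_def fun_eq_iff)
  have h2: "has_bochner_integral std_exp (\<lambda>x. (indicator {s0 n<..} x * g (x - s0 n))\<^sup>2) (exp (- s0 n) * I2)" for n
    unfolding sq by (rule std_exp_shift[OF I2 _ s0_nonneg]) measurable
  show "W n \<in> borel_measurable M" unfolding W_def by measurable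
  have gm: "(\<lambda>x. indicator {s0 n<..} x * g (x - s0 n)) \<in> borel_measurable borel" for n by measurable
  have Weq: "W n w = (\<Sum>i\<in>{1..N n}. indicator {s0 n<..} (e i w) * g (e i w - s0 n)
      - (LINT x|std_exp. indicator {s0 n<..} x * g (x - s0 n))) / sqrt (K n)" for n w
    using h1[of n] by (simp add: W_def sum_subtractf has_bochner_integral_iff)
  have h2i: "integrable std_exp (\<lambda>x. (indicator {s0 n<..} x * g (x - s0 n))\<^sup>2)" for n
    using h2 by (simp add: has_bochner_integral_iff)
  note s = iid_sum_second_moment[OF ind dist gm h2i]
  show "integrable M (\<lambda>w. (W n w)\<^sup>2)"
    using s(1)[of n "N n"] by (simp add: Weq power_divide)
  show "\<forall>\<^sub>F n in sequentially. expectation (\<lambda>w. (W n w)\<^sup>2) \<le> I2"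
    using eventually_exp_s0 eventually_K_N
  proof eventually_elim
    case (elim n)
    have "expectation (\<lambda>w. (W n w)\<^sup>2) =
      expectation (\<lambda>w. (\<Sum>i\<in>{1..N n}. indicator {s0 n<..} (e i w) * g (e i w - s0 n)
      - (LINT x|std_exp. indicator {s0 n<..} x * g (x - s0 n)))\<^sup>2) / K n"
      by (simp add: Weq power_divide)
    also have "\<dots> \<le> (N n * (LINT x|std_exp. (indicator {s0 n<..} x * g (x - s0 n))\<^sup>2)) / K n"
      using s(2)[of n "N n"] by (simp add: divide_right_mono)
    also have "\<dots> = I2" using elim h2[of n] by (simp add: has_bochner_integral_iff)
    finally show ?case .
  qed
qed

lemma cnt_s0_lim: "((\<lambda>z. cnt (fst z) (s0 (fst z)) (snd z) / K (fst z)) \<longlongrightarrow> 1) (prob_filter M)"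
proof -
  have "(\<lambda>n. inverse (real (K n))) \<longlonglongrightarrow> 0"
    by (rule tendsto_inverse_0_at_top[OF K_lim_real])
  moreover have "\<forall>\<^sub>F n in sequentially. real (K n) / (real (K n))\<^sup>2 = inverse (real (K n))"
    using eventually_K_N by eventually_elim (auto simp: power2_eq_square field_simps)
  moreover have "\<forall>\<^sub>F n in sequentially. real (K n) * 1 / real (K n) = 1"
    using eventually_K_N by eventually_elim auto
  ultimately have "((\<lambda>z. (\<Sum>i\<in>{1..N (fst z)}. indicator {s0 (fst z)<..} (e i (snd z)) * (1::real)) / K (fst z)) \<longlongrightarrow> 1) (prob_filter M)"
    by (intro tail_sum_lln[OF _ std_exp_const])
      (auto simp: tendsto_cong intro: std_exp_const[of 1, simplified] tendsto_eventually)
  then show ?thesis by (simp add: cnt_def)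
qed

text \<open>A move of the level by y / sqrt K crosses about |y| sqrt K points. After division by
  sqrt K the variance is at most |exp (- y / sqrt K) - 1|, which vanishes, while the mean tends to
  -y. All levels on this scale therefore share one random fluctuation, that of the count at
  s0.\<close>

lemma cnt_increment_lim:
  "((\<lambda>z. (cnt (fst z) (s0 (fst z) + y / sqrt (K (fst z))) (snd z) - cnt (fst z) (s0 (fst z)) (snd z))
      / sqrt (K (fst z))) \<longlongrightarrow> - y) (prob_filter M)"
proof -
  define a where "a n = s0 n + y / sqrt (K n)" for n
  define g where "g n x = (indicator {a n<..} x - indicator {s0 n<..} x :: real)" for n x
  have y0: "(\<lambda>n. y / sqrt (K n)) \<longlonglongrightarrow> 0"
    by (rule real_tendsto_divide_at_top[OF tendsto_const sqrt_K_lim])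
  have a_pos: "\<forall>\<^sub>F n in sequentially. a n \<ge> 0"
    using filterlim_at_top_dense[THEN iffD1, OF s0_lim, rule_format, of 1] order_tendstoD(1)[OF y0, of "-1", simplified]
    by eventually_elim (simp add: a_def)
  have [measurable]: "g n \<in> borel_measurable borel" for n unfolding g_def[abs_def] by measurable
  have Eg: "has_bochner_integral std_exp (g n) (exp (- max 0 (a n)) - exp (- max 0 (s0 n)))" for n
    unfolding g_def[abs_def] by (intro has_bochner_integral_diff std_exp_tail)
  \<comment> \<open>The two half-lines are nested, so g is an indicator up to sign and its square is
    its absolute value.\<close>
  have sq: "(\<lambda>x. (g n x)\<^sup>2) = (if a n \<le> s0 n then g n else (\<lambda>x. - g n x))" for n
    by (auto simp: fun_eq_iff g_def indicator_def)
  have Eg2: "has_bochner_integral std_exp (\<lambda>x. (g n x)\<^sup>2) \<bar>exp (- max 0 (a n)) - exp (- max 0 (s0 n))\<bar>" for n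
    unfolding sq using Eg[of n] has_bochner_integral_minus[OF Eg[of n]] by (auto simp: abs_if)
  have ev: "\<forall>\<^sub>F n in sequentially. N n * (exp (- max 0 (a n)) - exp (- max 0 (s0 n))) = K n * (exp (- y / sqrt (K n)) - 1)"
    using a_pos eventually_exp_s0 eventually_K_N
  proof eventually_elim
    case (elim n)
    have "exp (- max 0 (a n)) - exp (- max 0 (s0 n)) = exp (- a n) - exp (- s0 n)"
      using elim s0_nonneg[of n] by (simp add: max_def)
    also have "\<dots> = exp (- s0 n) * (exp (- y / sqrt (K n)) - 1)"
      by (simp add: a_def algebra_simps flip: exp_add)
    finally show ?case using elim by simp
  qed
  have l1: "(\<lambda>n. exp (- y / sqrt (K n)) - 1) \<longlonglongrightarrow> 0"
    using tendsto_diff[OF tendsto_exp[OF tendsto_minus[OF y0]] tendsto_const[of 1]] by simp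
  \<comment> \<open>This is the derivative of exp at 0; y = 0 is split off because the difference
    quotient is taken along nonzero arguments.\<close>
  have l2: "(\<lambda>n. sqrt (K n) * (exp (- y / sqrt (K n)) - 1)) \<longlonglongrightarrow> - y"
  proof (cases "y = 0")
    case False
    have "filterlim (\<lambda>n. - y / sqrt (K n)) (at 0) sequentially"
      using tendsto_minus[OF y0] eventually_K_N False by (auto simp: filterlim_at elim!: eventually_mono)
    then have "(\<lambda>n. (exp (- y / sqrt (K n)) - 1) / (- y / sqrt (K n))) \<longlonglongrightarrow> 1"
      by (rule filterlim_compose[OF lim_exp_minus_1])
    from tendsto_mult[OF tendsto_const[of "-y"] this]
    have "(\<lambda>n. - y * ((exp (- y / sqrt (K n)) - 1) / (- y / sqrt (K n)))) \<longlonglongrightarrow> - y" by simp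
    then show ?thesis
      by (rule Lim_transform_eventually) (use False eventually_K_N in \<open>auto elim!: eventually_mono\<close>)
  qed auto
  have "((\<lambda>z. (\<Sum>i\<in>{1..N (fst z)}. g (fst z) (e i (snd z))) / sqrt (K (fst z))) \<longlongrightarrow> - y) (prob_filter M)"
  proof (rule scaled_sum_lln[OF ind dist])
    show "integrable std_exp (\<lambda>x. (g n x)\<^sup>2)" for n using Eg2 by (simp add: has_bochner_integral_iff)
    show "(\<lambda>n. real (N n) * (LINT x|std_exp. (g n x)\<^sup>2) / (sqrt (K n))\<^sup>2) \<longlonglongrightarrow> 0"
    proof (rule Lim_transform_eventually)
      show "(\<lambda>n. \<bar>exp (- y / sqrt (K n)) - 1\<bar>) \<longlonglongrightarrow> 0" using tendsto_rabs[OF l1] by simp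
      show "\<forall>\<^sub>F n in sequentially. \<bar>exp (- y / sqrt (K n)) - 1\<bar> = real (N n) * (LINT x|std_exp. (g n x)\<^sup>2) / (sqrt (K n))\<^sup>2"
        using ev eventually_K_N
      proof eventually_elim
        case (elim n)
        have "real (N n) * (LINT x|std_exp. (g n x)\<^sup>2) = \<bar>N n * (exp (- max 0 (a n)) - exp (- max 0 (s0 n)))\<bar>"
          using Eg2[of n] by (simp add: has_bochner_integral_iff abs_mult)
        then show ?case using elim by (simp add: abs_mult)
      qed
    qed
    show "(\<lambda>n. real (N n) * integral\<^sup>L std_exp (g n) / sqrt (K n)) \<longlonglongrightarrow> - y"
    proof (rule Lim_transform_eventually[OF l2])
      show "\<forall>\<^sub>F n in sequentially. sqrt (K n) * (exp (- y / sqrt (K n)) - 1) = real (N n) * integral\<^sup>L std_exp (g n) / sqrt (K n)"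
        using ev eventually_K_N
      proof eventually_elim
        case (elim n)
        then have "real (N n) * integral\<^sup>L std_exp (g n) = K n * (exp (- y / sqrt (K n)) - 1)"
          using Eg[of n] by (simp add: has_bochner_integral_iff)
        then show ?case using elim by (simp add: field_simps)
      qed
    qed
  qed measurable
  then show ?thesis by (simp add: g_def a_def cnt_def sum_subtractf)
qed

end

lemma abs_exp_neg_diff_le:
  fixes a b :: real
  assumes "a \<ge> 0" "b \<ge> 0"
  shows "\<bar>exp (- a) - exp (- b)\<bar> \<le> \<bar>a - b\<bar>"
proof -
  have *: "exp (- a) - exp (- b) \<le> b - a" "0 \<le> exp (- a) - exp (- b)" if "a \<le> b" "a \<ge> 0" for a b :: real
  proof -
    have "exp (- a) - exp (- b) = exp (- a) * (1 - exp (- (b - a)))"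
      by (simp add: algebra_simps flip: exp_add)
    also have "\<dots> \<le> 1 * (b - a)"
    proof (intro mult_mono)
      show "1 - exp (- (b - a)) \<le> b - a" using exp_ge_add_one_self[of "- (b - a)"] by linarith
    qed (use that in auto)
    finally show "exp (- a) - exp (- b) \<le> b - a" by simp
    show "0 \<le> exp (- a) - exp (- b)" using that by simp
  qed
  show ?thesis using *[of a b] *[of b a] assms by linarith
qed

section \<open>The random threshold and the expansion of the Hill estimator\<close>

context exp_tail
begin

lemma thr_gt_iff:
  "K n < N n \<Longrightarrow> s < thr n w \<longleftrightarrow> real (K n) < cnt n s w"
  unfolding thr_def cnt_def by (rule order_stat_gt_iff)

text \<open>Centred at its exact mean, as the second-moment bound requires; by
  \<open>eventually_W0\<close> that mean is K for large n.\<close>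

definition W0 :: "nat \<Rightarrow> 'w \<Rightarrow> real" where
  "W0 n w = (cnt n (s0 n) w - N n * exp (- s0 n)) / sqrt (K n)"

definition Z0 :: "nat \<Rightarrow> 'w \<Rightarrow> real" where
  "Z0 n w = sqrt (K n) * (thr n w - s0 n)"

lemma W0_props:
  "W0 n \<in> borel_measurable M" "integrable M (\<lambda>w. (W0 n w)\<^sup>2)"
  "\<forall>\<^sub>F n in sequentially. expectation (\<lambda>w. (W0 n w)\<^sup>2) \<le> 1"
proof -
  note * = tail_sum_second_moment[of "\<lambda>_. 1" 1 1, OF _ std_exp_const[of 1]]
  have "(\<lambda>x::real. 1\<^sup>2 :: real) = (\<lambda>x. 1)" by simp
  with * show "W0 n \<in> borel_measurable M" "integrable M (\<lambda>w. (W0 n w)\<^sup>2)"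
    "\<forall>\<^sub>F n in sequentially. expectation (\<lambda>w. (W0 n w)\<^sup>2) \<le> 1"
    using std_exp_const[of 1] by (simp_all add: W0_def[abs_def] cnt_def)
qed

lemma eventually_W0:
  "\<forall>\<^sub>F n in sequentially. \<forall>w. W0 n w = (cnt n (s0 n) w - K n) / sqrt (K n)"
  using eventually_exp_s0 eventually_K_N by eventually_elim (simp add: W0_def)

text \<open>Both inequalities between the rescaled random threshold and a grid point are events about
  the tail counts, whose increments over the grid are asymptotically deterministic.\<close>

lemma thr_expansion: "((\<lambda>z. Z0 (fst z) (snd z) - W0 (fst z) (snd z)) \<longlongrightarrow> 0) (prob_filter M)"
  unfolding tendsto_iff
proof (intro allI impI)
  fix e' :: real assume "e' > 0"
  define \<epsilon> where "\<epsilon> = e' / 2"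
  have \<epsilon>: "\<epsilon> > 0" "e' = 2 * \<epsilon>" using \<open>e' > 0\<close> by (auto simp: \<epsilon>_def)
  show "\<forall>\<^sub>F z in prob_filter M. dist (Z0 (fst z) (snd z) - W0 (fst z) (snd z)) 0 < e'"
  proof (rule tight_eventuallyI[OF W0_props])
    fix L :: real assume "L > 0"
    \<comment> \<open>For |W0| < L the grid reaches far enough to contain a point on either side of
      W0 at distance at least \<epsilon> and less than 2 \<epsilon>. It is finite, so pointwise
      control of the increments suffices.\<close>
    define m where "m = \<lceil>L / \<epsilon>\<rceil> + 2"
    define G where "G = (\<lambda>i. \<epsilon> * real_of_int i) ` {-m..m}"
    define Dy where "Dy y z = (cnt (fst z) (s0 (fst z) + y / sqrt (K (fst z))) (snd z) - cnt (fst z) (s0 (fst z)) (snd z))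
      / sqrt (K (fst z)) + y" for y and z :: "nat \<times> 'w"
    have "\<forall>\<^sub>F z in prob_filter M. \<forall>y\<in>G. \<bar>Dy y z\<bar> < \<epsilon> / 2"
    proof (intro eventually_ball_finite ballI)
      fix y
      have "(Dy y \<longlongrightarrow> - y + y) (prob_filter M)"
        unfolding Dy_def by (intro tendsto_add cnt_increment_lim tendsto_const)
      then show "\<forall>\<^sub>F z in prob_filter M. \<bar>Dy y z\<bar> < \<epsilon> / 2"
        using \<epsilon> by (auto simp: tendsto_iff dest!: spec[of _ "\<epsilon> / 2"])
    qed (simp add: G_def)
    then show "\<forall>\<^sub>F z in prob_filter M. \<bar>W0 (fst z) (snd z)\<bar> < L \<longrightarrow>
        dist (Z0 (fst z) (snd z) - W0 (fst z) (snd z)) 0 < e'"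
      using eventually_fst_prob_filter[OF eventually_K_N] eventually_fst_prob_filter[OF eventually_W0]
    proof eventually_elim
      case (elim z)
      obtain n w where z: "z = (n, w)" by force
      have n: "0 < K n" "K n < N n" and W: "W0 n w = (cnt n (s0 n) w - K n) / sqrt (K n)"
        and D: "\<And>y. y \<in> G \<Longrightarrow> \<bar>Dy y z\<bar> < \<epsilon> / 2"
        using elim by (auto simp: z)
      \<comment> \<open>An inequality for the threshold is one for the count at a shifted level,
        that is, for W0 plus an increment close to -y. When the deviation \<open>Dy\<close> is below
        \<epsilon> / 2, the comparison is decided for every y at distance at least \<epsilon> from
        W0.\<close>
      have Z: "y < Z0 n w \<longleftrightarrow> 0 < W0 n w + Dy y z - y" for y
      proof -
        have "y < Z0 n w \<longleftrightarrow> s0 n + y / sqrt (K n) < thr n w"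
          using n by (simp add: Z0_def field_simps)
        also have "\<dots> \<longleftrightarrow> 0 < (cnt n (s0 n + y / sqrt (K n)) w - K n) / sqrt (K n)"
          using n by (simp add: thr_gt_iff zero_less_divide_iff)
        also have "(cnt n (s0 n + y / sqrt (K n)) w - K n) / sqrt (K n) = W0 n w + Dy y z - y"
          by (simp add: W Dy_def z diff_divide_distrib)
        finally show ?thesis .
      qed
      show ?case
      proof
        assume "\<bar>W0 (fst z) (snd z)\<bar> < L"
        then have WL: "\<bar>W0 n w / \<epsilon>\<bar> < L / \<epsilon>" using \<epsilon> by (simp add: z divide_strict_right_mono)
        let ?i = "\<lceil>W0 n w / \<epsilon>\<rceil> + 1" and ?j = "\<lfloor>W0 n w / \<epsilon>\<rfloor> - 1"
        have ij: "?i \<in> {-m..m}" "?j \<in> {-m..m}"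
          using WL unfolding m_def by (simp_all; linarith)+
        have i: "W0 n w / \<epsilon> + 1 \<le> ?i" "?i < W0 n w / \<epsilon> + 2" by linarith+
        have j: "W0 n w / \<epsilon> - 2 < ?j" "?j \<le> W0 n w / \<epsilon> - 1" by linarith+
        have i': "W0 n w + \<epsilon> \<le> \<epsilon> * ?i" "\<epsilon> * ?i < W0 n w + 2 * \<epsilon>"
          using mult_left_mono[OF i(1), of \<epsilon>] mult_strict_left_mono[OF i(2), of \<epsilon>] \<epsilon>
          by (simp_all add: algebra_simps)
        have j': "W0 n w - 2 * \<epsilon> < \<epsilon> * ?j" "\<epsilon> * ?j \<le> W0 n w - \<epsilon>"
          using mult_left_mono[OF j(2), of \<epsilon>] mult_strict_left_mono[OF j(1), of \<epsilon>] \<epsilon>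
          by (simp_all add: algebra_simps)
        have "\<bar>Dy (\<epsilon> * ?i) z\<bar> < \<epsilon> / 2" "\<bar>Dy (\<epsilon> * ?j) z\<bar> < \<epsilon> / 2"
          using ij unfolding G_def by (blast intro: D[unfolded G_def])+
        with i' j' \<epsilon> have "\<not> \<epsilon> * ?i < Z0 n w" "\<epsilon> * ?j < Z0 n w"
          unfolding Z by linarith+
        with i' j' show "dist (Z0 (fst z) (snd z) - W0 (fst z) (snd z)) 0 < e'"
          by (simp add: z \<epsilon>(2) dist_real_def abs_less_iff)
      qed
    qed
  qed
qed

lemma thr_minus_s0: "((\<lambda>z. thr (fst z) (snd z) - s0 (fst z)) \<longlongrightarrow> 0) (prob_filter M)"
proof -
  have 1: "(\<lambda>n. 1 / sqrt (K n)) \<longlonglongrightarrow> 0"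
    by (rule real_tendsto_divide_at_top[OF tendsto_const sqrt_K_lim])
  note 1 = tendsto_fst_prob_filter[OF this]
  have "((\<lambda>z. 1 / sqrt (K (fst z)) * (Z0 (fst z) (snd z) - W0 (fst z) (snd z)) +
      1 / sqrt (K (fst z)) * W0 (fst z) (snd z)) \<longlongrightarrow> 0 * 0 + 0) (prob_filter M)"
    by (intro tendsto_add tendsto_mult 1 thr_expansion tight_mult_tendsto_0[OF W0_props])
  then have "((\<lambda>z. 1 / sqrt (K (fst z)) * (Z0 (fst z) (snd z) - W0 (fst z) (snd z)) +
      1 / sqrt (K (fst z)) * W0 (fst z) (snd z)) \<longlongrightarrow> 0) (prob_filter M)" by simp
  then show ?thesis
    by (rule Lim_transform_eventually)
      (use eventually_fst_prob_filter[OF eventually_K_N] in \<open>auto elim!: eventually_mono simp: Z0_def field_simps\<close>)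
qed

definition excess :: "nat \<Rightarrow> 'w \<Rightarrow> real" where
  "excess n w = (\<Sum>i\<in>{1..N n}. max 0 (e i w - thr n w)) / K n"

lemma cnt_thr_le:
  assumes "K n < N n" shows "cnt n (thr n w) w \<le> K n"
  using thr_gt_iff[OF assms, of "thr n w" w] by simp

text \<open>Moving the level from s0 to the threshold changes the normalised excess sum by -Z0, up
  to the error of \<open>sum_excess_expansion\<close>. Since Z0 is asymptotically the centred count
  W0, subtracting it from the excess sum at s0 leaves exactly \<open>lin\<close>.\<close>

lemma excess_expansion:
  "((\<lambda>z. sqrt (K (fst z)) * (excess (fst z) (snd z) - 1) - lin (fst z) (snd z)) \<longlongrightarrow> 0) (prob_filter M)"
proof -
  define D where "D z = cnt (fst z) (s0 (fst z)) (snd z) / K (fst z) - 1" for z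
  define b1 where "b1 z = sqrt (K (fst z)) * (excess (fst z) (snd z) - 1) - lin (fst z) (snd z)
     + (Z0 (fst z) (snd z) - W0 (fst z) (snd z))" for z
  have D: "(D \<longlongrightarrow> 0) (prob_filter M)"
    using tendsto_diff[OF cnt_s0_lim tendsto_const[of 1]] by (simp add: D_def[abs_def])
  have "((\<lambda>z. D z * (Z0 (fst z) (snd z) - W0 (fst z) (snd z)) + D z * W0 (fst z) (snd z)) \<longlongrightarrow> 0 * 0 + 0) (prob_filter M)"
    by (intro tendsto_add tendsto_mult D thr_expansion tight_mult_tendsto_0[OF W0_props])
  \<comment> \<open>Z0 has no moment bound of its own; it is handled as the tight W0 plus a
    vanishing term.\<close>
  then have DZ: "((\<lambda>z. D z * Z0 (fst z) (snd z)) \<longlongrightarrow> 0) (prob_filter M)" by (simp add: algebra_simps)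
  have "(b1 \<longlongrightarrow> 0) (prob_filter M)"
  proof (rule Lim_null_comparison[OF _ tendsto_rabs_zero[OF DZ]])
    show "\<forall>\<^sub>F z in prob_filter M. norm (b1 z) \<le> \<bar>D z * Z0 (fst z) (snd z)\<bar>"
      using eventually_fst_prob_filter[OF eventually_K_N] eventually_fst_prob_filter[OF eventually_W0]
    proof eventually_elim
      case (elim z)
      obtain n w where z: "z = (n, w)" by force
      have n: "0 < K n" "K n < N n" and W: "W0 n w = (cnt n (s0 n) w - K n) / sqrt (K n)"
        using elim by (auto simp: z)
      have sK: "sqrt (K n) > 0" "real (K n) = sqrt (K n) * sqrt (K n)" using n by auto
      define S where "S s = (\<Sum>i\<in>{1..N n}. max 0 (e i w - s))" for s
      have "(\<Sum>i\<in>{1..N n}. indicator {thr n w<..} (e i w)) \<le> real (K n)"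
        using cnt_thr_le[OF n(2)] by (simp add: cnt_def)
      moreover have "real (K n) \<le> (\<Sum>i\<in>{1..N n}. indicator {thr n w..} (e i w))"
        using order_stat_ge_iff[OF n(2), of "thr n w" "\<lambda>i. e i w"] by (simp add: thr_def)
      ultimately have *: "\<bar>S (thr n w) - S (s0 n) + K n * (thr n w - s0 n)\<bar>
          \<le> \<bar>thr n w - s0 n\<bar> * \<bar>cnt n (s0 n) w - K n\<bar>"
        unfolding S_def cnt_def by (rule sum_excess_expansion)
      have lin: "lin n w = (S (s0 n) - cnt n (s0 n) w) / sqrt (K n)"
        unfolding lin_def S_def cnt_def sum_subtractf[symmetric]
        by (intro arg_cong2[where f="(/)"] sum.cong) (auto simp: indicator_def)
      have b1: "b1 z = (S (thr n w) - S (s0 n) + K n * (thr n w - s0 n)) / sqrt (K n)"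
      proof -
        have alg: "r * (A / (r * r) - 1) - (S' - c) / r + (r * (t - s) - (c - r * r) / r) = (A - S' + r * r * (t - s)) / r"
          if "r > 0" for r A S' c t s :: real
          using that by (simp add: field_simps)
        have "b1 z = sqrt (K n) * (S (thr n w) / K n - 1) - (S (s0 n) - cnt n (s0 n) w) / sqrt (K n)
          + (sqrt (K n) * (thr n w - s0 n) - (cnt n (s0 n) w - K n) / sqrt (K n))"
          by (simp add: b1_def z excess_def S_def lin W Z0_def)
        also have "\<dots> = (S (thr n w) - S (s0 n) + K n * (thr n w - s0 n)) / sqrt (K n)"
          using alg[OF sK(1)] unfolding sK(2)[symmetric] .
        finally show ?thesis .
      qed
      have "\<bar>b1 z\<bar> \<le> \<bar>thr n w - s0 n\<bar> * \<bar>cnt n (s0 n) w - K n\<bar> / sqrt (K n)"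
        unfolding b1 using * sK(1) by (simp add: divide_right_mono)
      also have "\<dots> = \<bar>D z * Z0 (fst z) (snd z)\<bar>"
      proof -
        have "D z = (cnt n (s0 n) w - K n) / K n" using n by (simp add: D_def z diff_divide_distrib)
        then have Dz: "D z = (cnt n (s0 n) w - K n) / (sqrt (K n) * sqrt (K n))" using sK by simp
        have "\<bar>x\<bar> * \<bar>c\<bar> / r = \<bar>c / (r * r) * (r * x)\<bar>" if "r > 0" for x c r :: real
          using that by (simp add: abs_mult)
        from this[OF sK(1)] show ?thesis unfolding Dz by (simp only: Z0_def z fst_conv snd_conv)
      qed
      finally show ?case by simp
    qed
  qed
  from tendsto_diff[OF this thr_expansion] show ?thesis by (simp add: b1_def)
qed

text \<open>The summand is Lipschitz and vanishes below the level, so the random threshold may be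
  replaced by s0; the weak law then yields the mean of 1 - exp (\<rho> x) under the exponential
  law.\<close>

lemma relative_bias_lim:
  assumes "\<rho> < 0"
  shows "((\<lambda>z. (\<Sum>i\<in>{1..N (fst z)}. 1 - exp (\<rho> * max 0 (e i (snd z) - thr (fst z) (snd z)))) / K (fst z))
     \<longlongrightarrow> 1 - 1 / (1 - \<rho>)) (prob_filter M)"
proof -
  define f where "f x = 1 - exp (\<rho> * max 0 x)" for x
  have f0: "f x = 0" if "x \<le> 0" for x using that by (simp add: f_def)
  have lip: "\<bar>f x - f y\<bar> \<le> (- \<rho>) * \<bar>x - y\<bar>" for x y
  proof -
    have "\<bar>f x - f y\<bar> = \<bar>exp (- ((- \<rho>) * max 0 x)) - exp (- ((- \<rho>) * max 0 y))\<bar>"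
      by (simp add: f_def)
    also have "\<dots> \<le> \<bar>(- \<rho>) * max 0 x - (- \<rho>) * max 0 y\<bar>"
      using assms by (intro abs_exp_neg_diff_le mult_nonneg_nonneg) auto
    also have "\<dots> = (- \<rho>) * \<bar>max 0 x - max 0 y\<bar>"
      using assms by (simp add: abs_mult flip: right_diff_distrib)
    also have "\<dots> \<le> (- \<rho>) * \<bar>x - y\<bar>" using assms by (intro mult_left_mono) auto
    finally show ?thesis .
  qed
  have I1: "has_bochner_integral std_exp (\<lambda>x. 1 - exp (\<rho> * x)) (1 - 1 / (1 - \<rho>))"
    by (intro has_bochner_integral_diff std_exp_const std_exp_exp assms)
  have "has_bochner_integral std_exp (\<lambda>x. 1 - 2 * exp (\<rho> * x) + exp (2 * \<rho> * x)) (1 - 2 * (1 / (1 - \<rho>)) + 1 / (1 - 2 * \<rho>))"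
    using assms by (intro has_bochner_integral_add has_bochner_integral_diff has_bochner_integral_mult_right std_exp_const std_exp_exp) auto
  then have I2: "has_bochner_integral std_exp (\<lambda>x. (1 - exp (\<rho> * x))\<^sup>2) (1 - 2 * (1 / (1 - \<rho>)) + 1 / (1 - 2 * \<rho>))"
    by (simp add: power2_diff mult.assoc algebra_simps flip: exp_double)
  have Kinv: "(\<lambda>n. inverse (real (K n))) \<longlonglongrightarrow> 0"
    by (rule tendsto_inverse_0_at_top[OF K_lim_real])
  have "((\<lambda>z. (\<Sum>i\<in>{1..N (fst z)}. indicator {s0 (fst z)<..} (e i (snd z)) * (1 - exp (\<rho> * (e i (snd z) - s0 (fst z)))))
      / K (fst z)) \<longlongrightarrow> 1 - 1 / (1 - \<rho>)) (prob_filter M)"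
  proof (rule tail_sum_lln[OF _ I1 I2])
    show "(\<lambda>n. real (K n) / (real (K n))\<^sup>2) \<longlonglongrightarrow> 0"
      by (rule Lim_transform_eventually[OF Kinv])
        (use eventually_K_N in eventually_elim, auto simp: power2_eq_square field_simps)
    show "(\<lambda>n. real (K n) * (1 - 1 / (1 - \<rho>)) / real (K n)) \<longlonglongrightarrow> 1 - 1 / (1 - \<rho>)"
      by (rule tendsto_eventually) (use eventually_K_N in eventually_elim, auto)
  qed measurable
  moreover have "indicator {s<..} x * (1 - exp (\<rho> * (x - s))) = f (x - s)" for s x :: real
    by (auto simp: f_def indicator_def)
  ultimately have A: "((\<lambda>z. (\<Sum>i\<in>{1..N (fst z)}. f (e i (snd z) - s0 (fst z))) / K (fst z)) \<longlongrightarrow> 1 - 1 / (1 - \<rho>)) (prob_filter M)"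
    by simp
  have "((\<lambda>z. (- \<rho>) * \<bar>thr (fst z) (snd z) - s0 (fst z)\<bar> * (cnt (fst z) (s0 (fst z)) (snd z) / K (fst z) + 1)) \<longlongrightarrow> (-\<rho>) * \<bar>0\<bar> * (1 + 1)) (prob_filter M)"
    by (intro tendsto_intros thr_minus_s0 cnt_s0_lim)
  then have B: "((\<lambda>z. (- \<rho>) * \<bar>thr (fst z) (snd z) - s0 (fst z)\<bar> * (cnt (fst z) (s0 (fst z)) (snd z) / K (fst z) + 1)) \<longlongrightarrow> 0) (prob_filter M)"
    by simp
  have "((\<lambda>z. (\<Sum>i\<in>{1..N (fst z)}. f (e i (snd z) - thr (fst z) (snd z))) / K (fst z) -
      (\<Sum>i\<in>{1..N (fst z)}. f (e i (snd z) - s0 (fst z))) / K (fst z)) \<longlongrightarrow> 0) (prob_filter M)"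
  proof (rule Lim_null_comparison[OF _ B])
    show "\<forall>\<^sub>F z in prob_filter M. norm ((\<Sum>i\<in>{1..N (fst z)}. f (e i (snd z) - thr (fst z) (snd z))) / K (fst z) -
      (\<Sum>i\<in>{1..N (fst z)}. f (e i (snd z) - s0 (fst z))) / K (fst z)) \<le> (- \<rho>) * \<bar>thr (fst z) (snd z) - s0 (fst z)\<bar> * (cnt (fst z) (s0 (fst z)) (snd z) / K (fst z) + 1)"
      using eventually_fst_prob_filter[OF eventually_K_N]
    proof eventually_elim
      case (elim z)
      obtain n w where z: "z = (n, w)" by force
      have n: "0 < K n" "K n < N n" using elim by (auto simp: z)
      have "\<bar>(\<Sum>i\<in>{1..N n}. f (e i w - thr n w)) - (\<Sum>i\<in>{1..N n}. f (e i w - s0 n))\<bar>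
         \<le> (- \<rho>) * \<bar>thr n w - s0 n\<bar> * (cnt n (s0 n) w + cnt n (thr n w) w)"
        unfolding cnt_def using assms by (intro sum_lipschitz_excess f0 lip) auto
      also have "\<dots> \<le> (- \<rho>) * \<bar>thr n w - s0 n\<bar> * (cnt n (s0 n) w + K n)"
        using assms cnt_thr_le[OF n(2), of w] by (intro mult_left_mono mult_nonneg_nonneg) auto
      finally have "\<bar>(\<Sum>i\<in>{1..N n}. f (e i w - thr n w)) - (\<Sum>i\<in>{1..N n}. f (e i w - s0 n))\<bar> / K n
         \<le> (- \<rho>) * \<bar>thr n w - s0 n\<bar> * (cnt n (s0 n) w + K n) / K n"
        by (rule divide_right_mono) simp
      also have "\<dots> = (- \<rho>) * \<bar>thr n w - s0 n\<bar> * (cnt n (s0 n) w / K n + 1)"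
        using n by (simp add: field_simps)
      finally show ?case by (simp add: z flip: diff_divide_distrib)
    qed
  qed
  from tendsto_add[OF this A] show ?thesis by (simp add: f_def)
qed

text \<open>In ln (q u) - ln (q T) the constant c0 cancels, the linear part gives \<gamma> times the
  excess, and a exp (\<rho> x) gives -a exp (\<rho> T) (1 - exp (\<rho> (u - T))). The last factor
  averages to -\<rho> / (1 - \<rho>) and sqrt K exp (\<rho> T) tends to \<mu>, which explains the
  limit.\<close>

theorem hill_expansion:
  fixes q :: "real \<Rightarrow> real" and y :: "nat \<Rightarrow> 'w \<Rightarrow> real"
  assumes ae: "AE w in M. \<forall>i\<ge>1. 0 < e i w \<and> y i w = q (e i w)"
    and q_mono: "\<And>a b. 0 < a \<Longrightarrow> a \<le> b \<Longrightarrow> q a \<le> q b"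
    and q_pos: "\<forall>\<^sub>F x in at_top. 0 < q x"
    and q_exp: "((\<lambda>x. (ln (q x) - c0 - \<gamma> * x) / exp (\<rho> * x)) \<longlongrightarrow> a) at_top"
    and \<rho>: "\<rho> < 0"
    and \<mu>: "(\<lambda>n. sqrt (K n) * exp (\<rho> * s0 n)) \<longlonglongrightarrow> \<mu>"
  shows "((\<lambda>z. sqrt (K (fst z)) * (hill (\<lambda>i. y i (snd z)) (N (fst z)) (K (fst z)) - \<gamma>) - \<gamma> * lin (fst z) (snd z))
    \<longlongrightarrow> a * \<mu> * \<rho> / (1 - \<rho>)) (prob_filter M)"
proof -
  define bias where "bias z = (\<Sum>i\<in>{1..N (fst z)}. 1 - exp (\<rho> * max 0 (e i (snd z) - thr (fst z) (snd z)))) / K (fst z)" for z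
  define H where "H z = hill (\<lambda>i. y i (snd z)) (N (fst z)) (K (fst z))" for z
  define E where "E z = exp (\<rho> * thr (fst z) (snd z))" for z
  \<comment> \<open>What remains after the linear term and the leading bias is o(exp (\<rho> T)),
    enough because sqrt K exp (\<rho> T) converges.\<close>
  define rem where "rem z = H z - \<gamma> * excess (fst z) (snd z) + a * E z * bias z" for z
  have bias: "(bias \<longlongrightarrow> 1 - 1 / (1 - \<rho>)) (prob_filter M)"
    unfolding bias_def by (rule relative_bias_lim[OF \<rho>])
  have "((\<lambda>z. sqrt (K (fst z)) * exp (\<rho> * s0 (fst z)) * exp (\<rho> * (thr (fst z) (snd z) - s0 (fst z)))) \<longlongrightarrow> \<mu> * exp (\<rho> * 0)) (prob_filter M)"
    by (intro tendsto_intros tendsto_fst_prob_filter[OF \<mu>] thr_minus_s0)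
  moreover have "sqrt (K (fst z)) * exp (\<rho> * s0 (fst z)) * exp (\<rho> * (thr (fst z) (snd z) - s0 (fst z))) = sqrt (K (fst z)) * E z" for z
    unfolding E_def mult.assoc exp_add[symmetric] by (simp add: algebra_simps)
  ultimately have E: "((\<lambda>z. sqrt (K (fst z)) * E z) \<longlongrightarrow> \<mu>) (prob_filter M)" by simp
  have thr_ge: "\<forall>\<^sub>F z in prob_filter M. x < thr (fst z) (snd z)" for x
  proof -
    have "\<forall>\<^sub>F z in prob_filter M. x + 1 < s0 (fst z)"
      by (rule eventually_fst_prob_filter) (use s0_lim filterlim_at_top_dense in blast)
    moreover have "\<forall>\<^sub>F z in prob_filter M. - 1 < thr (fst z) (snd z) - s0 (fst z)"
      by (rule order_tendstoD(1)[OF thr_minus_s0]) simp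
    ultimately show ?thesis by eventually_elim simp
  qed
  have rem: "\<forall>\<^sub>F z in prob_filter M. \<bar>rem z\<bar> \<le> 2 * \<epsilon> * E z" if "\<epsilon> > 0" for \<epsilon>
  proof -
    have "\<forall>\<^sub>F x in at_top. \<bar>(ln (q x) - c0 - \<gamma> * x) / exp (\<rho> * x) - a\<bar> < \<epsilon> \<and> 0 < q x"
      using q_exp q_pos that by (auto simp: tendsto_iff dist_real_def intro: eventually_conj)
    then obtain x0 where x0: "\<And>x. x \<ge> x0 \<Longrightarrow> \<bar>(ln (q x) - c0 - \<gamma> * x) / exp (\<rho> * x) - a\<bar> < \<epsilon> \<and> 0 < q x"
      by (auto simp: eventually_at_top_linorder)
    define r where "r x = (ln (q x) - c0 - \<gamma> * x) / exp (\<rho> * x) - a" for x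
    have lnq: "ln (q x) = c0 + \<gamma> * x + (a + r x) * exp (\<rho> * x)" for x by (simp add: r_def)
    have r: "\<bar>r x\<bar> \<le> \<epsilon>" "0 < q x" if "x \<ge> x0" for x using x0[OF that] by (auto simp: r_def)
    have ev_ae: "\<forall>\<^sub>F z in prob_filter M. \<forall>i\<ge>1. 0 < e i (snd z) \<and> y i (snd z) = q (e i (snd z))"
      by (rule AE_imp_eventually_prob_filter[where P="\<lambda>_ w. \<forall>i\<ge>1. 0 < e i w \<and> y i w = q (e i w)"])
        (use ae in auto)
    show ?thesis
      using thr_ge[of "max 0 x0"] ev_ae eventually_fst_prob_filter[OF eventually_K_N]
    proof eventually_elim
      case (elim z)
      obtain n w where z: "z = (n, w)" by force
      let ?y = "\<lambda>i. y i w" and ?e = "\<lambda>i. e i w"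
      have n: "0 < K n" "K n < N n" and ew: "\<And>i. i \<ge> 1 \<Longrightarrow> 0 < e i w \<and> y i w = q (e i w)"
        and T: "x0 < thr n w" "0 < thr n w"
        using elim by (auto simp: z)
      have sum_lin: "(\<Sum>i=1..K n. g * A i - c * B i + C i) =
          g * (\<Sum>i=1..K n. A i) - c * (\<Sum>i=1..K n. B i) + (\<Sum>i=1..K n. C i)"
        for g c and A B C :: "nat \<Rightarrow> real"
        by (simp add: sum.distrib sum_subtractf sum_distrib_left)
      define T where "T = thr n w"
      define u where "u i = order_stat ?e (N n) (N n - i + 1)" for i
      have os: "order_stat ?y (N n) i = q (order_stat ?e (N n) i)" if "1 \<le> i" "i \<le> N n" for i
        by (rule order_stat_image[where S="{0<..}", OF _ _ _ that]) (use q_mono ew in auto)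
      have uT: "T \<le> u i" if "i \<in> {1..K n}" for i
      proof -
        have "N n - (N n - K n) < card {p\<in>{1..N n}. T \<le> e p w}"
          using n order_stat_pred_iff[of "\<lambda>x. T \<le> x" "N n - K n" "N n" ?e] by (auto simp: T_def thr_def)
        then have "N n - (N n - i + 1) < card {p\<in>{1..N n}. T \<le> e p w}"
          using n that by (elim le_less_trans[rotated]) auto
        moreover have "Suc (N n - i) \<le> N n" using n that by (simp, linarith)
        ultimately show ?thesis
          using n that order_stat_pred_iff[of "\<lambda>x. T \<le> x" "N n - i + 1" "N n" ?e] by (simp add: u_def)
      qed
      have sumf: "(\<Sum>i=1..K n. f (u i - T)) = (\<Sum>i\<in>{1..N n}. f (e i w - T))"
        if "\<And>x. x \<le> 0 \<Longrightarrow> f x = 0" for f :: "real \<Rightarrow> real"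
        using sum_upper_order_stats[OF n(2), of ?e "\<lambda>x. f (x - T)"] that by (simp add: u_def T_def thr_def)
      have "order_stat ?y (N n) (N n - i + 1) = q (u i)" if "i \<in> {1..K n}" for i
        unfolding u_def using n that by (intro os) (simp_all, linarith)
      moreover have "order_stat ?y (N n) (N n - K n) = q T"
        unfolding T_def thr_def using n by (intro os) auto
      ultimately have "H z = (\<Sum>i=1..K n. ln (q (u i) / q T)) / K n"
        by (simp add: H_def hill_def z)
      also have "(\<Sum>i=1..K n. ln (q (u i) / q T)) = (\<Sum>i=1..K n. ln (q (u i)) - ln (q T))"
      proof (intro sum.cong refl)
        fix i assume "i \<in> {1..K n}"
        then have "0 < q (u i)" "0 < q T" using uT[of i] T by (auto intro!: r(2) simp: T_def)
        then show "ln (q (u i) / q T) = ln (q (u i)) - ln (q T)" by (simp add: ln_div)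
      qed
      also have "\<dots> = (\<Sum>i=1..K n. \<gamma> * max 0 (u i - T) - a * exp (\<rho> * T) * (1 - exp (\<rho> * max 0 (u i - T)))
           + (r (u i) * exp (\<rho> * u i) - r T * exp (\<rho> * T)))"
      proof (intro sum.cong refl)
        fix i assume "i \<in> {1..K n}"
        from uT[OF this] have "max 0 (u i - T) = u i - T" by simp
        then show "ln (q (u i)) - ln (q T) = \<gamma> * max 0 (u i - T) - a * exp (\<rho> * T) * (1 - exp (\<rho> * max 0 (u i - T)))
           + (r (u i) * exp (\<rho> * u i) - r T * exp (\<rho> * T))"
          unfolding lnq by (simp add: algebra_simps flip: exp_add)
      qed
      also have "\<dots> = \<gamma> * (\<Sum>i=1..K n. max 0 (u i - T)) - a * exp (\<rho> * T) * (\<Sum>i=1..K n. 1 - exp (\<rho> * max 0 (u i - T)))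
           + (\<Sum>i=1..K n. r (u i) * exp (\<rho> * u i) - r T * exp (\<rho> * T))"
        by (rule sum_lin)
      also have "(\<Sum>i=1..K n. max 0 (u i - T)) = (\<Sum>i\<in>{1..N n}. max 0 (e i w - T))"
        by (rule sumf) simp
      also have "(\<Sum>i=1..K n. 1 - exp (\<rho> * max 0 (u i - T))) = (\<Sum>i\<in>{1..N n}. 1 - exp (\<rho> * max 0 (e i w - T)))"
        by (rule sumf) simp
      finally have remz: "rem z = (\<Sum>i=1..K n. r (u i) * exp (\<rho> * u i) - r T * exp (\<rho> * T)) / K n"
        by (simp add: rem_def excess_def bias_def z E_def T_def add_divide_distrib diff_divide_distrib)
      have "\<bar>rem z\<bar> \<le> (\<Sum>i=1..K n. 2 * \<epsilon> * exp (\<rho> * T)) / K n"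
      proof -
        have "\<bar>r (u i) * exp (\<rho> * u i) - r T * exp (\<rho> * T)\<bar> \<le> 2 * \<epsilon> * exp (\<rho> * T)" if i: "i \<in> {1..K n}" for i
        proof -
          have "\<bar>r (u i)\<bar> * exp (\<rho> * u i) \<le> \<epsilon> * exp (\<rho> * T)"
            using uT[OF i] T \<rho> \<open>\<epsilon> > 0\<close> by (intro mult_mono r) (auto simp: T_def)
          moreover have "\<bar>r T\<bar> * exp (\<rho> * T) \<le> \<epsilon> * exp (\<rho> * T)"
            using T by (intro mult_right_mono r) (auto simp: T_def)
          ultimately show ?thesis
            using abs_triangle_ineq4[of "r (u i) * exp (\<rho> * u i)" "r T * exp (\<rho> * T)"]
            unfolding abs_mult abs_exp_cancel by linarith
        qed
        then have "\<bar>\<Sum>i=1..K n. r (u i) * exp (\<rho> * u i) - r T * exp (\<rho> * T)\<bar> \<le> (\<Sum>i=1..K n. 2 * \<epsilon> * exp (\<rho> * T))"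
          by (intro order.trans[OF sum_abs] sum_mono)
        then have "\<bar>\<Sum>i=1..K n. r (u i) * exp (\<rho> * u i) - r T * exp (\<rho> * T)\<bar> / K n \<le> (\<Sum>i=1..K n. 2 * \<epsilon> * exp (\<rho> * T)) / K n"
          by (rule divide_right_mono) simp
        then show ?thesis unfolding remz by simp
      qed
      also have "\<dots> = 2 * \<epsilon> * E z" using n by (simp add: E_def T_def z)
      finally show ?case .
    qed
  qed
  have "((\<lambda>z. sqrt (K (fst z)) * rem z) \<longlongrightarrow> 0) (prob_filter M)"
    unfolding tendsto_iff
  proof (intro allI impI)
    fix e' :: real assume "e' > 0"
    define \<epsilon> where "\<epsilon> = e' / (4 * (\<bar>\<mu>\<bar> + 1))"
    have \<epsilon>: "\<epsilon> > 0" using \<open>e' > 0\<close> by (simp add: \<epsilon>_def add_nonneg_pos)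
    have "\<forall>\<^sub>F z in prob_filter M. sqrt (K (fst z)) * E z < \<bar>\<mu>\<bar> + 1"
      by (rule order_tendstoD(2)[OF E]) simp
    with rem[OF \<epsilon>] show "\<forall>\<^sub>F z in prob_filter M. dist (sqrt (K (fst z)) * rem z) 0 < e'"
    proof eventually_elim
      case (elim z)
      have "\<bar>sqrt (K (fst z)) * rem z\<bar> \<le> sqrt (K (fst z)) * (2 * \<epsilon> * E z)"
        using elim by (simp add: abs_mult mult_left_mono)
      also have "\<dots> = 2 * \<epsilon> * (sqrt (K (fst z)) * E z)" by simp
      also have "\<dots> \<le> 2 * \<epsilon> * (\<bar>\<mu>\<bar> + 1)" using elim \<epsilon> by (intro mult_left_mono) auto
      also have "\<dots> = e' / 2" by (simp add: \<epsilon>_def field_simps add_nonneg_eq_0_iff)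
      finally show ?case using \<open>e' > 0\<close> by simp
    qed
  qed
  note rem0 = this
  have "((\<lambda>z. \<gamma> * (sqrt (K (fst z)) * (excess (fst z) (snd z) - 1) - lin (fst z) (snd z))
      - a * (sqrt (K (fst z)) * E z) * bias z + sqrt (K (fst z)) * rem z) \<longlongrightarrow>
      \<gamma> * 0 - a * \<mu> * (1 - 1 / (1 - \<rho>)) + 0) (prob_filter M)"
    by (intro tendsto_intros excess_expansion E bias rem0)
  moreover have "\<gamma> * 0 - a * \<mu> * (1 - 1 / (1 - \<rho>)) + 0 = a * \<mu> * \<rho> / (1 - \<rho>)"
    using \<rho> by (simp add: field_simps)
  moreover have "\<gamma> * (sqrt (K (fst z)) * (excess (fst z) (snd z) - 1) - lin (fst z) (snd z))
      - a * (sqrt (K (fst z)) * E z) * bias z + sqrt (K (fst z)) * rem z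
      = sqrt (K (fst z)) * (H z - \<gamma>) - \<gamma> * lin (fst z) (snd z)" for z
    by (simp add: rem_def algebra_simps)
  ultimately show ?thesis by (simp add: H_def)
qed

end

section \<open>Tail covariances of dependent exponential variables\<close>

lemma indicator_greaterThan_measurable[measurable (raw)]:
  fixes f h :: "'a \<Rightarrow> real"
  assumes [measurable]: "f \<in> borel_measurable M" "h \<in> borel_measurable M"
  shows "(\<lambda>z. indicator {h z<..} (f z) :: real) \<in> borel_measurable M"
proof -
  have "(\<lambda>z. if h z < f z then 1 else 0 :: real) \<in> borel_measurable M" by measurable
  then show ?thesis by (simp add: indicator_def)
qed

text \<open>Layer-cake form of the excess; it turns means of excesses into integrals of tail
  probabilities.\<close>

lemma max_0_layer:
  fixes x s :: real
  shows "(\<integral>\<^sup>+ a. ennreal (indicator {0<..} a * indicator {s + a<..} x) \<partial>lborel) = ennreal (max 0 (x - s))"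
proof -
  have "(\<integral>\<^sup>+ a. ennreal (indicator {0<..} a * indicator {s + a<..} x) \<partial>lborel) =
      (\<integral>\<^sup>+ a. indicator {0<..<x - s} a \<partial>lborel)"
    by (intro nn_integral_cong) (auto simp: indicator_def)
  also have "\<dots> = ennreal (max 0 (x - s))"
    by (cases "s \<le> x") (auto simp: max_def)
  finally show ?thesis .
qed

text \<open>The integrand is minus the derivative in h of the product of the excesses of x and y
  over h. Integrating along the diagonal, instead of over a quadrant, raises both levels together,
  and this is what later brings in the factor exp (- h).\<close>

lemma max_0_product_layer:
  fixes x y :: real
  shows "(\<integral>\<^sup>+ h. ennreal (indicator {0<..} h *
      (max 0 (x - h) * indicator {h<..} y + indicator {h<..} x * max 0 (y - h))) \<partial>lborel)
    = ennreal (max 0 x * max 0 y)"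
proof (cases "0 < x \<and> 0 < y")
  case True
  define m where "m = min x y"
  \<comment> \<open>The last fact says that m is x or y; it turns the value (x + y) m - m^2 of the
    antiderivative into x y.\<close>
  have m: "0 < m" "m \<le> x" "m \<le> y" "(m - x) * (m - y) = 0" using True by (auto simp: m_def min_def)
  have "(\<integral>\<^sup>+ h. ennreal (indicator {0<..} h *
      (max 0 (x - h) * indicator {h<..} y + indicator {h<..} x * max 0 (y - h))) \<partial>lborel)
    = (\<integral>\<^sup>+ h. ennreal (x + y - 2 * h) * indicator {0..m} h \<partial>lborel)"
  proof (rule nn_integral_cong_AE)
    have "AE h in lborel. h \<noteq> (0::real)" "AE h in lborel. h \<noteq> m" by (rule AE_lborel_singleton)+
    then show "AE h in lborel. ennreal (indicator {0<..} h *
      (max 0 (x - h) * indicator {h<..} y + indicator {h<..} x * max 0 (y - h)))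
      = ennreal (x + y - 2 * h) * indicator {0..m} h"
    proof eventually_elim
      case (elim h)
      consider "h < 0" | "0 < h" "h < m" | "m < h" using elim by linarith
      then show ?case
      proof cases
        case 2
        then show ?thesis using m by (simp add: indicator_def algebra_simps)
      next
        case 3
        then have "h > 0" "h > x \<or> h > y" using m by (auto simp: m_def)
        then show ?thesis using 3 by (auto simp: indicator_def)
      qed simp
    qed
  qed
  also have "\<dots> = ennreal (((x + y) * m - m * m) - ((x + y) * 0 - 0 * 0))"
    using m by (intro nn_integral_FTC_Icc) (auto intro!: derivative_eq_intros)
  also have "((x + y) * m - m * m) - ((x + y) * 0 - 0 * 0) = max 0 x * max 0 y"
    using m True by (simp add: algebra_simps)
  finally show ?thesis .
next
  case False
  have "(\<integral>\<^sup>+ h. ennreal (indicator {0<..} h *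
      (max 0 (x - h) * indicator {h<..} y + indicator {h<..} x * max 0 (y - h))) \<partial>lborel)
    = (\<integral>\<^sup>+ h. 0 \<partial>(lborel :: real measure))"
    using False by (intro nn_integral_cong) (auto simp: indicator_def max_def)
  also have "\<dots> = ennreal (max 0 x * max 0 y)" using False by (auto simp: max_def)
  finally show ?thesis .
qed

lemma std_exp_excess:
  assumes "s \<ge> 0"
  shows "has_bochner_integral std_exp (\<lambda>x. max 0 (x - s)) (exp (- s))"
proof -
  have "has_bochner_integral std_exp (\<lambda>x. indicator {s<..} x * (x - s) ^ 1) (exp (- s) * fact 1)"
    by (rule std_exp_shift[OF std_exp_power _ assms]) measurable
  moreover have "indicator {s<..} x * (x - s) ^ 1 = max 0 (x - s)" for x :: real
    by (auto simp: indicator_def)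
  ultimately show ?thesis by simp
qed

lemma has_bochner_integral_std_expD:
  assumes "distr M borel e = std_exp" "e \<in> borel_measurable M" "f \<in> borel_measurable borel"
    and "has_bochner_integral std_exp f (I::real)"
  shows "has_bochner_integral M (\<lambda>w. f (e w)) I"
  using assms(4) unfolding assms(1)[symmetric] has_bochner_integral_iff
  using assms(2,3) by (simp add: integrable_distr_eq integral_distr)

locale exp_pair = prob_space M for M :: "'w measure" +
  fixes e1 e2 :: "'w \<Rightarrow> real"
  assumes e1_rv[measurable]: "e1 \<in> borel_measurable M" and e2_rv[measurable]: "e2 \<in> borel_measurable M"
    and e1_exp: "distr M borel e1 = std_exp" and e2_exp: "distr M borel e2 = std_exp"
begin

definition joint_tail :: "real \<Rightarrow> real \<Rightarrow> real" where
  "joint_tail a b = expectation (\<lambda>w. indicator {a<..} (e1 w) * indicator {b<..} (e2 w))"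

definition exc1 :: "real \<Rightarrow> real \<Rightarrow> real" where
  "exc1 s t = expectation (\<lambda>w. max 0 (e1 w - s) * indicator {t<..} (e2 w))"

definition exc2 :: "real \<Rightarrow> real \<Rightarrow> real" where
  "exc2 s t = expectation (\<lambda>w. indicator {s<..} (e1 w) * max 0 (e2 w - t))"

definition exc12 :: "real \<Rightarrow> real \<Rightarrow> real" where
  "exc12 s t = expectation (\<lambda>w. max 0 (e1 w - s) * max 0 (e2 w - t))"

lemma swap: "exp_pair M e2 e1"
  by unfold_locales (auto simp: e1_exp e2_exp)

lemma joint_tail_swap: "exp_pair.joint_tail M e2 e1 a b = joint_tail b a"
  unfolding joint_tail_def exp_pair.joint_tail_def[OF swap] by (simp add: mult.commute)

lemma exc1_swap: "exp_pair.exc1 M e2 e1 a b = exc2 b a"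
  unfolding exc2_def exp_pair.exc1_def[OF swap] by (simp add: mult.commute)

lemma joint_tail_nonneg: "0 \<le> joint_tail a b"
  by (simp add: joint_tail_def)

lemma joint_tail_integrable: "integrable M (\<lambda>w. indicator {a<..} (e1 w) * indicator {b<..} (e2 w) :: real)"
  by (rule integrable_const_bound[of _ 1]) (auto simp: indicator_def)

lemma tail1: "has_bochner_integral M (\<lambda>w. indicator {a<..} (e1 w) :: real) (exp (- max 0 a))"
  by (rule has_bochner_integral_std_expD[OF e1_exp e1_rv _ std_exp_tail]) simp

lemma joint_tail_le1: "joint_tail a b \<le> exp (- max 0 a)"
proof -
  have "joint_tail a b \<le> expectation (\<lambda>w. indicator {a<..} (e1 w))"
    unfolding joint_tail_def using tail1[of a] joint_tail_integrable
    by (intro integral_mono) (auto simp: has_bochner_integral_iff indicator_def)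
  with tail1[of a] show ?thesis by (simp add: has_bochner_integral_iff)
qed

text \<open>Moving one level changes the joint tail by at most the marginal mass in between. The
  bound is uniform in the other level, so varying thresholds can be replaced by their
  limits.\<close>

lemma joint_tail_lipschitz1: "\<bar>joint_tail a b - joint_tail a' b\<bar> \<le> \<bar>exp (- max 0 a) - exp (- max 0 a')\<bar>"
proof -
  have *: "joint_tail a b - joint_tail a' b \<le> exp (- max 0 a) - exp (- max 0 a')"
    "joint_tail a b \<ge> joint_tail a' b" if "a \<le> a'" for a a'
  proof -
    have "joint_tail a b - joint_tail a' b = expectation (\<lambda>w. indicator {a<..} (e1 w) * indicator {b<..} (e2 w)
        - indicator {a'<..} (e1 w) * indicator {b<..} (e2 w))"
      unfolding joint_tail_def using joint_tail_integrable by simp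
    also have "\<dots> \<le> expectation (\<lambda>w. indicator {a<..} (e1 w) - indicator {a'<..} (e1 w))"
      using tail1[of a] tail1[of a'] joint_tail_integrable that
      by (intro integral_mono Bochner_Integration.integrable_diff) (auto simp: has_bochner_integral_iff indicator_def)
    also have "\<dots> = exp (- max 0 a) - exp (- max 0 a')"
      using tail1[of a] tail1[of a'] by (simp add: has_bochner_integral_iff)
    finally show "joint_tail a b - joint_tail a' b \<le> exp (- max 0 a) - exp (- max 0 a')" .
    show "joint_tail a b \<ge> joint_tail a' b"
      unfolding joint_tail_def using joint_tail_integrable that
      by (intro integral_mono) (auto simp: indicator_def)
  qed
  show ?thesis using *[of a a'] *[of a' a] by linarith
qed

lemma integrable_excess: "integrable M (\<lambda>w. max 0 (e1 w - s))"
proof -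
  have "integrable M e1"
    using has_bochner_integral_std_expD[OF e1_exp e1_rv _ std_exp_power[of 1]] by (simp add: has_bochner_integral_iff)
  then show ?thesis by (intro integrable_max) auto
qed

lemma integrable_exc1: "integrable M (\<lambda>w. max 0 (e1 w - s) * indicator {t<..} (e2 w))"
  by (rule Bochner_Integration.integrable_bound[OF integrable_excess[of s]]) (auto simp: indicator_def)

lemma exc1_nonneg: "0 \<le> exc1 s t" by (simp add: exc1_def)

lemma exc1_le:
  assumes "s \<ge> 0" shows "exc1 s t \<le> exp (- s)"
proof -
  have "exc1 s t \<le> expectation (\<lambda>w. max 0 (e1 w - s))"
    unfolding exc1_def using integrable_exc1 integrable_excess by (intro integral_mono) (auto simp: indicator_def)
  also have "\<dots> = exp (- s)"
    using has_bochner_integral_std_expD[OF e1_exp e1_rv _ std_exp_excess[OF assms]]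
    by (simp add: has_bochner_integral_iff)
  finally show ?thesis .
qed

text \<open>Tonelli's theorem, carried out in the extended nonnegative reals so that integrability
  is asked only for each fixed layer.\<close>

lemma expectation_layer:
  fixes F :: "'w \<Rightarrow> real" and f :: "'w \<Rightarrow> real \<Rightarrow> real"
  assumes f: "case_prod f \<in> borel_measurable (M \<Otimes>\<^sub>M lborel)" and F: "F \<in> borel_measurable M"
    and nn: "\<And>w a. 0 \<le> f w a" "\<And>w. 0 \<le> F w"
    and eq: "\<And>w. (\<integral>\<^sup>+ a. ennreal (f w a) \<partial>lborel) = ennreal (F w)"
    and int: "\<And>a. integrable M (\<lambda>w. f w a)"
  shows "expectation F = (LINT a|lborel. expectation (\<lambda>w. f w a))"
proof -
  interpret P: pair_sigma_finite M lborel ..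
  have [measurable]: "case_prod f \<in> borel_measurable (M \<Otimes>\<^sub>M lborel)" by (rule f)
  have "case_prod (\<lambda>a w. f w a) \<in> borel_measurable (lborel \<Otimes>\<^sub>M M)" by measurable
  then have meas: "(\<lambda>a. expectation (\<lambda>w. f w a)) \<in> borel_measurable lborel"
    by (rule borel_measurable_lebesgue_integral)
  have "expectation F = enn2real (\<integral>\<^sup>+ w. ennreal (F w) \<partial>M)"
    using F nn by (intro integral_eq_nn_integral) auto
  also have "(\<integral>\<^sup>+ w. ennreal (F w) \<partial>M) = (\<integral>\<^sup>+ w. (\<integral>\<^sup>+ a. ennreal (f w a) \<partial>lborel) \<partial>M)"
    by (simp add: eq)
  also have "\<dots> = (\<integral>\<^sup>+ a. (\<integral>\<^sup>+ w. ennreal (f w a) \<partial>M) \<partial>lborel)"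
    by (rule P.Fubini'[symmetric]) measurable
  also have "\<dots> = (\<integral>\<^sup>+ a. ennreal (expectation (\<lambda>w. f w a)) \<partial>lborel)"
    using int nn by (intro nn_integral_cong nn_integral_eq_integral) auto
  also have "enn2real \<dots> = (LINT a|lborel. expectation (\<lambda>w. f w a))"
    using meas nn by (intro integral_eq_nn_integral[symmetric]) auto
  finally show ?thesis .
qed

lemma exc1_eq: "exc1 s t = (LINT a|lborel. indicator {0<..} a * joint_tail (s + a) t)"
proof -
  have "exc1 s t = (LINT a|lborel. expectation (\<lambda>w. indicator {0<..} a * (indicator {s + a<..} (e1 w) * indicator {t<..} (e2 w))))"
    unfolding exc1_def
  proof (rule expectation_layer)
    fix w
    have "(\<integral>\<^sup>+ a. ennreal (indicator {0<..} a * (indicator {s + a<..} (e1 w) * indicator {t<..} (e2 w))) \<partial>lborel)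
      = (\<integral>\<^sup>+ a. ennreal (indicator {0<..} a * indicator {s + a<..} (e1 w)) * indicator {t<..} (e2 w) \<partial>lborel)"
      by (intro nn_integral_cong) (auto simp: indicator_def)
    also have "\<dots> = (\<integral>\<^sup>+ a. ennreal (indicator {0<..} a * indicator {s + a<..} (e1 w)) \<partial>lborel) * indicator {t<..} (e2 w)"
      by (rule nn_integral_multc) measurable
    also have "\<dots> = ennreal (max 0 (e1 w - s) * indicator {t<..} (e2 w))"
      unfolding max_0_layer by (auto simp: indicator_def)
    finally show "(\<integral>\<^sup>+ a. ennreal (indicator {0<..} a * (indicator {s + a<..} (e1 w) * indicator {t<..} (e2 w))) \<partial>lborel)
      = ennreal (max 0 (e1 w - s) * indicator {t<..} (e2 w))" .
  next
    show "(\<lambda>(w, a). indicator {0<..} a * (indicator {s + a<..} (e1 w) * indicator {t<..} (e2 w)) :: real) \<in> borel_measurable (M \<Otimes>\<^sub>M lborel)"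
      by measurable
  qed (auto intro: integrable_mult_right joint_tail_integrable)
  also have "\<dots> = (LINT a|lborel. indicator {0<..} a * joint_tail (s + a) t)"
    by (simp add: joint_tail_def)
  finally show ?thesis .
qed

text \<open>By the diagonal layer formula the double excess becomes an integral of single excesses
  at jointly raised levels.\<close>

lemma exc12_eq: "exc12 s t = (LINT h|lborel. indicator {0<..} h * (exc1 (s + h) (t + h) + exc2 (s + h) (t + h)))"
proof -
  interpret sw: exp_pair M e2 e1 by (rule swap)
  have i2: "integrable M (\<lambda>w. indicator {s<..} (e1 w) * max 0 (e2 w - t))" for s t
    using sw.integrable_exc1[of t s] by (simp add: mult.commute)
  have "exc12 s t = (LINT h|lborel. expectation (\<lambda>w. indicator {0<..} h *
      (max 0 (e1 w - (s + h)) * indicator {t + h<..} (e2 w) + indicator {s + h<..} (e1 w) * max 0 (e2 w - (t + h)))))"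
    unfolding exc12_def
  proof (rule expectation_layer)
    fix w
    have "indicator {t + h<..} (e2 w) = (indicator {h<..} (e2 w - t) :: real)"
      "indicator {s + h<..} (e1 w) = (indicator {h<..} (e1 w - s) :: real)" for h
      by (auto simp: indicator_def)
    then show "(\<integral>\<^sup>+ h. ennreal (indicator {0<..} h *
      (max 0 (e1 w - (s + h)) * indicator {t + h<..} (e2 w) + indicator {s + h<..} (e1 w) * max 0 (e2 w - (t + h)))) \<partial>lborel)
      = ennreal (max 0 (e1 w - s) * max 0 (e2 w - t))"
      using max_0_product_layer[of "e1 w - s" "e2 w - t"] by (simp add: algebra_simps)
  next
    show "(\<lambda>(w, h). indicator {0<..} h *
      (max 0 (e1 w - (s + h)) * indicator {t + h<..} (e2 w) + indicator {s + h<..} (e1 w) * max 0 (e2 w - (t + h))) :: real) \<in> borel_measurable (M \<Otimes>\<^sub>M lborel)"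
      by measurable
  qed (auto intro!: integrable_mult_right Bochner_Integration.integrable_add integrable_exc1 i2 add_nonneg_nonneg)
  also have "\<dots> = (LINT h|lborel. indicator {0<..} h * (exc1 (s + h) (t + h) + exc2 (s + h) (t + h)))"
    using i2 integrable_exc1 by (simp add: exc1_def exc2_def)
  finally show ?thesis .
qed

end

lemma integrable_exp_neg_pos: "has_bochner_integral lborel (\<lambda>a::real. indicator {0<..} a * exp (- a)) 1"
proof -
  have "has_bochner_integral lborel (\<lambda>x. exponential_density 1 x * 1) (1::real)"
    by (rule iffD1[OF has_bochner_integral_std_exp std_exp_const]) simp
  moreover have "AE a in lborel. a \<noteq> (0::real)" by (rule AE_lborel_singleton)
  then have "AE a in lborel. exponential_density 1 a * 1 = indicator {0<..} a * exp (- a)"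
    by eventually_elim (auto simp: exp_density_1 indicator_def)
  ultimately show ?thesis by (subst (asm) has_bochner_integral_cong_AE) (auto simp: exp_density_1)
qed

text \<open>In terms of the tail copula, g a b is R at (exp (- a), exp (- b)). In these logarithmic
  coordinates multiplying both arguments by a factor becomes a common shift of the levels.\<close>

locale exp_pair_limit = exp_pair +
  fixes g :: "real \<Rightarrow> real \<Rightarrow> real"
  assumes g_lim: "\<And>a b. ((\<lambda>h. exp h * joint_tail (h + a) (h + b)) \<longlongrightarrow> g a b) at_top"
begin

text \<open>The limit defining g has fixed offsets. Here the second level misses s n + d + b by a
  vanishing amount, and the Lipschitz bound keeps the resulting error small even after scaling by
  exp (s n).\<close>

lemma g_lim_seq:
  fixes s t :: "nat \<Rightarrow> real"
  assumes s: "filterlim s at_top sequentially" and t: "(\<lambda>n. t n - s n) \<longlonglongrightarrow> d"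
  shows "(\<lambda>n. exp (s n) * joint_tail (s n + a) (t n + b)) \<longlonglongrightarrow> g a (d + b)"
proof -
  interpret sw: exp_pair M e2 e1 by (rule swap)
  have 1: "(\<lambda>n. exp (s n) * joint_tail (s n + a) (s n + (d + b))) \<longlonglongrightarrow> g a (d + b)"
    by (rule filterlim_compose[OF g_lim s])
  have "(\<lambda>n. \<bar>exp (- (t n - s n + b)) - exp (- (d + b))\<bar>) \<longlonglongrightarrow> \<bar>exp (- (d + b)) - exp (- (d + b))\<bar>"
    by (intro tendsto_intros t)
  then have 2: "(\<lambda>n. \<bar>exp (- (t n - s n + b)) - exp (- (d + b))\<bar>) \<longlonglongrightarrow> 0" by simp
  have "\<forall>\<^sub>F n in sequentially. s n > \<bar>d\<bar> + \<bar>b\<bar> + 1"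
    using s filterlim_at_top_dense by blast
  moreover have "\<forall>\<^sub>F n in sequentially. t n - s n > d - 1" by (rule order_tendstoD(1)[OF t]) simp
  ultimately have "\<forall>\<^sub>F n in sequentially. norm (exp (s n) * joint_tail (s n + a) (t n + b) - exp (s n) * joint_tail (s n + a) (s n + (d + b)))
      \<le> \<bar>exp (- (t n - s n + b)) - exp (- (d + b))\<bar>"
  proof eventually_elim
    case (elim n)
    then have pos: "t n + b \<ge> 0" "s n + (d + b) \<ge> 0" by linarith+
    have "norm (exp (s n) * joint_tail (s n + a) (t n + b) - exp (s n) * joint_tail (s n + a) (s n + (d + b)))
      = exp (s n) * \<bar>joint_tail (s n + a) (t n + b) - joint_tail (s n + a) (s n + (d + b))\<bar>"
      by (simp add: abs_mult flip: right_diff_distrib)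
    also have "\<dots> \<le> exp (s n) * \<bar>exp (- (t n + b)) - exp (- (s n + (d + b)))\<bar>"
      using sw.joint_tail_lipschitz1[of "t n + b" "s n + a" "s n + (d + b)"] pos
      by (intro mult_left_mono) (auto simp: joint_tail_swap max_def)
    also have "\<dots> = \<bar>exp (s n) * (exp (- (t n + b)) - exp (- (s n + (d + b))))\<bar>"
      by (simp add: abs_mult)
    also have "\<dots> = \<bar>exp (- (t n - s n + b)) - exp (- (d + b))\<bar>"
      by (simp add: algebra_simps flip: exp_add)
    finally show ?case .
  qed
  from Lim_null_comparison[OF this 2] have "(\<lambda>n. exp (s n) * joint_tail (s n + a) (t n + b) - exp (s n) * joint_tail (s n + a) (s n + (d + b))) \<longlonglongrightarrow> 0" .
  from tendsto_add[OF this 1] show ?thesis by simp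
qed

text \<open>Homogeneity of the tail copula, R (c x, c y) = c R (x, y) with c = exp (- t). It comes
  from replacing h by h + t in the defining limit.\<close>

lemma g_shift: "g (a + t) (b + t) = exp (- t) * g a b"
proof (rule tendsto_unique[OF trivial_limit_at_top_linorder])
  show "((\<lambda>h. exp h * joint_tail (h + (a + t)) (h + (b + t))) \<longlongrightarrow> g (a + t) (b + t)) at_top" by (rule g_lim)
  have "filterlim (\<lambda>h. h + t) at_top at_top" by (rule filterlim_tendsto_add_at_top[of "\<lambda>_. t" t _ "\<lambda>h. h", simplified add.commute]) (auto simp: filterlim_ident)
  from tendsto_mult[OF tendsto_const[of "exp (- t)"] filterlim_compose[OF g_lim this, of a b]]
  have "((\<lambda>h. exp (- t) * (exp (h + t) * joint_tail (h + t + a) (h + t + b))) \<longlongrightarrow> exp (- t) * g a b) at_top" .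
  moreover have "exp (- t) * (exp (h + t) * joint_tail (h + t + a) (h + t + b)) = exp h * joint_tail (h + (a + t)) (h + (b + t))" for h
    by (simp add: ac_simps flip: exp_add mult.assoc)
  ultimately show "((\<lambda>h. exp h * joint_tail (h + (a + t)) (h + (b + t))) \<longlongrightarrow> exp (- t) * g a b) at_top"
    by simp
qed

lemma swap_limit: "exp_pair_limit M e2 e1 (\<lambda>a b. g b a)"
proof -
  interpret sw: exp_pair M e2 e1 by (rule swap)
  show ?thesis
    by unfold_locales (simp add: joint_tail_swap g_lim)
qed

text \<open>With u = exp (- a) this is the integral of R (u, exp (- d)) / u over 0 < u < 1.\<close>

definition G1 :: "real \<Rightarrow> real" where "G1 d = (LINT a|lborel. indicator {0<..} a * g a d)"

lemma joint_tail_measurable: "(\<lambda>a. joint_tail (c + a) d) \<in> borel_measurable borel"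
  unfolding joint_tail_def by (rule borel_measurable_lebesgue_integral) measurable

lemma g_measurable: "(\<lambda>a. g a d) \<in> borel_measurable borel"
proof (rule borel_measurable_LIMSEQ_real)
  show "(\<lambda>n. exp (real n) * joint_tail (real n + a) (real n + d)) \<longlonglongrightarrow> g a d" for a
    by (rule filterlim_compose[OF g_lim filterlim_real_sequentially])
  show "(\<lambda>a. exp (real n) * joint_tail (real n + a) (real n + d)) \<in> borel_measurable borel" for n
    by (intro borel_measurable_times borel_measurable_const joint_tail_measurable)
qed

text \<open>Dominated convergence in the layer-cake integral; the marginal tail bounds the scaled
  integrand by exp (- a).\<close>

lemma exc1_lim:
  fixes s t :: "nat \<Rightarrow> real"
  assumes s: "filterlim s at_top sequentially" and t: "(\<lambda>n. t n - s n) \<longlonglongrightarrow> d" and s0: "\<And>n. s n \<ge> 0"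
  shows "(\<lambda>n. exp (s n) * exc1 (s n) (t n)) \<longlonglongrightarrow> G1 d"
proof -
  note joint_tail_measurable[measurable] g_measurable[measurable]
  have "(\<lambda>n. LINT a|lborel. exp (s n) * (indicator {0<..} a * joint_tail (s n + a) (t n)))
      \<longlonglongrightarrow> (LINT a|lborel. indicator {0<..} a * g a d)"
  proof (rule integral_dominated_convergence[where w="\<lambda>a. indicator {0<..} a * exp (- a)"])
    show "integrable lborel (\<lambda>a::real. indicator {0<..} a * exp (- a))"
      using integrable_exp_neg_pos by (simp add: has_bochner_integral_iff)
    show "AE a in lborel. (\<lambda>n. exp (s n) * (indicator {0<..} a * joint_tail (s n + a) (t n))) \<longlonglongrightarrow> indicator {0<..} a * g a d"
    proof (intro AE_I2)
      fix a
      show "(\<lambda>n. exp (s n) * (indicator {0<..} a * joint_tail (s n + a) (t n))) \<longlonglongrightarrow> indicator {0<..} a * g a d"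
        using tendsto_mult[OF tendsto_const[of "indicator {0<..} a"] g_lim_seq[OF s t, of a 0]] by (simp add: mult.left_commute)
    qed
    show "AE a in lborel. norm (exp (s n) * (indicator {0<..} a * joint_tail (s n + a) (t n))) \<le> indicator {0<..} a * exp (- a)" for n
    proof (intro AE_I2)
      fix a
      have "exp (s n) * joint_tail (s n + a) (t n) \<le> exp (- a)" if "a > 0"
      proof -
        have "joint_tail (s n + a) (t n) \<le> exp (- (s n + a))"
          using joint_tail_le1[of "s n + a" "t n"] s0[of n] that by (simp add: max_def)
        then have "exp (s n) * joint_tail (s n + a) (t n) \<le> exp (s n) * exp (- (s n + a))" by simp
        then show ?thesis by (simp flip: exp_add)
      qed
      then show "norm (exp (s n) * (indicator {0<..} a * joint_tail (s n + a) (t n))) \<le> indicator {0<..} a * exp (- a)"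
        using joint_tail_nonneg by (auto simp: indicator_def)
    qed
  qed measurable
  then show ?thesis unfolding exc1_eq G1_def by simp
qed

text \<open>The mirror image of \<open>exc1_lim\<close>. Scaling by exp (s n) rather than exp (t n)
  produces the factor exp (- d).\<close>

lemma exc2_lim:
  fixes s t :: "nat \<Rightarrow> real"
  assumes s: "filterlim s at_top sequentially" and t: "(\<lambda>n. t n - s n) \<longlonglongrightarrow> d"
    and t0: "\<And>n. t n \<ge> 0"
  shows "(\<lambda>n. exp (s n) * exc2 (s n) (t n)) \<longlonglongrightarrow> exp (- d) * exp_pair_limit.G1 (\<lambda>a b. g b a) (- d)"
proof -
  interpret sw: exp_pair_limit M e2 e1 "\<lambda>a b. g b a" by (rule swap_limit)
  have "filterlim (\<lambda>n. (t n - s n) + s n) at_top sequentially"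
    by (rule filterlim_tendsto_add_at_top[OF t s])
  then have tl: "filterlim t at_top sequentially" by simp
  have st: "(\<lambda>n. s n - t n) \<longlonglongrightarrow> - d" using tendsto_minus[OF t] by simp
  have "(\<lambda>n. exp (s n - t n) * (exp (t n) * exc2 (s n) (t n))) \<longlonglongrightarrow> exp (- d) * sw.G1 (- d)"
    using sw.exc1_lim[OF tl st t0] by (intro tendsto_mult tendsto_exp st) (simp add: exc1_swap)
  then show ?thesis by (simp flip: exp_add mult.assoc)
qed

text \<open>Raising both levels by h keeps their limiting difference, so the scaled single excesses
  tend to exp (- h) times their limits at h = 0. As exp (- h) integrates to 1 over the half-line,
  the double excess has the same limit as the sum of the two single ones.\<close>

lemma exc12_lim:
  fixes s t :: "nat \<Rightarrow> real"
  assumes s: "filterlim s at_top sequentially" and t: "(\<lambda>n. t n - s n) \<longlonglongrightarrow> d"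
    and s0: "\<And>n. s n \<ge> 0" and t0: "\<And>n. t n \<ge> 0"
  shows "(\<lambda>n. exp (s n) * exc12 (s n) (t n)) \<longlonglongrightarrow> G1 d + exp (- d) * exp_pair_limit.G1 (\<lambda>a b. g b a) (- d)"
proof -
  interpret sw: exp_pair_limit M e2 e1 "\<lambda>a b. g b a" by (rule swap_limit)
  let ?L = "G1 d + exp (- d) * sw.G1 (- d)"
  from t have "Bseq (\<lambda>n. t n - s n)" by (intro convergent_imp_Bseq convergentI)
  \<comment> \<open>C bounds the gap between the two levels for all n; through exp (s n - t n) <=
    exp C it supplies a dominating function free of n.\<close>
  then obtain C where C: "\<And>n. \<bar>t n - s n\<bar> \<le> C" unfolding Bseq_def by auto
  have m1: "(\<lambda>h. exc1 (s n + h) (t n + h)) \<in> borel_measurable lborel" for n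
    unfolding exc1_def by (rule borel_measurable_lebesgue_integral) measurable
  have m2: "(\<lambda>h. exc2 (s n + h) (t n + h)) \<in> borel_measurable lborel" for n
    unfolding exc2_def by (rule borel_measurable_lebesgue_integral) measurable
  note m1[measurable] m2[measurable]
  have hb: "has_bochner_integral lborel (\<lambda>h. (indicator {0<..} h * exp (- h)) * c) (1 * c)" for c :: real
    by (rule has_bochner_integral_mult_left[OF integrable_exp_neg_pos])
  have "(\<lambda>n. LINT h|lborel. exp (s n) * (indicator {0<..} h * (exc1 (s n + h) (t n + h) + exc2 (s n + h) (t n + h))))
      \<longlonglongrightarrow> (LINT h|lborel. (indicator {0<..} h * exp (- h)) * ?L)"
  proof (rule integral_dominated_convergence[where w="\<lambda>h. (indicator {0<..} h * exp (- h)) * (1 + exp C)"])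
    show "integrable lborel (\<lambda>h::real. (indicator {0<..} h * exp (- h)) * (1 + exp C))"
      using hb[of "1 + exp C"] by (simp add: has_bochner_integral_iff)
    show "AE h in lborel. (\<lambda>n. exp (s n) * (indicator {0<..} h * (exc1 (s n + h) (t n + h) + exc2 (s n + h) (t n + h))))
        \<longlonglongrightarrow> (indicator {0<..} h * exp (- h)) * ?L"
    proof (intro AE_I2)
      fix h :: real
      show "(\<lambda>n. exp (s n) * (indicator {0<..} h * (exc1 (s n + h) (t n + h) + exc2 (s n + h) (t n + h))))
        \<longlonglongrightarrow> (indicator {0<..} h * exp (- h)) * ?L"
      proof (cases "h > 0")
        case True
        have sh: "filterlim (\<lambda>n. s n + h) at_top sequentially"
          using filterlim_tendsto_add_at_top[OF tendsto_const s, of h] by (simp add: add.commute)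
        have th: "(\<lambda>n. (t n + h) - (s n + h)) \<longlonglongrightarrow> d" using t by simp
        have "(\<lambda>n. exp (- h) * (exp (s n + h) * exc1 (s n + h) (t n + h) + exp (s n + h) * exc2 (s n + h) (t n + h)))
          \<longlonglongrightarrow> exp (- h) * ?L"
          using True s0 t0 by (intro tendsto_intros exc1_lim[OF sh th] exc2_lim[OF sh th]) (auto intro: add_nonneg_nonneg)
        moreover have "exp (- h) * (exp (s n + h) * exc1 (s n + h) (t n + h) + exp (s n + h) * exc2 (s n + h) (t n + h))
          = exp (s n) * (indicator {0<..} h * (exc1 (s n + h) (t n + h) + exc2 (s n + h) (t n + h)))" for n
          using True by (simp add: distrib_left flip: mult.assoc exp_add)
        ultimately show ?thesis using True by simp
      qed simp
    qed
    show "AE h in lborel. norm (exp (s n) * (indicator {0<..} h * (exc1 (s n + h) (t n + h) + exc2 (s n + h) (t n + h))))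
        \<le> (indicator {0<..} h * exp (- h)) * (1 + exp C)" for n
    proof (intro AE_I2)
      fix h :: real
      have "exp (s n) * (exc1 (s n + h) (t n + h) + exc2 (s n + h) (t n + h)) \<le> exp (- h) * (1 + exp C)" if "h > 0"
      proof -
        have 1: "exc1 (s n + h) (t n + h) \<le> exp (- (s n + h))" using that s0[of n] by (intro exc1_le) auto
        have "exc2 (s n + h) (t n + h) \<le> exp (- (t n + h))"
          using that t0[of n] sw.exc1_le[of "t n + h" "s n + h"] by (simp add: exc1_swap)
        also have "\<dots> \<le> exp (C - s n - h)" using C[of n] by (simp add: abs_le_iff)
        finally have "exc1 (s n + h) (t n + h) + exc2 (s n + h) (t n + h) \<le> exp (- (s n + h)) + exp (C - s n - h)"
          using 1 by simp
        then have "exp (s n) * (exc1 (s n + h) (t n + h) + exc2 (s n + h) (t n + h)) \<le> exp (s n) * (exp (- (s n + h)) + exp (C - s n - h))"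
          by (rule mult_left_mono) simp
        also have "\<dots> = exp (- h) * (1 + exp C)"
          by (simp add: distrib_left algebra_simps flip: exp_add)
        finally show ?thesis .
      qed
      then show "norm (exp (s n) * (indicator {0<..} h * (exc1 (s n + h) (t n + h) + exc2 (s n + h) (t n + h))))
        \<le> (indicator {0<..} h * exp (- h)) * (1 + exp C)"
        using exc1_nonneg[of "s n + h" "t n + h"] sw.exc1_nonneg[of "t n + h" "s n + h"] by (auto simp: indicator_def exc1_swap)
    qed
  qed measurable
  then show ?thesis
    unfolding exc12_eq has_bochner_integral_integral_eq[OF hb[of ?L]] by simp
qed

text \<open>The two single-excess limits cancel against the double-excess limit: this is where the
  homogeneity of the tail copula enters.\<close>

theorem tail_covariance_lim:
  fixes s t :: "nat \<Rightarrow> real"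
  assumes s: "filterlim s at_top sequentially" and t: "(\<lambda>n. t n - s n) \<longlonglongrightarrow> d"
    and s0: "\<And>n. s n \<ge> 0" and t0: "\<And>n. t n \<ge> 0"
  shows "(\<lambda>n. exp (s n) * expectation (\<lambda>w. (indicator {s n<..} (e1 w) * (e1 w - s n - 1)) *
      (indicator {t n<..} (e2 w) * (e2 w - t n - 1)))) \<longlonglongrightarrow> g 0 d"
proof -
  interpret sw: exp_pair_limit M e2 e1 "\<lambda>a b. g b a" by (rule swap_limit)
  have sq: "integrable M (\<lambda>w. (e1 w)\<^sup>2)" "integrable M (\<lambda>w. (e2 w)\<^sup>2)"
    using has_bochner_integral_std_expD[OF e1_exp e1_rv _ std_exp_power[of 2]]
      has_bochner_integral_std_expD[OF e2_exp e2_rv _ std_exp_power[of 2]]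
    by (simp_all add: has_bochner_integral_iff)
  have i12: "integrable M (\<lambda>w. max 0 (e1 w - s) * max 0 (e2 w - t))" if "s \<ge> 0" "t \<ge> 0" for s t
  proof (rule Bochner_Integration.integrable_bound)
    show "integrable M (\<lambda>w. (e1 w)\<^sup>2 + (e2 w)\<^sup>2)" using sq by simp
    show "AE w in M. norm (max 0 (e1 w - s) * max 0 (e2 w - t)) \<le> norm ((e1 w)\<^sup>2 + (e2 w)\<^sup>2)"
    proof (intro AE_I2)
      fix w
      have "\<bar>max 0 (e1 w - s)\<bar> * \<bar>max 0 (e2 w - t)\<bar> \<le> \<bar>e1 w\<bar> * \<bar>e2 w\<bar>"
        using that by (intro mult_mono) auto
      also have "\<dots> \<le> (e1 w)\<^sup>2 + (e2 w)\<^sup>2"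
      proof -
        have "0 \<le> \<bar>e1 w\<bar> * \<bar>e2 w\<bar>" by simp
        then show ?thesis using sum_squares_bound[of "\<bar>e1 w\<bar>" "\<bar>e2 w\<bar>"]
          unfolding power2_abs mult.assoc by linarith
      qed
      finally show "norm (max 0 (e1 w - s) * max 0 (e2 w - t)) \<le> norm ((e1 w)\<^sup>2 + (e2 w)\<^sup>2)"
        by (simp add: abs_mult)
    qed
  qed measurable
  have i2: "integrable M (\<lambda>w. indicator {s<..} (e1 w) * max 0 (e2 w - t))" for s t
    using sw.integrable_exc1[of t s] by (simp add: mult.commute)
  \<comment> \<open>Above its level each factor is an excess minus an indicator, so the product
    splits into a double excess, two single ones and a joint tail.\<close>
  have eq: "expectation (\<lambda>w. (indicator {s n<..} (e1 w) * (e1 w - s n - 1)) *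
      (indicator {t n<..} (e2 w) * (e2 w - t n - 1)))
    = exc12 (s n) (t n) - exc1 (s n) (t n) - exc2 (s n) (t n) + joint_tail (s n) (t n)" for n
  proof -
    have "(\<lambda>w. (indicator {s n<..} (e1 w) * (e1 w - s n - 1)) * (indicator {t n<..} (e2 w) * (e2 w - t n - 1)))
      = (\<lambda>w. max 0 (e1 w - s n) * max 0 (e2 w - t n) - max 0 (e1 w - s n) * indicator {t n<..} (e2 w)
         - indicator {s n<..} (e1 w) * max 0 (e2 w - t n) + indicator {s n<..} (e1 w) * indicator {t n<..} (e2 w))"
      by (auto simp: fun_eq_iff indicator_def algebra_simps)
    then show ?thesis
      using i12[OF s0 t0] i2 integrable_exc1 joint_tail_integrable
      by (simp add: exc12_def exc1_def exc2_def joint_tail_def)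
  qed
  have "(\<lambda>n. exp (s n) * exc12 (s n) (t n) - exp (s n) * exc1 (s n) (t n) - exp (s n) * exc2 (s n) (t n)
      + exp (s n) * joint_tail (s n + 0) (t n + 0)) \<longlonglongrightarrow>
    (G1 d + exp (- d) * sw.G1 (- d)) - G1 d - exp (- d) * sw.G1 (- d) + g 0 (d + 0)"
    by (intro tendsto_intros exc12_lim exc1_lim exc2_lim g_lim_seq assms)
  then show ?thesis unfolding eq by (simp add: algebra_simps)
qed

end

section \<open>Tail quantile functions of second order\<close>

text \<open>For a pure power \<open>A\<close> with negative exponent, the remainder \<open>g\<close> of the logarithmic expansion
  satisfies \<open>g (2 * t) - g t = o(t powr \<rho>)\<close>; summing the dyadic increments gives a uniform
  expansion without any uniformity theorem for regular variation.\<close>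

lemma dyadic_limit:
  fixes g :: "real \<Rightarrow> real"
  assumes \<rho>: "\<rho> < 0"
    and lim: "\<And>x. x > 0 \<Longrightarrow> ((\<lambda>t. (g (t * x) - g t) / t powr \<rho>) \<longlongrightarrow> 0) at_top"
  shows "\<exists>c0. ((\<lambda>t. (g t - c0) / t powr \<rho>) \<longlongrightarrow> 0) at_top"
proof -
  define p where "p = (2::real) powr \<rho>"
  have p: "0 < p" "p < 1" using \<rho> by (auto simp: p_def powr_less_one)
  have pow2: "(t * 2 ^ n) powr \<rho> = t powr \<rho> * p ^ n" if "t > 0" for t :: real and n
  proof -
    have "((2::real) ^ n) powr \<rho> = p ^ n"
      unfolding p_def by (simp add: powr_powr mult.commute flip: powr_realpow)
    then show ?thesis using that by (simp add: powr_mult)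
  qed
  \<comment> \<open>Telescoping over doublings: the i-th increment is at most \<delta> p^i
    \<open>t powr \<rho>\<close>, and \<delta> = \<epsilon> (1 - p) makes the geometric series sum
    to at most \<epsilon> \<open>t powr \<rho>\<close>.\<close>
  have step: "\<exists>T>0. \<forall>t\<ge>T. \<forall>n. \<bar>g (t * 2 ^ n) - g t\<bar> \<le> \<epsilon> * t powr \<rho>" if "\<epsilon> > 0" for \<epsilon>
  proof -
    define \<delta> where "\<delta> = \<epsilon> * (1 - p)"
    have \<delta>: "\<delta> > 0" using that p by (simp add: \<delta>_def)
    have "\<forall>\<^sub>F t in at_top. \<bar>(g (t * 2) - g t) / t powr \<rho>\<bar> < \<delta>"
      using lim[of 2] \<delta> by (auto simp: tendsto_iff)
    moreover have "\<forall>\<^sub>F t in at_top. (t::real) > 0" by (rule eventually_gt_at_top)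
    ultimately have "\<forall>\<^sub>F t in at_top. \<bar>g (t * 2) - g t\<bar> \<le> \<delta> * t powr \<rho> \<and> t > 0"
      by eventually_elim (simp add: abs_divide pos_divide_less_eq)
    then obtain T where T: "\<And>t. t \<ge> T \<Longrightarrow> \<bar>g (t * 2) - g t\<bar> \<le> \<delta> * t powr \<rho> \<and> t > 0"
      by (auto simp: eventually_at_top_linorder)
    have "\<bar>g (t * 2 ^ n) - g t\<bar> \<le> \<epsilon> * t powr \<rho>" if t: "t \<ge> T" for t n
    proof -
      have t0: "t > 0" using T[OF t] by simp
      have "\<bar>g (t * 2 ^ n) - g t\<bar> \<le> \<delta> * t powr \<rho> * (\<Sum>i<n. p ^ i)"
      proof (induction n)
        case (Suc n)
        have "t * 1 \<le> t * 2 ^ n" using t0 by (intro mult_left_mono) auto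
        then have "T \<le> t * 2 ^ n" using t by simp
        from T[OF this] have "\<bar>g (t * 2 ^ n * 2) - g (t * 2 ^ n)\<bar> \<le> \<delta> * (t powr \<rho> * p ^ n)"
          using pow2[OF t0] by simp
        with Suc show ?case by (simp add: algebra_simps abs_if split: if_splits)
      qed simp
      also have "\<dots> \<le> \<delta> * t powr \<rho> * (1 / (1 - p))"
      proof (rule mult_left_mono)
        have "(\<Sum>i<n. p ^ i) * (1 - p) = 1 - p ^ n"
          using one_diff_power_eq[of p n] by (simp add: mult.commute)
        then have "(\<Sum>i<n. p ^ i) * (1 - p) \<le> 1" using p by simp
        then show "(\<Sum>i<n. p ^ i) \<le> 1 / (1 - p)" using p by (simp add: field_simps)
      qed (use \<delta> in simp)
      also have "\<dots> = \<epsilon> * t powr \<rho>" using p by (simp add: \<delta>_def)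
      finally show ?thesis .
    qed
    moreover have "T > 0" using T[of T] by simp
    ultimately show ?thesis by blast
  qed
  have tp0: "((\<lambda>t. t powr \<rho>) \<longlongrightarrow> 0) at_top" using \<rho> by (intro tendsto_neg_powr filterlim_ident)
  have tn: "filterlim (\<lambda>n. t * 2 ^ n :: real) at_top sequentially" if "t > 0" for t :: real
  proof -
    have "filterlim (\<lambda>n. inverse (inverse 2 ^ n) :: real) at_top sequentially"
      by (intro filterlim_inverse_at_top LIMSEQ_realpow_zero) auto
    then have "filterlim (\<lambda>n. 2 ^ n :: real) at_top sequentially" by (simp add: power_one_over)
    then show ?thesis by (rule filterlim_tendsto_pos_mult_at_top[OF tendsto_const that])
  qed
  \<comment> \<open>Multipliers other than 2 enter only here: dyadic sequences started at any t
    share the limit c0 of the one started at 1.\<close>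
  have diff0: "(\<lambda>n. g (2 ^ n * t) - g (2 ^ n)) \<longlonglongrightarrow> 0" if "t > 0" for t :: real
  proof -
    have "((\<lambda>s. (g (s * t) - g s) / s powr \<rho> * s powr \<rho>) \<longlongrightarrow> 0 * 0) at_top"
      by (intro tendsto_mult lim[OF that] tp0)
    then have "((\<lambda>s. (g (s * t) - g s) / s powr \<rho> * s powr \<rho>) \<longlongrightarrow> 0) at_top" by simp
    moreover have "\<forall>\<^sub>F s in at_top. (g (s * t) - g s) / s powr \<rho> * s powr \<rho> = g (s * t) - g s"
      using eventually_gt_at_top[of "0::real"] by eventually_elim simp
    ultimately have "((\<lambda>s. g (s * t) - g s) \<longlongrightarrow> 0) at_top"
      by (rule Lim_transform_eventually)
    from filterlim_compose[OF this tn[of 1]] show ?thesis by simp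
  qed
  have "Cauchy (\<lambda>n. g (2 ^ n))"
  proof (rule metric_CauchyI)
    fix e :: real assume "e > 0"
    obtain T where T: "T > 0" "\<And>t n. t \<ge> T \<Longrightarrow> \<bar>g (t * 2 ^ n) - g t\<bar> \<le> 1 * t powr \<rho>" using step[of 1] by auto
    have "(\<lambda>m. (2 ^ m :: real) powr \<rho>) \<longlonglongrightarrow> 0"
      using filterlim_compose[OF tp0 tn[of 1]] by simp
    then have "\<forall>\<^sub>F m in sequentially. (2 ^ m :: real) powr \<rho> < e / 2"
      using \<open>e > 0\<close> by (intro order_tendstoD) auto
    moreover have "\<forall>\<^sub>F m in sequentially. (2 ^ m :: real) \<ge> T"
      using filterlim_at_top[THEN iffD1, OF tn[of 1]] by simp
    ultimately have "\<forall>\<^sub>F m in sequentially. (2 ^ m :: real) powr \<rho> < e / 2 \<and> (2 ^ m :: real) \<ge> T" by eventually_elim simp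
    then obtain m0 where m0: "(2 ^ m0 :: real) powr \<rho> < e / 2" "(2 ^ m0 :: real) \<ge> T"
      by (auto simp: eventually_sequentially)
    have "dist (g (2 ^ m)) (g (2 ^ m0)) < e / 2" if "m \<ge> m0" for m
    proof -
      have "(2::real) ^ m = 2 ^ m0 * 2 ^ (m - m0)" using that by (simp flip: power_add)
      then show ?thesis using T(2)[OF m0(2), of "m - m0"] m0(1) by (simp add: dist_real_def)
    qed
    then show "\<exists>M. \<forall>m\<ge>M. \<forall>n\<ge>M. dist (g (2 ^ m)) (g (2 ^ n)) < e"
      by (meson dist_triangle_half_l)
  qed
  then obtain c0 where c0: "(\<lambda>n. g (2 ^ n)) \<longlonglongrightarrow> c0" unfolding Cauchy_convergent_iff convergent_def by blast
  have c0': "(\<lambda>n. g (t * 2 ^ n)) \<longlonglongrightarrow> c0" if "t > 0" for t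
    using tendsto_add[OF diff0[OF that] c0] by (simp add: mult.commute)
  have "((\<lambda>t. (g t - c0) / t powr \<rho>) \<longlongrightarrow> 0) at_top"
    unfolding tendsto_iff
  proof (intro allI impI)
    fix e :: real assume "e > 0"
    then obtain T where T: "T > 0" "\<And>t n. t \<ge> T \<Longrightarrow> \<bar>g (t * 2 ^ n) - g t\<bar> \<le> e / 2 * t powr \<rho>"
      using step[of "e / 2"] by auto
    have "dist ((g t - c0) / t powr \<rho>) 0 < e" if "t \<ge> T" for t
    proof -
      have t0: "t > 0" using that T(1) by simp
      have "(\<lambda>n. \<bar>g (t * 2 ^ n) - g t\<bar>) \<longlonglongrightarrow> \<bar>c0 - g t\<bar>" by (intro tendsto_intros c0' t0)
      then have "\<bar>c0 - g t\<bar> \<le> e / 2 * t powr \<rho>"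
        by (rule tendsto_upperbound) (use T(2)[OF that] in auto)
      also have "\<dots> < e * t powr \<rho>" using \<open>e > 0\<close> t0 by simp
      finally show ?thesis using t0 by (simp add: abs_divide pos_divide_less_eq abs_minus_commute)
    qed
    then show "\<forall>\<^sub>F t in at_top. dist ((g t - c0) / t powr \<rho>) 0 < e"
      by (auto simp: eventually_at_top_linorder)
  qed
  then show ?thesis by blast
qed

text \<open>After taking logarithms, the second-order term is exactly the increment of (C / \<rho>)
  \<open>t powr \<rho>\<close> between t and t x. Subtracting this power leaves a function to which
  \<open>dyadic_limit\<close> applies.\<close>

lemma second_order_ln_expansion:
  fixes Q :: "real \<Rightarrow> real"
  assumes \<gamma>: "\<gamma> > 0" and \<rho>: "\<rho> < 0" and C: "C \<noteq> 0"
    and mono: "\<And>s t. 1 < s \<Longrightarrow> s \<le> t \<Longrightarrow> Q s \<le> Q t"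
    and so: "\<And>x. x > 0 \<Longrightarrow> ((\<lambda>t. 1 / (C * t powr \<rho>) * (Q (t * x) / Q t - x powr \<gamma>))
        \<longlongrightarrow> x powr \<gamma> * ((x powr \<rho> - 1) / \<rho>)) at_top"
  shows "(\<forall>\<^sub>F t in at_top. 0 < Q t) \<and> (\<exists>c0. ((\<lambda>t. (ln (Q t) - c0 - \<gamma> * ln t) / t powr \<rho>) \<longlongrightarrow> C / \<rho>) at_top)"
proof
  define A where "A t = C * t powr \<rho>" for t
  have tp0: "((\<lambda>t. t powr \<rho>) \<longlongrightarrow> 0) at_top" using \<rho> by (intro tendsto_neg_powr filterlim_ident)
  have A0: "(A \<longlongrightarrow> 0) at_top"
    unfolding A_def using tendsto_mult[OF tendsto_const[of C] tp0] by simp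
  have pos: "\<forall>\<^sub>F t in at_top. (t::real) > 0" by (rule eventually_gt_at_top)
  have Anz: "\<forall>\<^sub>F t in at_top. A t \<noteq> 0"
    using pos by eventually_elim (simp add: A_def C)
  have ratio: "((\<lambda>t. Q (t * x) / Q t) \<longlongrightarrow> x powr \<gamma>) at_top" if "x > 0" for x
  proof -
    have "((\<lambda>t. A t * (1 / A t * (Q (t * x) / Q t - x powr \<gamma>)) + x powr \<gamma>) \<longlongrightarrow>
        0 * (x powr \<gamma> * ((x powr \<rho> - 1) / \<rho>)) + x powr \<gamma>) at_top"
      by (intro tendsto_intros A0 so[OF that, folded A_def])
    then have "((\<lambda>t. A t * (1 / A t * (Q (t * x) / Q t - x powr \<gamma>)) + x powr \<gamma>) \<longlongrightarrow> x powr \<gamma>) at_top" by simp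
    then show ?thesis
      by (rule Lim_transform_eventually) (use Anz in \<open>eventually_elim, simp\<close>)
  qed
  \<comment> \<open>If Q t were negative, monotonicity would force Q (2 t) / Q t to be at most 1; if
    Q t were 0, the ratio would be 0 by HOL's convention. Both contradict the limit
    \<open>2 powr \<gamma>\<close>, which exceeds 1.\<close>
  show Qpos: "\<forall>\<^sub>F t in at_top. 0 < Q t"
  proof -
    have "\<forall>\<^sub>F t in at_top. 1 < Q (t * 2) / Q t"
      using \<gamma> by (intro order_tendstoD(1)[OF ratio]) (auto intro: gr_one_powr)
    moreover have "\<forall>\<^sub>F t in at_top. (t::real) > 1" by (rule eventually_gt_at_top)
    ultimately show ?thesis
    proof eventually_elim
      case (elim t)
      have "Q t \<le> Q (t * 2)" using elim by (intro mono) auto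
      show ?case
      proof (rule ccontr)
        assume "\<not> 0 < Q t"
        then consider "Q t = 0" | "Q t < 0" by linarith
        then show False
          using elim \<open>Q t \<le> Q (t * 2)\<close> by cases (auto simp: less_divide_eq)
      qed
    qed
  qed
  define a where "a = C / \<rho>"
  define g where "g t = ln (Q t) - \<gamma> * ln t - a * t powr \<rho>" for t
  have "((\<lambda>t. (g (t * x) - g t) / t powr \<rho>) \<longlongrightarrow> 0) at_top" if x: "x > 0" for x
  proof -
    define L where "L = (x powr \<rho> - 1) / \<rho>"
    \<comment> \<open>Chosen so that 1 + A h is Q (t x) / Q t divided by
      \<open>x powr \<gamma>\<close>; the logarithm can then be expanded at 1.\<close>
    define h where "h t = 1 / A t * (Q (t * x) / Q t - x powr \<gamma>) / x powr \<gamma>" for t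
    have h: "(h \<longlongrightarrow> L) at_top"
    proof -
      have "(h \<longlongrightarrow> x powr \<gamma> * ((x powr \<rho> - 1) / \<rho>) / x powr \<gamma>) at_top"
        unfolding h_def using x by (intro tendsto_divide so[OF x, folded A_def] tendsto_const) auto
      then show ?thesis using x by (simp add: L_def)
    qed
    have Ah: "((\<lambda>t. A t * h t) \<longlongrightarrow> 0) at_top" using tendsto_mult[OF A0 h] by simp
    have lnh: "((\<lambda>t. ln (1 + A t * h t) / A t - h t) \<longlongrightarrow> 0) at_top"
    proof (rule Lim_null_comparison)
      show "((\<lambda>t. 2 * \<bar>A t\<bar> * (h t)\<^sup>2) \<longlongrightarrow> 0) at_top"
      proof -
        have "((\<lambda>t. 2 * \<bar>A t\<bar> * (h t)\<^sup>2) \<longlongrightarrow> 2 * \<bar>0\<bar> * L\<^sup>2) at_top" by (intro tendsto_intros A0 h)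
        then show ?thesis by simp
      qed
      have "\<forall>\<^sub>F t in at_top. \<bar>A t * h t\<bar> < 1 / 2"
        using Ah by (auto simp: tendsto_iff dest: spec[of _ "1/2"])
      with Anz show "\<forall>\<^sub>F t in at_top. norm (ln (1 + A t * h t) / A t - h t) \<le> 2 * \<bar>A t\<bar> * (h t)\<^sup>2"
      proof eventually_elim
        case (elim t)
        have "\<bar>ln (1 + A t * h t) - A t * h t\<bar> \<le> 2 * (A t * h t)\<^sup>2"
          using elim by (intro abs_ln_one_plus_x_minus_x_bound) simp
        also have "2 * (A t * h t)\<^sup>2 = 2 * \<bar>A t\<bar> * (h t)\<^sup>2 * \<bar>A t\<bar>"
          by (simp add: power2_eq_square power_mult_distrib)
        finally have "\<bar>ln (1 + A t * h t) - A t * h t\<bar> / \<bar>A t\<bar> \<le> 2 * \<bar>A t\<bar> * (h t)\<^sup>2"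
          using elim by (simp add: divide_le_eq)
        moreover have "ln (1 + A t * h t) / A t - h t = (ln (1 + A t * h t) - A t * h t) / A t"
          using elim by (simp add: field_simps)
        ultimately show ?case by simp
      qed
    qed
    have "((\<lambda>t. C * (ln (1 + A t * h t) / A t) - a * (x powr \<rho> - 1)) \<longlongrightarrow> C * L - a * (x powr \<rho> - 1)) at_top"
      using tendsto_add[OF lnh h] by (intro tendsto_intros) simp
    moreover have "C * L - a * (x powr \<rho> - 1) = 0" by (simp add: L_def a_def)
    ultimately have "((\<lambda>t. C * (ln (1 + A t * h t) / A t) - a * (x powr \<rho> - 1)) \<longlongrightarrow> 0) at_top" by simp
    then show ?thesis
    proof (rule Lim_transform_eventually)
      have "filterlim (\<lambda>t. t * x) at_top at_top"
        using filterlim_tendsto_pos_mult_at_top[OF tendsto_const x filterlim_ident] by (simp add: mult.commute)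
      then have "\<forall>\<^sub>F t in at_top. 0 < Q (t * x)" using Qpos by (auto simp: filterlim_iff)
      with Qpos pos show "\<forall>\<^sub>F t in at_top. C * (ln (1 + A t * h t) / A t) - a * (x powr \<rho> - 1) = (g (t * x) - g t) / t powr \<rho>"
      proof eventually_elim
        case (elim t)
        have Ah: "1 + A t * h t = Q (t * x) / Q t / x powr \<gamma>"
          using elim C x by (simp add: h_def A_def field_simps)
        have "ln (1 + A t * h t) = ln (Q (t * x)) - ln (Q t) - \<gamma> * ln x"
          unfolding Ah using elim x by (simp add: ln_div ln_mult ln_powr)
        moreover have "g (t * x) - g t = ln (Q (t * x)) - ln (Q t) - \<gamma> * ln x - a * t powr \<rho> * (x powr \<rho> - 1)"
          using elim x by (simp add: g_def ln_mult powr_mult algebra_simps)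
        ultimately have "g (t * x) - g t = ln (1 + A t * h t) - a * t powr \<rho> * (x powr \<rho> - 1)" by simp
        then show ?case using elim C by (simp add: A_def diff_divide_distrib)
      qed
    qed
  qed
  from dyadic_limit[OF \<rho> this] obtain c0 where "((\<lambda>t. (g t - c0) / t powr \<rho>) \<longlongrightarrow> 0) at_top" by blast
  from tendsto_add[OF this tendsto_const[of a]] have "((\<lambda>t. (g t - c0) / t powr \<rho> + a) \<longlongrightarrow> a) at_top" by simp
  then have "((\<lambda>t. (ln (Q t) - c0 - \<gamma> * ln t) / t powr \<rho>) \<longlongrightarrow> a) at_top"
    by (rule Lim_transform_eventually) (use pos in \<open>eventually_elim, simp add: g_def field_simps\<close>)
  then show "\<exists>c0. ((\<lambda>t. (ln (Q t) - c0 - \<gamma> * ln t) / t powr \<rho>) \<longlongrightarrow> C / \<rho>) at_top"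
    by (auto simp: a_def)
qed

section \<open>The probability integral transform\<close>

locale continuous_df = real_distribution +
  assumes cont: "continuous_on UNIV (cdf M)"
begin

definition sf :: "real \<Rightarrow> real" where "sf x = 1 - cdf M x"

lemma sf_antimono: "x \<le> y \<Longrightarrow> sf y \<le> sf x"
  by (simp add: sf_def cdf_nondecreasing)

lemma sf_bounds: "0 \<le> sf x" "sf x \<le> 1"
  by (auto simp: sf_def cdf_bounded_prob cdf_nonneg)

lemma sf_measurable[measurable]: "sf \<in> borel_measurable borel"
  unfolding sf_def[abs_def] using cont by (intro borel_measurable_continuous_onI continuous_intros)

lemma sf_eq_tail: "sf x = prob {x<..}"
proof -
  have "prob (UNIV - {..x}) = 1 - prob {..x}" using prob_compl[of "{..x}"] by simp
  moreover have "UNIV - {..x} = {x<..}" by auto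
  ultimately show ?thesis by (simp add: sf_def cdf_def)
qed

text \<open>Continuity provides a point y with \<open>sf y = u\<close>, and the half-line above y
  lies between the two sets. Equality follows in the next two lemmas by letting u vary.\<close>

lemma prob_sf_between:
  assumes u: "0 < u" "u < 1"
  shows "prob {x. sf x < u} \<le> u" "u \<le> prob {x. sf x \<le> u}"
proof -
  have "\<exists>y. cdf M y = 1 - u"
  proof -
    obtain b where b: "1 - u < cdf M b"
      using order_tendstoD(1)[OF cdf_lim_at_top_prob, of "1 - u"] u
      by (auto simp: eventually_at_top_linorder)
    obtain a where a: "cdf M a < 1 - u"
      using order_tendstoD(2)[OF cdf_lim_at_bot, of "1 - u"] u
      by (auto simp: eventually_at_bot_linorder)
    have "a \<le> b" using a b cdf_nondecreasing[of b a] by linarith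
    with IVT'[of "cdf M" a "1 - u" b] a b show ?thesis
      using continuous_on_subset[OF cont] by auto
  qed
  then obtain y where "cdf M y = 1 - u" by blast
  then have y: "sf y = u" by (simp add: sf_def)
  have "{x. sf x < u} \<subseteq> {y<..}" using sf_antimono y by (force simp: not_le[symmetric])
  then show "prob {x. sf x < u} \<le> u"
    using y sf_eq_tail[of y] finite_measure_mono[of "{x. sf x < u}" "{y<..}"] by simp
  have "{y<..} \<subseteq> {x. sf x \<le> u}" using sf_antimono[of y] y by auto
  then have "prob {y<..} \<le> prob {x. sf x \<le> u}" by (intro finite_measure_mono) auto
  then show "u \<le> prob {x. sf x \<le> u}" using y sf_eq_tail[of y] by simp
qed

lemma prob_sf_le: assumes "0 \<le> u" "u < 1" shows "prob {x. sf x \<le> u} = u"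
proof (rule antisym)
  show "prob {x. sf x \<le> u} \<le> u"
  proof (rule dense_ge_bounded[OF assms(2)])
    fix v assume v: "u < v" "v < 1"
    have "prob {x. sf x \<le> u} \<le> prob {x. sf x < v}" using v by (intro finite_measure_mono) auto
    also have "\<dots> \<le> v" using v assms by (intro prob_sf_between) auto
    finally show "prob {x. sf x \<le> u} \<le> v" .
  qed
  show "u \<le> prob {x. sf x \<le> u}" using prob_sf_between[of u] assms by (cases "u = 0") auto
qed

lemma prob_sf_less: assumes "0 < u" "u \<le> 1" shows "prob {x. sf x < u} = u"
proof (rule antisym)
  show "u \<le> prob {x. sf x < u}"
  proof (rule dense_le_bounded[OF assms(1)])
    fix v assume v: "0 < v" "v < u"
    have "v \<le> prob {x. sf x \<le> v}" using v assms by (intro prob_sf_between) auto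
    also have "\<dots> \<le> prob {x. sf x < u}" using v by (intro finite_measure_mono) auto
    finally show "v \<le> prob {x. sf x < u}" .
  qed
  show "prob {x. sf x < u} \<le> u" using prob_sf_between[of u] assms by (cases "u = 1") auto
qed

text \<open>The survival value of an observation is uniform, hence without atoms.\<close>

lemma AE_sf_neq: "AE x in M. sf x \<noteq> u"
proof -
  have "prob {x. sf x = u} = 0"
  proof (cases "0 \<le> u \<and> u \<le> 1")
    case True
    show ?thesis
    proof (cases "u = 0")
      case True
      then have "{x. sf x = u} = {x. sf x \<le> 0}" using sf_bounds by (auto intro: antisym)
      then show ?thesis using prob_sf_le[of 0] by simp
    next
      case False
      show ?thesis
      proof (cases "u = 1")
        case True
        have "{x. sf x = u} = space M - {x. sf x < 1}" using sf_bounds(2) True by (auto simp: not_less intro: antisym)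
        then show ?thesis using prob_compl[of "{x. sf x < 1}"] prob_sf_less[of 1] by simp
      next
        case u1: False
        have "{x. sf x = u} = {x. sf x \<le> u} - {x. sf x < u}" by auto
        also have "prob \<dots> = prob {x. sf x \<le> u} - prob {x. sf x < u}"
          by (intro finite_measure_Diff) auto
        also have "\<dots> = 0" using prob_sf_le[of u] prob_sf_less[of u] \<open>u \<noteq> 0\<close> u1 \<open>0 \<le> u \<and> u \<le> 1\<close> by simp
        finally show ?thesis .
      qed
    qed
  next
    case False
    then have "{x. sf x = u} = {}" using sf_bounds by auto
    then show ?thesis by simp
  qed
  then have "AE x in M. x \<notin> {x. sf x = u}"
    by (intro AE_not_in) (auto simp: emeasure_eq_measure null_sets_def)
  then show ?thesis by simp
qed

lemma AE_sf_range: "AE x in M. 0 < sf x \<and> sf x < 1"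
  using AE_sf_neq[of 0] AE_sf_neq[of 1]
  by eventually_elim (metis sf_bounds order_le_less)

text \<open>A flat stretch of \<open>sf\<close> ending at x would contain a rational r with
  \<open>sf r = sf x\<close>, and each such equality has probability zero. Observations thus avoid
  the points where the quantile function fails to invert the distribution function.\<close>

lemma AE_sf_strict: "AE x in M. \<forall>y<x. sf x < sf y"
proof -
  have "AE x in M. \<forall>r\<in>\<rat>. sf x \<noteq> sf r"
    by (subst AE_ball_countable) (auto intro: AE_sf_neq countable_rat)
  then show ?thesis
  proof eventually_elim
    case (elim x)
    show ?case
    proof (intro allI impI)
      fix y assume "y < x"
      then obtain r where r: "r \<in> \<rat>" "y < r" "r < x" using Rats_dense_in_real by blast
      then have "sf x \<le> sf r" "sf r \<le> sf y" by (auto intro: sf_antimono)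
      moreover have "sf x \<noteq> sf r" using elim r by auto
      ultimately show "sf x < sf y" by simp
    qed
  qed
qed

lemma distr_neg_ln_sf: "distr M borel (\<lambda>x. - ln (sf x)) = std_exp"
proof -
  have "distributed M lborel (\<lambda>x. - ln (sf x)) (exponential_density 1)"
  proof (subst exponential_distributed_iff, simp, intro conjI allI impI)
    show "(\<lambda>x. - ln (sf x)) \<in> borel_measurable M" by measurable
    fix a :: real assume a: "0 \<le> a"
    have "prob {x \<in> space M. - ln (sf x) \<le> a} = prob (space M - {x. sf x < exp (- a)})"
    proof (rule measure_eq_AE)
      show "AE x in M. x \<in> {x \<in> space M. - ln (sf x) \<le> a} \<longleftrightarrow> x \<in> space M - {x. sf x < exp (- a)}"
        using AE_sf_range
      proof eventually_elim
        case (elim x)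
        then have "- ln (sf x) \<le> a \<longleftrightarrow> exp (- a) \<le> sf x"
          by (metis exp_le_cancel_iff exp_ln minus_le_iff)
        then show ?case by auto
      qed
    qed auto
    also have "\<dots> = 1 - exp (- a)"
      using prob_compl[of "{x. sf x < exp (- a)}"] prob_sf_less[of "exp (- a)"] a by simp
    finally show "prob {x \<in> space M. - ln (sf x) \<le> a} = 1 - exp (- a * 1)" by simp
  qed
  then show ?thesis
    unfolding std_exp_def distributed_def by (simp cong: distr_cong)
qed

end

text \<open>A fixed shift a multiplies the expected count K by exp (- a). The rank conditions of the
  empirical tail copula are compared with such counts.\<close>

lemma (in exp_tail) cnt_shift_lim:
  "((\<lambda>z. cnt (fst z) (s0 (fst z) + a) (snd z) / K (fst z)) \<longlongrightarrow> exp (- a)) (prob_filter M)"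
  unfolding cnt_def
proof (rule scaled_sum_lln[OF ind dist])
  note h = std_exp_tail
  have sq: "(\<lambda>x. (indicator {s<..} x)\<^sup>2) = (indicator {s<..} :: real \<Rightarrow> real)" for s
    by (auto simp: fun_eq_iff indicator_def)
  have "\<forall>\<^sub>F n in sequentially. s0 n > - a" using s0_lim filterlim_at_top_dense by blast
  then have ev: "\<forall>\<^sub>F n in sequentially. N n * exp (- max 0 (s0 n + a)) = K n * exp (- a)"
    using eventually_exp_s0 eventually_K_N
  proof eventually_elim
    case (elim n)
    have "max 0 (s0 n + a) = s0 n + a" using elim(1) by simp
    then have "exp (- max 0 (s0 n + a)) = exp (- s0 n) * exp (- a)" by (simp flip: exp_add)
    then show ?case using elim by simp
  qed
  show "integrable std_exp (\<lambda>x. (indicator {s0 n + a<..} x)\<^sup>2 :: real)" for n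
    unfolding sq using h by (simp add: has_bochner_integral_iff)
  have "(\<lambda>n. exp (- a) * inverse (real (K n))) \<longlonglongrightarrow> exp (- a) * 0"
    by (intro tendsto_intros tendsto_inverse_0_at_top[OF K_lim_real])
  then have "(\<lambda>n. exp (- a) * inverse (real (K n))) \<longlonglongrightarrow> 0" by simp
  then show "(\<lambda>n. real (N n) * (LINT x|std_exp. (indicator {s0 n + a<..} x)\<^sup>2) / (real (K n))\<^sup>2) \<longlonglongrightarrow> 0"
  proof (rule Lim_transform_eventually)
    show "\<forall>\<^sub>F n in sequentially. exp (- a) * inverse (real (K n)) = real (N n) * (LINT x|std_exp. (indicator {s0 n + a<..} x)\<^sup>2) / (real (K n))\<^sup>2"
      unfolding sq has_bochner_integral_integral_eq[OF h]
      using ev eventually_K_N by eventually_elim (simp add: power2_eq_square field_simps)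
  qed
  show "(\<lambda>n. real (N n) * integral\<^sup>L std_exp (indicator {s0 n + a<..}) / real (K n)) \<longlonglongrightarrow> exp (- a)"
    unfolding has_bochner_integral_integral_eq[OF h]
    by (rule tendsto_eventually, use ev eventually_K_N in eventually_elim) simp
qed measurable

text \<open>Cauchy-Schwarz applied twice; it reduces the fourth moment of a linear combination to
  those of its terms.\<close>

lemma sum_power4_le:
  fixes x :: "'i \<Rightarrow> real"
  assumes "finite I"
  shows "(\<Sum>i\<in>I. x i)^4 \<le> (real (card I))^3 * (\<Sum>i\<in>I. (x i)^4)"
proof -
  have 1: "(\<Sum>i\<in>I. x i)\<^sup>2 \<le> (\<Sum>i\<in>I. (x i)\<^sup>2) * card I" by (rule sum_squared_le_sum_of_squares)
  have 2: "(\<Sum>i\<in>I. (x i)\<^sup>2)\<^sup>2 \<le> (\<Sum>i\<in>I. ((x i)\<^sup>2)\<^sup>2) * card I" by (rule sum_squared_le_sum_of_squares)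
  have "(\<Sum>i\<in>I. x i)^4 = ((\<Sum>i\<in>I. x i)\<^sup>2)\<^sup>2" by simp
  also have "\<dots> \<le> ((\<Sum>i\<in>I. (x i)\<^sup>2) * card I)\<^sup>2" using 1 by (intro power_mono) auto
  also have "\<dots> = (\<Sum>i\<in>I. (x i)\<^sup>2)\<^sup>2 * (card I)\<^sup>2" by (simp add: power_mult_distrib)
  also have "\<dots> \<le> ((\<Sum>i\<in>I. ((x i)\<^sup>2)\<^sup>2) * card I) * (card I)\<^sup>2" using 2 by (intro mult_right_mono) auto
  also have "\<dots> = (real (card I))^3 * (\<Sum>i\<in>I. (x i)^4)"
    by (simp add: power3_eq_cube power2_eq_square power4_eq_xxxx mult_ac)
  finally show ?thesis .
qed

section \<open>Dependent samples with exponential margins\<close>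

text \<open>All samples are read off the same independent vectors X i through the maps
  \<open>\<epsilon>\<close>, so the dependence between samples stays inside the common law
  D.\<close>

locale exp_family = prob_space M for M :: "'w measure" +
  fixes X :: "nat \<Rightarrow> 'w \<Rightarrow> 'b::topological_space" and D :: "'b measure"
    and \<epsilon> :: "'m::{finite,linorder} \<Rightarrow> 'b \<Rightarrow> real" and N K :: "nat \<Rightarrow> 'm \<Rightarrow> nat"
    and g :: "'m \<Rightarrow> 'm \<Rightarrow> real \<Rightarrow> real \<Rightarrow> real"
  assumes ind_X: "indep_vars (\<lambda>_. borel) X {1..}"
    and dist_X: "\<And>i. i \<ge> 1 \<Longrightarrow> distr M borel (X i) = D"
    and \<epsilon>_meas[measurable]: "\<And>j. \<epsilon> j \<in> borel_measurable borel"
    and \<epsilon>_exp: "\<And>j. distr D borel (\<epsilon> j) = std_exp"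
    and N_lim: "\<And>j. filterlim (\<lambda>n. N n j) at_top sequentially"
    and K_lim: "\<And>j. filterlim (\<lambda>n. K n j) at_top sequentially"
    and KN_lim: "\<And>j. (\<lambda>n. real (K n j) / real (N n j)) \<longlonglongrightarrow> 0"
    and N_mono: "\<And>n. mono (N n)"
    and g_lim: "\<And>j l a b. j \<noteq> l \<Longrightarrow> ((\<lambda>h. exp h * (LINT x|D. indicator {h + a<..} (\<epsilon> j x) * indicator {h + b<..} (\<epsilon> l x)))
      \<longlongrightarrow> g j l a b) at_top"
begin

lemma X_measurable: "i \<ge> 1 \<Longrightarrow> X i \<in> measurable M borel"
  using ind_X by (auto simp: indep_vars_def2)

lemma sets_D[measurable_cong]: "sets D = sets borel"
  using dist_X[of 1] by auto

lemma prob_space_D: "prob_space D"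
  using dist_X[of 1] prob_space_distr[of "X 1" borel] X_measurable[of 1] by auto

lemma eps_D_measurable: "\<epsilon> j \<in> borel_measurable D"
  by measurable

lemma exp_tail_restrict:
  assumes "filterlim n at_top sequentially" "filterlim k at_top sequentially"
    "(\<lambda>i. real (k i) / real (n i)) \<longlonglongrightarrow> 0"
  shows "exp_tail M (\<lambda>i w. \<epsilon> j (X i w)) n k"
proof
  show "indep_vars (\<lambda>_. borel) (\<lambda>i w. \<epsilon> j (X i w)) {1..}"
    by (rule indep_vars_compose2[OF ind_X]) simp
  show "distr M borel (\<lambda>w. \<epsilon> j (X i w)) = std_exp" if "i \<ge> 1" for i
    using distr_distr[OF \<epsilon>_meas X_measurable[OF that], of j] dist_X[OF that] \<epsilon>_exp[of j]
    by (simp add: comp_def)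
qed (fact assms)+

sublocale tl: exp_tail M "\<lambda>i w. \<epsilon> j (X i w)" "\<lambda>n. N n j" "\<lambda>n. K n j" for j
  by (rule exp_tail_restrict[OF N_lim K_lim KN_lim])

lemma exp_pair_D: "exp_pair D (\<epsilon> j) (\<epsilon> l)"
  using prob_space_D eps_D_measurable \<epsilon>_exp by (auto simp: exp_pair_def exp_pair_axioms_def)

lemma exp_pair_limit_D: "j \<noteq> l \<Longrightarrow> exp_pair_limit D (\<epsilon> j) (\<epsilon> l) (g j l)"
  using exp_pair_D g_lim by (auto simp: exp_pair_limit_def exp_pair_limit_axioms_def exp_pair.joint_tail_def)

text \<open>A product of indicators equals its square, so the mean of the joint count also bounds
  its variance; both are governed by m / k = exp s.\<close>

lemma pair_count_lim:
  assumes jl: "j \<noteq> l" and s: "filterlim s at_top sequentially" and k: "filterlim (\<lambda>n. real (k n)) at_top sequentially"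
    and ev: "\<forall>\<^sub>F n in sequentially. real (m n) / real (k n) = exp (s n)"
  shows "((\<lambda>z. (\<Sum>i\<in>{1..m (fst z)}. indicator {s (fst z) + a<..} (\<epsilon> j (X i (snd z))) * indicator {s (fst z) + b<..} (\<epsilon> l (X i (snd z))))
    / real (k (fst z))) \<longlongrightarrow> g j l a b) (prob_filter M)"
proof (rule scaled_sum_lln[OF ind_X dist_X])
  interpret P: exp_pair_limit D "\<epsilon> j" "\<epsilon> l" "g j l" by (rule exp_pair_limit_D[OF jl])
  define J where "J n = P.joint_tail (s n + a) (s n + b)" for n
  have sq: "(indicator A (x::real) * indicator B (y::real))\<^sup>2 = (indicator A x * indicator B y :: real)" for A B x y
    by (auto simp: indicator_def)
  have J2: "(LINT x|D. (indicator {s n + a<..} (\<epsilon> j x) * indicator {s n + b<..} (\<epsilon> l x))\<^sup>2) = J n" for n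
    unfolding sq J_def P.joint_tail_def ..
  have J1: "(LINT x|D. indicator {s n + a<..} (\<epsilon> j x) * indicator {s n + b<..} (\<epsilon> l x)) = J n" for n
    unfolding J_def P.joint_tail_def ..
  have l: "(\<lambda>n. exp (s n) * J n) \<longlonglongrightarrow> g j l a b"
    unfolding J_def by (rule filterlim_compose[OF P.g_lim s])
  show "integrable D (\<lambda>x. (indicator {s n + a<..} (\<epsilon> j x) * indicator {s n + b<..} (\<epsilon> l x))\<^sup>2 :: real)" for n
    unfolding sq by (rule P.joint_tail_integrable)
  have "(\<lambda>n. (exp (s n) * J n) * inverse (real (k n))) \<longlonglongrightarrow> g j l a b * 0"
    by (intro tendsto_mult l tendsto_inverse_0_at_top[OF k])
  then have "(\<lambda>n. (exp (s n) * J n) * inverse (real (k n))) \<longlonglongrightarrow> 0" by simp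
  then show "(\<lambda>n. real (m n) * (LINT x|D. (indicator {s n + a<..} (\<epsilon> j x) * indicator {s n + b<..} (\<epsilon> l x))\<^sup>2) / (real (k n))\<^sup>2) \<longlonglongrightarrow> 0"
    unfolding J2 by (rule Lim_transform_eventually)
      (use ev in \<open>auto simp: power2_eq_square divide_inverse mult_ac elim!: eventually_mono\<close>)
  show "(\<lambda>n. real (m n) * (LINT x|D. indicator {s n + a<..} (\<epsilon> j x) * indicator {s n + b<..} (\<epsilon> l x)) / real (k n)) \<longlonglongrightarrow> g j l a b"
    unfolding J1 by (rule Lim_transform_eventually[OF l])
      (use ev in \<open>auto simp: divide_inverse mult_ac elim!: eventually_mono\<close>)
qed measurable

text \<open>The rank conditions in the empirical tail copula are sandwiched between exceedances of two
  deterministic thresholds, shifted by \<open>\<plusminus>\<delta>\<close> on the exponential scale.\<close>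

lemma R_hat_lim:
  fixes x :: "'w \<Rightarrow> nat \<Rightarrow> 'm rvec" and u v :: "nat \<Rightarrow> real"
  assumes jl: "j \<noteq> l"
    and order: "AE w in M. \<forall>q. \<forall>i\<ge>1. \<forall>p\<ge>1. x w p $ q \<le> x w i $ q \<longleftrightarrow> \<epsilon> q (X p w) \<le> \<epsilon> q (X i w)"
    and u: "u \<longlonglongrightarrow> u0" "u0 > 0" and v: "v \<longlonglongrightarrow> v0" "v0 > 0"
  shows "((\<lambda>z. R_hat (N (fst z)) (K (fst z)) (x (snd z)) j l (u (fst z)) (v (fst z))) \<longlongrightarrow> g j l (- ln u0) (- ln v0)) (prob_filter M)"
proof -
  let ?R = "\<lambda>z. R_hat (N (fst z)) (K (fst z)) (x (snd z)) j l (u (fst z)) (v (fst z))"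
  \<comment> \<open>Only the first m observations enter the empirical tail copula. With the k
    attached to the pair they form an exponential tail of their own, whose level s is ln (m / k)
    eventually.\<close>
  define m where "m n = min (N n j) (N n l)" for n
  define k where "k n = k_pair (N n) (K n) j l" for n
  have m_lim: "filterlim m at_top sequentially"
    unfolding filterlim_at_top
  proof
    fix Z
    from N_lim[of j] N_lim[of l] have "\<forall>\<^sub>F n in sequentially. Z \<le> N n j" "\<forall>\<^sub>F n in sequentially. Z \<le> N n l"
      by (auto simp: filterlim_at_top)
    then show "\<forall>\<^sub>F n in sequentially. Z \<le> m n" by eventually_elim (simp add: m_def)
  qed
  have k_lim: "filterlim k at_top sequentially"
    unfolding filterlim_at_top
  proof
    fix Z
    from K_lim[of j] K_lim[of l] have "\<forall>\<^sub>F n in sequentially. Z \<le> K n j" "\<forall>\<^sub>F n in sequentially. Z \<le> K n l"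
      by (auto simp: filterlim_at_top)
    then show "\<forall>\<^sub>F n in sequentially. Z \<le> k n" by eventually_elim (simp add: k_def k_pair_def)
  qed
  have km_lim: "(\<lambda>n. real (k n) / real (m n)) \<longlonglongrightarrow> 0"
  proof (rule tendsto_sandwich[OF always_eventually always_eventually tendsto_const])
    show "\<forall>n. 0 \<le> real (k n) / real (m n)" by simp
    show "\<forall>n. real (k n) / real (m n) \<le> real (K n j) / real (N n j) + real (K n l) / real (N n l)"
      by (auto simp: k_def k_pair_def m_def min_def)
    show "(\<lambda>n. real (K n j) / real (N n j) + real (K n l) / real (N n l)) \<longlonglongrightarrow> 0"
      using tendsto_add[OF KN_lim[of j] KN_lim[of l]] by simp
  qed
  interpret Pj: exp_tail M "\<lambda>i w. \<epsilon> j (X i w)" m k by (rule exp_tail_restrict[OF m_lim k_lim km_lim])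
  interpret Pl: exp_tail M "\<lambda>i w. \<epsilon> l (X i w)" m k by (rule exp_tail_restrict[OF m_lim k_lim km_lim])
  define s where "s = Pj.s0"
  define c where "c q a z = (\<Sum>i\<in>{1..m (fst z)}. indicator {s (fst z) + a<..} (\<epsilon> q (X i (snd z))) :: real)" for q a and z :: "nat \<times> 'w"
  define cc where "cc a b z = (\<Sum>i\<in>{1..m (fst z)}. indicator {s (fst z) + a<..} (\<epsilon> j (X i (snd z))) * indicator {s (fst z) + b<..} (\<epsilon> l (X i (snd z))))
    / real (k (fst z))" for a b and z :: "nat \<times> 'w"
  have cj: "((\<lambda>z. c j a z / k (fst z)) \<longlongrightarrow> exp (- a)) (prob_filter M)" for a
    using Pj.cnt_shift_lim[of a] by (simp add: c_def Pj.cnt_def s_def)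
  have cl: "((\<lambda>z. c l a z / k (fst z)) \<longlongrightarrow> exp (- a)) (prob_filter M)" for a
    using Pl.cnt_shift_lim[of a] by (simp add: c_def Pl.cnt_def s_def)
  have ev: "\<forall>\<^sub>F n in sequentially. real (m n) / real (k n) = exp (s n)"
    using Pj.eventually_s0 Pj.eventually_K_N by eventually_elim (simp add: s_def)
  have cc: "(cc a b \<longlongrightarrow> g j l a b) (prob_filter M)" for a b
    unfolding cc_def by (rule pair_count_lim[OF jl _ Pj.K_lim_real ev]) (simp add: s_def Pj.s0_lim)
  interpret P: exp_pair_limit D "\<epsilon> j" "\<epsilon> l" "g j l" by (rule exp_pair_limit_D[OF jl])
  define G where "G = g j l (- ln u0) (- ln v0)"
  \<comment> \<open>The factor (m + 1) / m comes from the rank normalisation in \<open>R_hat\<close>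
    and tends to 1.\<close>
  define thu where "thu u z = u (fst z) * ((real (m (fst z)) + 1) / real (m (fst z)))" for u :: "nat \<Rightarrow> real" and z :: "nat \<times> 'w"
  have thu: "(thu u \<longlongrightarrow> u0) (prob_filter M)" if "u \<longlonglongrightarrow> u0" for u u0
  proof -
    have "(\<lambda>n. 1 + inverse (real (m n))) \<longlonglongrightarrow> 1 + 0"
      by (intro tendsto_intros tendsto_inverse_0_at_top filterlim_compose[OF filterlim_real_sequentially m_lim])
    then have "(\<lambda>n. 1 + inverse (real (m n))) \<longlonglongrightarrow> 1" by simp
    moreover have "\<forall>\<^sub>F n in sequentially. 1 + inverse (real (m n)) = (real (m n) + 1) / real (m n)"
      using Pj.eventually_K_N by eventually_elim (auto simp: field_simps)
    ultimately have "(\<lambda>n. (real (m n) + 1) / real (m n)) \<longlonglongrightarrow> 1" by (rule Lim_transform_eventually)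
    from tendsto_mult[OF that this] have "(\<lambda>n. u n * ((real (m n) + 1) / real (m n))) \<longlonglongrightarrow> u0" by simp
    then show ?thesis unfolding thu_def by (rule tendsto_fst_prob_filter)
  qed
  have order_ev: "\<forall>\<^sub>F z in prob_filter M. \<forall>q. \<forall>i\<ge>1. \<forall>p\<ge>1. x (snd z) p $ q \<le> x (snd z) i $ q \<longleftrightarrow> \<epsilon> q (X p (snd z)) \<le> \<epsilon> q (X i (snd z))"
    by (rule AE_imp_eventually_prob_filter[where P="\<lambda>_ w. \<forall>q. \<forall>i\<ge>1. \<forall>p\<ge>1. x w p $ q \<le> x w i $ q \<longleftrightarrow> \<epsilon> q (X p w) \<le> \<epsilon> q (X i w)"])
      (use order in auto)
  have sandwich: "\<forall>\<^sub>F z in prob_filter M.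
      cc (- ln u0 + \<delta>) (- ln v0 + \<delta>) z \<le> ?R z \<and>
      ?R z \<le> cc (- ln u0 - \<delta>) (- ln v0 - \<delta>) z"
    if \<delta>: "\<delta> > 0" for \<delta>
  proof -
    \<comment> \<open>The relative count at level s + a tends to exp (- a). Moving a by \<delta>
      puts this limit strictly on one side of y, so that the comparison holds with probability
      tending to 1.\<close>
    have lt: "exp (- (- ln y + \<delta>)) < y" "y < exp (- (- ln y - \<delta>))" if "y > 0" for y
      using that \<delta> by (simp_all add: exp_add exp_diff divide_less_eq)
    have A: "\<forall>\<^sub>F z in prob_filter M. f z < h z" if "(f \<longlongrightarrow> a) (prob_filter M)" "(h \<longlongrightarrow> b) (prob_filter M)" "a < b"
      for f h :: "nat \<times> 'w \<Rightarrow> real" and a b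
    proof -
      have "((\<lambda>z. h z - f z) \<longlongrightarrow> b - a) (prob_filter M)" by (intro tendsto_diff that)
      then have "\<forall>\<^sub>F z in prob_filter M. 0 < h z - f z" using that(3) by (intro order_tendstoD) auto
      then show ?thesis by eventually_elim simp
    qed
    show ?thesis
      using A[OF cj thu[OF u(1)] lt(1)[OF u(2)]] A[OF cl thu[OF v(1)] lt(1)[OF v(2)]]
        A[OF thu[OF u(1)] cj lt(2)[OF u(2)]] A[OF thu[OF v(1)] cl lt(2)[OF v(2)]]
        order_ev eventually_fst_prob_filter[OF Pj.eventually_K_N]
    proof eventually_elim
      case (elim z)
      obtain n w where z: "z = (n, w)" by force
      have pos: "0 < k n" "k n < m n" using elim by (auto simp: z)
      have ord: "\<And>q i p. i \<ge> 1 \<Longrightarrow> p \<ge> 1 \<Longrightarrow> x w p $ q \<le> x w i $ q \<longleftrightarrow> \<epsilon> q (X p w) \<le> \<epsilon> q (X i w)"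
        using elim by (auto simp: z)
      define cw where "cw q a = (\<Sum>p\<in>{1..m n}. indicator {a<..} (\<epsilon> q (X p w)) :: real)" for q and a :: real
      define r where "r q i = (real (m n) + 1 - real (rank (\<lambda>p. x w p $ q) (m n) i)) / (real (k n) * (real (m n) + 1) / real (m n))" for q i
      have r: "r q i \<le> y n \<longleftrightarrow> cw q (\<epsilon> q (X i w)) + 1 \<le> thu y z * k n" if i: "i \<in> {1..m n}" for q i y
      proof -
        have "real (rank (\<lambda>p. x w p $ q) (m n) i) = (\<Sum>p\<in>{1..m n}. indicator {..\<epsilon> q (X i w)} (\<epsilon> q (X p w)))"
          unfolding rank_def using i ord
          by (subst card_eq_sum_indicator[symmetric]) (auto intro!: arg_cong[where f=card])
        moreover have "(\<Sum>p\<in>{1..m n}. indicator {..\<epsilon> q (X i w)} (\<epsilon> q (X p w))) + cw q (\<epsilon> q (X i w)) = real (m n)"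
          unfolding cw_def sum.distrib[symmetric]
          by (subst sum.cong[OF refl, of _ _ "\<lambda>_. 1"]) (auto simp: indicator_def)
        ultimately have "real (m n) + 1 - real (rank (\<lambda>p. x w p $ q) (m n) i) = cw q (\<epsilon> q (X i w)) + 1" by simp
        then have "r q i \<le> y n \<longleftrightarrow> (cw q (\<epsilon> q (X i w)) + 1) / (real (k n) * (real (m n) + 1) / real (m n)) \<le> y n"
          unfolding r_def by (simp only:)
        also have "\<dots> \<longleftrightarrow> cw q (\<epsilon> q (X i w)) + 1 \<le> y n * (real (k n) * (real (m n) + 1) / real (m n))"
          using pos by (intro pos_divide_le_eq) simp
        also have "y n * (real (k n) * (real (m n) + 1) / real (m n)) = thu y z * k n"
          by (simp add: thu_def z)
        finally show ?thesis .
      qed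
      \<comment> \<open>Observation i exceeds s + a but is not strictly above itself; it accounts
        for the 1 added to the number of larger observations.\<close>
      have lower: "r q i \<le> y n" if "i \<in> {1..m n}" "s n + a < \<epsilon> q (X i w)" "c q a z / k n < thu y z" for q i a y
      proof -
        have "cw q (\<epsilon> q (X i w)) + 1 = (\<Sum>p\<in>{1..m n}. indicator {\<epsilon> q (X i w)<..} (\<epsilon> q (X p w)) + (if p = i then 1 else 0))"
          using that(1) by (simp add: cw_def sum.distrib)
        also have "\<dots> \<le> c q a z"
          unfolding c_def z fst_conv snd_conv using that(2) by (intro sum_mono) (auto simp: indicator_def)
        also have "\<dots> \<le> thu y z * k n" using that(3) pos by (simp add: divide_less_eq)
        finally show ?thesis using r[OF that(1)] by simp
      qed
      have upper: "s n + a < \<epsilon> q (X i w)" if "i \<in> {1..m n}" "r q i \<le> y n" "thu y z < c q a z / k n" for q i a y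
      proof (rule ccontr)
        assume "\<not> s n + a < \<epsilon> q (X i w)"
        then have "c q a z \<le> cw q (\<epsilon> q (X i w))"
          unfolding c_def cw_def z fst_conv snd_conv by (intro sum_mono) (auto simp: indicator_def)
        moreover have "thu y z * k n < c q a z" using that(3) pos by (simp add: less_divide_eq)
        ultimately show False using r[OF that(1), of q y] that(2) by simp
      qed
      have ccc: "cc a b z = card {i\<in>{1..m n}. s n + a < \<epsilon> j (X i w) \<and> s n + b < \<epsilon> l (X i w)} / k n" for a b
      proof -
        have "(\<Sum>i\<in>{1..m n}. indicator {s n + a<..} (\<epsilon> j (X i w)) * indicator {s n + b<..} (\<epsilon> l (X i w)) :: real)
           = (\<Sum>i\<in>{1..m n}. indicator ({s n + a<..} \<times> {s n + b<..}) (\<epsilon> j (X i w), \<epsilon> l (X i w)))"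
          by (intro sum.cong) (auto simp: indicator_def)
        also have "\<dots> = card {i\<in>{1..m n}. (\<epsilon> j (X i w), \<epsilon> l (X i w)) \<in> {s n + a<..} \<times> {s n + b<..}}"
          by (rule card_eq_sum_indicator[symmetric]) simp
        finally show ?thesis by (simp add: cc_def z)
      qed
      have Rh: "R_hat (N n) (K n) (x w) j l (u n) (v n) = card {i\<in>{1..m n}. r j i \<le> u n \<and> r l i \<le> v n} / k n"
        unfolding R_hat_def Let_def r_def m_def[symmetric] k_def[symmetric] by simp
      have "cc (- ln u0 + \<delta>) (- ln v0 + \<delta>) z \<le> R_hat (N n) (K n) (x w) j l (u n) (v n)"
        unfolding ccc Rh using elim
        by (intro divide_right_mono of_nat_mono card_mono) (auto simp: z intro: lower)
      moreover have "R_hat (N n) (K n) (x w) j l (u n) (v n) \<le> cc (- ln u0 - \<delta>) (- ln v0 - \<delta>) z"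
        unfolding ccc Rh using elim
        by (intro divide_right_mono of_nat_mono card_mono) (auto simp: z intro: upper)
      ultimately show ?case by (simp add: z)
    qed
  qed
  \<comment> \<open>By homogeneity both bounds are multiples of the same value G, so the sandwich
    closes as \<delta> tends to 0.\<close>
  have gs: "g j l (- ln u0 + \<delta>) (- ln v0 + \<delta>) = exp (- \<delta>) * G" "g j l (- ln u0 - \<delta>) (- ln v0 - \<delta>) = exp \<delta> * G" for \<delta>
    using P.g_shift[of "- ln u0" \<delta> "- ln v0"] P.g_shift[of "- ln u0" "- \<delta>" "- ln v0"] by (simp_all add: G_def)
  have "((\<lambda>\<delta>. exp (- \<delta>) * G) \<longlongrightarrow> exp (- 0) * G) (at_right 0)" "((\<lambda>\<delta>. exp \<delta> * G) \<longlongrightarrow> exp 0 * G) (at_right 0)"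
    by (intro tendsto_intros)+
  then have dl: "((\<lambda>\<delta>. exp (- \<delta>) * G) \<longlongrightarrow> G) (at_right 0)" "((\<lambda>\<delta>. exp \<delta> * G) \<longlongrightarrow> G) (at_right 0)"
    by simp_all
  have dpos: "\<forall>\<^sub>F \<delta> in at_right 0. (0::real) < \<delta>" by (rule eventually_at_right_less)
  show ?thesis
    unfolding G_def[symmetric]
  proof (rule order_tendstoI)
    fix y assume "y < G"
    from order_tendstoD(1)[OF dl(1) this] dpos have "\<forall>\<^sub>F \<delta> in at_right 0. y < exp (- \<delta>) * G \<and> 0 < \<delta>" by eventually_elim simp
    then obtain \<delta> where \<delta>: "y < exp (- \<delta>) * G" "\<delta> > 0" by (auto dest!: eventually_happens)
    have "\<forall>\<^sub>F z in prob_filter M. y < cc (- ln u0 + \<delta>) (- ln v0 + \<delta>) z"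
      using \<delta> by (intro order_tendstoD(1)[OF cc]) (simp only: gs)
    with sandwich[OF \<delta>(2)] show "\<forall>\<^sub>F z in prob_filter M. y < ?R z"
      by eventually_elim simp
  next
    fix y assume "G < y"
    from order_tendstoD(2)[OF dl(2) this] dpos have "\<forall>\<^sub>F \<delta> in at_right 0. exp \<delta> * G < y \<and> 0 < \<delta>" by eventually_elim simp
    then obtain \<delta> where \<delta>: "exp \<delta> * G < y" "\<delta> > 0" by (auto dest!: eventually_happens)
    have "\<forall>\<^sub>F z in prob_filter M. cc (- ln u0 - \<delta>) (- ln v0 - \<delta>) z < y"
      using \<delta> by (intro order_tendstoD(2)[OF cc]) (simp only: gs)
    with sandwich[OF \<delta>(2)] show "\<forall>\<^sub>F z in prob_filter M. ?R z < y"
      by eventually_elim simp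
  qed
qed

text \<open>The summand of \<open>lin\<close>, before division by sqrt K, as a function of one
  vector observation.\<close>

definition psi :: "nat \<Rightarrow> 'm \<Rightarrow> 'b \<Rightarrow> real" where
  "psi n j x = indicator {tl.s0 j n<..} (\<epsilon> j x) * (\<epsilon> j x - tl.s0 j n - 1)"

lemma psi_measurable[measurable]: "psi n j \<in> borel_measurable borel"
  unfolding psi_def[abs_def] by measurable

lemma psi_moments:
  "has_bochner_integral D (psi n j) 0"
  "has_bochner_integral D (\<lambda>x. (psi n j x)\<^sup>2) (exp (- tl.s0 j n))"
  "has_bochner_integral D (\<lambda>x. (psi n j x)^4) (9 * exp (- tl.s0 j n))"
proof -
  let ?s = "tl.s0 j n"
  have *: "has_bochner_integral D (\<lambda>x. indicator {?s<..} (\<epsilon> j x) * f (\<epsilon> j x - ?s)) (exp (- ?s) * I)"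
    if "has_bochner_integral std_exp f I" "f \<in> borel_measurable borel" for f I
    using std_exp_shift[OF that tl.s0_nonneg[of j n]] that(2)
    by (intro has_bochner_integral_std_expD[OF \<epsilon>_exp eps_D_measurable]) (auto intro: borel_measurable_times)
  show "has_bochner_integral D (psi n j) 0"
    using *[OF std_exp_minus_one(1)] by (simp add: psi_def[abs_def])
  have "(\<lambda>x. (psi n j x)\<^sup>2) = (\<lambda>x. indicator {?s<..} (\<epsilon> j x) * (\<epsilon> j x - ?s - 1)\<^sup>2)"
    by (auto simp: fun_eq_iff psi_def indicator_def)
  with *[OF std_exp_minus_one(2)] show "has_bochner_integral D (\<lambda>x. (psi n j x)\<^sup>2) (exp (- ?s))" by simp
  have "(\<lambda>x. (psi n j x)^4) = (\<lambda>x. indicator {?s<..} (\<epsilon> j x) * (\<epsilon> j x - ?s - 1)^4)"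
    by (auto simp: fun_eq_iff psi_def indicator_def)
  with *[OF std_exp_minus_one(3)] show "has_bochner_integral D (\<lambda>x. (psi n j x)^4) (9 * exp (- ?s))" by (simp add: mult.commute)
qed

lemma psi_prod_integrable: "integrable D (\<lambda>x. psi n j x * psi n l x)"
proof (rule Bochner_Integration.integrable_bound)
  show "integrable D (\<lambda>x. (psi n j x)\<^sup>2 + (psi n l x)\<^sup>2)"
    using psi_moments(2)[of n j] psi_moments(2)[of n l] by (simp add: has_bochner_integral_iff)
  have "\<bar>a * b\<bar> \<le> a\<^sup>2 + b\<^sup>2" for a b :: real
  proof -
    have "0 \<le> \<bar>a\<bar> * \<bar>b\<bar>" by simp
    then show ?thesis using sum_squares_bound[of "\<bar>a\<bar>" "\<bar>b\<bar>"] unfolding power2_abs mult.assoc abs_mult by linarith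
  qed
  then show "AE x in D. norm (psi n j x * psi n l x) \<le> norm ((psi n j x)\<^sup>2 + (psi n l x)\<^sup>2)"
    by (intro AE_I2) simp
qed measurable

lemma psi_covariance_lim:
  assumes "j \<noteq> l" and d: "(\<lambda>n. tl.s0 l n - tl.s0 j n) \<longlonglongrightarrow> d"
  shows "(\<lambda>n. exp (tl.s0 j n) * (LINT x|D. psi n j x * psi n l x)) \<longlonglongrightarrow> g j l 0 d"
proof -
  interpret P: exp_pair_limit D "\<epsilon> j" "\<epsilon> l" "g j l" by (rule exp_pair_limit_D[OF assms(1)])
  show ?thesis
    unfolding psi_def by (rule P.tail_covariance_lim[OF tl.s0_lim d tl.s0_nonneg tl.s0_nonneg])
qed

text \<open>Grouping the terms by observation instead of by sample gives a row-wise independent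
  array in spite of unequal sample sizes: observation i carries a zero coefficient for each sample
  shorter than i.\<close>

theorem lin_comb_clt:
  fixes \<alpha> :: "'m \<Rightarrow> real" and \<kappa> d :: "'m \<Rightarrow> 'm \<Rightarrow> real"
  assumes \<kappa>: "\<And>j l. (\<lambda>n. real (K n j) / real (K n l)) \<longlonglongrightarrow> \<kappa> j l"
    and d: "\<And>j l. (\<lambda>n. tl.s0 l n - tl.s0 j n) \<longlonglongrightarrow> d j l"
  defines "\<sigma> \<equiv> \<lambda>j l. if j = l then 1 else if j < l then sqrt (\<kappa> j l) * g j l 0 (d j l) else sqrt (\<kappa> l j) * g l j 0 (d l j)"
  shows "(\<lambda>n. char (distr M borel (\<lambda>w. \<Sum>j\<in>UNIV. \<alpha> j * tl.lin j n w)) t)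
     \<longlonglongrightarrow> of_real (exp (- (t\<^sup>2 * (\<Sum>j\<in>UNIV. \<Sum>l\<in>UNIV. \<alpha> j * \<alpha> l * \<sigma> j l) / 2)))"
proof -
  \<comment> \<open>Any bound on all sample sizes would do; beyond the longest sample the
    coefficients \<open>co\<close> vanish.\<close>
  define I where "I n = {1..(\<Sum>j\<in>UNIV. N n j)}" for n
  define co where "co n i j = (if i \<le> N n j then \<alpha> j / sqrt (K n j) else 0)" for n i j
  define f where "f n i x = (\<Sum>j\<in>UNIV. co n i j * psi n j x)" for n i x
  have NI: "N n j \<le> (\<Sum>j\<in>UNIV. N n j)" for n j by (rule member_le_sum) auto
  have fm[measurable]: "f n i \<in> borel_measurable borel" for n i
    unfolding f_def[abs_def] by measurable
  have tr: "integrable M (\<lambda>w. h (X i w)) = integrable D h" "expectation (\<lambda>w. h (X i w)) = integral\<^sup>L D h"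
    if "i \<in> I n" "h \<in> borel_measurable borel" for h :: "'b \<Rightarrow> real" and i n
  proof -
    have i: "i \<ge> 1" using that by (simp add: I_def)
    show "integrable M (\<lambda>w. h (X i w)) = integrable D h" "expectation (\<lambda>w. h (X i w)) = integral\<^sup>L D h"
      using that X_measurable[OF i] unfolding dist_X[OF i, symmetric]
      by (simp_all add: integrable_distr_eq integral_distr)
  qed
  have cosum: "(\<Sum>i\<in>I n. if i \<le> N n j then y i else 0) = (\<Sum>i\<in>{1..N n j}. y i)" for n j and y :: "nat \<Rightarrow> real"
  proof -
    have "(\<Sum>i\<in>{1..N n j}. y i) = (\<Sum>i\<in>{1..N n j}. if i \<le> N n j then y i else 0)" by (intro sum.cong) auto
    also have "\<dots> = (\<Sum>i\<in>I n. if i \<le> N n j then y i else 0)"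
      using NI[of n j] by (intro sum.mono_neutral_left) (auto simp: I_def)
    finally show ?thesis ..
  qed
  have coconst: "(\<Sum>i\<in>I n. if i \<le> N n j \<and> i \<le> N n l then y else 0) = min (N n j) (N n l) * y" for n j l and y :: real
  proof -
    have "(\<Sum>i\<in>I n. if i \<le> N n j \<and> i \<le> N n l then y else 0) = (\<Sum>i\<in>{1..min (N n j) (N n l)}. y)"
      using NI[of n j] NI[of n l] by (intro sum.mono_neutral_cong_right) (auto simp: I_def)
    then show ?thesis by simp
  qed
  have S_eq: "(\<Sum>i\<in>I n. f n i (X i w)) = (\<Sum>j\<in>UNIV. \<alpha> j * tl.lin j n w)" for n w
  proof -
    have "(\<Sum>i\<in>I n. f n i (X i w)) = (\<Sum>j\<in>UNIV. \<Sum>i\<in>I n. if i \<le> N n j then \<alpha> j / sqrt (K n j) * psi n j (X i w) else 0)"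
      unfolding f_def by (subst sum.swap) (intro sum.cong refl, simp add: co_def)
    also have "\<dots> = (\<Sum>j\<in>UNIV. \<Sum>i\<in>{1..N n j}. \<alpha> j / sqrt (K n j) * psi n j (X i w))"
      unfolding cosum ..
    also have "\<dots> = (\<Sum>j\<in>UNIV. \<alpha> j * tl.lin j n w)"
      unfolding tl.lin_def psi_def sum_distrib_left sum_divide_distrib
      by (intro sum.cong refl) simp
    finally show ?thesis .
  qed
  have f2: "has_bochner_integral D (\<lambda>x. (f n i x)\<^sup>2) (\<Sum>j\<in>UNIV. \<Sum>l\<in>UNIV. co n i j * co n i l * (LINT x|D. psi n j x * psi n l x))" for n i
  proof -
    have "(\<lambda>x. (f n i x)\<^sup>2) = (\<lambda>x. \<Sum>j\<in>UNIV. \<Sum>l\<in>UNIV. co n i j * co n i l * (psi n j x * psi n l x))"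
      by (simp add: f_def power2_eq_square sum_product mult_ac)
    then show ?thesis
      using psi_prod_integrable by (auto intro!: has_bochner_integral_sum has_bochner_integral_mult_right has_bochner_integral_integrable)
  qed
  have f4_bound: "(f n i x)^4 \<le> (real CARD('m))^3 * (\<Sum>j\<in>UNIV. (co n i j)^4 * (psi n j x)^4)" for n i x
    unfolding f_def using sum_power4_le[of UNIV "\<lambda>j. co n i j * psi n j x"] by (simp add: power_mult_distrib)
  have f4_b: "has_bochner_integral D (\<lambda>x. (real CARD('m))^3 * (\<Sum>j\<in>UNIV. (co n i j)^4 * (psi n j x)^4))
      ((real CARD('m))^3 * (\<Sum>j\<in>UNIV. (co n i j)^4 * (9 * exp (- tl.s0 j n))))" for n i
    by (intro has_bochner_integral_mult_right has_bochner_integral_sum psi_moments)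
  have f4_int: "integrable D (\<lambda>x. (f n i x)^4)" for n i
  proof (rule Bochner_Integration.integrable_bound)
    show "integrable D (\<lambda>x. (real CARD('m))^3 * (\<Sum>j\<in>UNIV. (co n i j)^4 * (psi n j x)^4))"
      using f4_b by (simp add: has_bochner_integral_iff)
    show "AE x in D. norm ((f n i x)^4) \<le> norm ((real CARD('m))^3 * (\<Sum>j\<in>UNIV. (co n i j)^4 * (psi n j x)^4))"
    proof (intro AE_I2)
      fix x
      have "0 \<le> (f n i x)^4" by simp
      then show "norm ((f n i x)^4) \<le> norm ((real CARD('m))^3 * (\<Sum>j\<in>UNIV. (co n i j)^4 * (psi n j x)^4))"
        using f4_bound[of n i x] unfolding real_norm_def by linarith
    qed
  qed measurable
  have f4_le: "(LINT x|D. (f n i x)^4) \<le> (real CARD('m))^3 * (\<Sum>j\<in>UNIV. (co n i j)^4 * (9 * exp (- tl.s0 j n)))" for n i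
    using f4_b[of n i] integral_mono[OF f4_int _ f4_bound, of n i] by (simp add: has_bochner_integral_iff)
  have "(\<lambda>n. char (distr M borel (\<lambda>w. \<Sum>i\<in>I n. f n i (X i w))) t)
     \<longlonglongrightarrow> of_real (exp (- (t\<^sup>2 * (\<Sum>j\<in>UNIV. \<Sum>l\<in>UNIV. \<alpha> j * \<alpha> l * \<sigma> j l) / 2)))"
  proof (rule lyapunov_clt_char)
    show "indep_vars (\<lambda>_. borel) (\<lambda>i w. f n i (X i w)) (I n)" for n
      by (rule indep_vars_compose2[OF indep_vars_subset[OF ind_X]]) (auto simp: I_def)
    show "finite (I n)" for n by (simp add: I_def)
    show "integrable M (\<lambda>w. (f n i (X i w))^4)" if "i \<in> I n" for n i
      using tr(1)[OF that, of "\<lambda>x. (f n i x)^4"] f4_int by simp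
    show "expectation (\<lambda>w. f n i (X i w)) = 0" if "i \<in> I n" for n i
    proof -
      have "has_bochner_integral D (f n i) (\<Sum>j\<in>UNIV. co n i j * 0)"
        unfolding f_def[abs_def] by (intro has_bochner_integral_mult_right has_bochner_integral_sum psi_moments)
      then show ?thesis using tr(2)[OF that fm] by (simp add: has_bochner_integral_iff)
    qed
    show "(\<lambda>n. \<Sum>i\<in>I n. expectation (\<lambda>w. (f n i (X i w))\<^sup>2)) \<longlonglongrightarrow> (\<Sum>j\<in>UNIV. \<Sum>l\<in>UNIV. \<alpha> j * \<alpha> l * \<sigma> j l)"
    proof -
      define cv where "cv n j l = min (N n j) (N n l) / (sqrt (K n j) * sqrt (K n l)) * (LINT x|D. psi n j x * psi n l x)" for n j l
      have "(\<Sum>i\<in>I n. expectation (\<lambda>w. (f n i (X i w))\<^sup>2)) = (\<Sum>j\<in>UNIV. \<Sum>l\<in>UNIV. \<alpha> j * \<alpha> l * cv n j l)" for n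
      proof -
        have "(\<Sum>i\<in>I n. expectation (\<lambda>w. (f n i (X i w))\<^sup>2)) =
          (\<Sum>i\<in>I n. \<Sum>j\<in>UNIV. \<Sum>l\<in>UNIV. co n i j * co n i l * (LINT x|D. psi n j x * psi n l x))"
        proof (intro sum.cong refl)
          fix i assume "i \<in> I n"
          from tr(2)[OF this, of "\<lambda>x. (f n i x)\<^sup>2"] f2[of n i]
          show "expectation (\<lambda>w. (f n i (X i w))\<^sup>2) = (\<Sum>j\<in>UNIV. \<Sum>l\<in>UNIV. co n i j * co n i l * (LINT x|D. psi n j x * psi n l x))"
            by (simp add: has_bochner_integral_iff)
        qed
        also have "\<dots> = (\<Sum>j\<in>UNIV. \<Sum>l\<in>UNIV. \<Sum>i\<in>I n. co n i j * co n i l * (LINT x|D. psi n j x * psi n l x))"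
          by (subst sum.swap, rule sum.cong[OF refl], rule sum.swap)
        also have "\<dots> = (\<Sum>j\<in>UNIV. \<Sum>l\<in>UNIV. \<Sum>i\<in>I n. if i \<le> N n j \<and> i \<le> N n l then \<alpha> j / sqrt (K n j) * (\<alpha> l / sqrt (K n l)) * (LINT x|D. psi n j x * psi n l x) else 0)"
          by (intro sum.cong refl) (simp add: co_def)
        also have "\<dots> = (\<Sum>j\<in>UNIV. \<Sum>l\<in>UNIV. \<alpha> j * \<alpha> l * cv n j l)"
          unfolding coconst by (simp add: cv_def mult_ac)
        finally show ?thesis .
      qed
      moreover have cv_less: "(\<lambda>n. cv n j l) \<longlonglongrightarrow> sqrt (\<kappa> j l) * g j l 0 (d j l)" if "j < l" for j l
      proof -
        have "(\<lambda>n. sqrt (real (K n j) / real (K n l)) * (exp (tl.s0 j n) * (LINT x|D. psi n j x * psi n l x))) \<longlonglongrightarrow> sqrt (\<kappa> j l) * g j l 0 (d j l)"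
          using that by (intro tendsto_mult tendsto_real_sqrt \<kappa> psi_covariance_lim d) auto
        then show ?thesis
        proof (rule Lim_transform_eventually)
          show "\<forall>\<^sub>F n in sequentially. sqrt (real (K n j) / real (K n l)) * (exp (tl.s0 j n) * (LINT x|D. psi n j x * psi n l x)) = cv n j l"
            using tl.eventually_s0[of j] tl.eventually_K_N[of j] tl.eventually_K_N[of l]
          proof eventually_elim
            case (elim n)
            \<comment> \<open>Sample sizes increase with the index, so for j < l the shared
              observations are the first N n j. Together with exp s0 = N / K this leaves the factor
              sqrt (K n j / K n l).\<close>
            have "min (N n j) (N n l) = N n j" using monoD[OF N_mono[of n], of j l] that by simp
            moreover have "exp (tl.s0 j n) = real (N n j) / real (K n j)" using elim by simp
            moreover have "sqrt (real (K n j) / real (K n l)) * (real (N n j) / real (K n j)) = real (N n j) / (sqrt (K n j) * sqrt (K n l))"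
              using elim by (simp add: real_sqrt_divide field_simps)
            ultimately show ?case unfolding cv_def mult.assoc[symmetric] by (simp only:)
          qed
        qed
      qed
      moreover have "(\<lambda>n. cv n j l) \<longlonglongrightarrow> \<sigma> j l" for j l
      proof -
        consider "j = l" | "j < l" | "l < j" by (rule linorder_cases)
        then show ?thesis
        proof cases
          case 1
          have "\<forall>\<^sub>F n in sequentially. cv n j j = 1"
            using tl.eventually_exp_s0[of j] tl.eventually_K_N[of j]
          proof eventually_elim
            case (elim n)
            then show ?case using psi_moments(2)[of n j]
              by (simp add: cv_def has_bochner_integral_iff flip: power2_eq_square)
          qed
          then show ?thesis using 1 by (simp add: \<sigma>_def tendsto_eventually)
        next
          case 2
          then show ?thesis using cv_less[OF 2] by (auto simp: \<sigma>_def)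
        next
          case 3
          have "cv n j l = cv n l j" for n by (simp add: cv_def mult.commute min.commute)
          then show ?thesis using cv_less[OF 3] 3 by (auto simp: \<sigma>_def)
        qed
      qed
      ultimately show ?thesis by (simp, intro tendsto_intros)
    qed
    show "(\<lambda>n. \<Sum>i\<in>I n. expectation (\<lambda>w. (f n i (X i w))^4)) \<longlonglongrightarrow> 0"
    proof -
      \<comment> \<open>Eventually N exp (- s0) = K, so the term for j is 9 times the fourth power
        of \<alpha> j divided by K n j. Hence Lyapunov's condition.\<close>
      define u where "u n = (real CARD('m))^3 * (\<Sum>j\<in>UNIV. real (N n j) * ((\<alpha> j / sqrt (K n j))^4 * (9 * exp (- tl.s0 j n))))" for n
      have le: "(\<Sum>i\<in>I n. expectation (\<lambda>w. (f n i (X i w))^4)) \<le> u n" for n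
      proof -
        have "(\<Sum>i\<in>I n. expectation (\<lambda>w. (f n i (X i w))^4)) \<le> (\<Sum>i\<in>I n. (real CARD('m))^3 * (\<Sum>j\<in>UNIV. (co n i j)^4 * (9 * exp (- tl.s0 j n))))"
          using f4_le tr(2)[of _ n "\<lambda>x. (f n _ x)^4"] by (intro sum_mono) (simp add: tr(2))
        also have "\<dots> = (real CARD('m))^3 * (\<Sum>j\<in>UNIV. \<Sum>i\<in>I n. (co n i j)^4 * (9 * exp (- tl.s0 j n)))"
          unfolding sum_distrib_left[symmetric] by (subst sum.swap) simp
        also have "\<dots> = (real CARD('m))^3 * (\<Sum>j\<in>UNIV. \<Sum>i\<in>I n. if i \<le> N n j then (\<alpha> j / sqrt (K n j))^4 * (9 * exp (- tl.s0 j n)) else 0)"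
          by (intro arg_cong2[where f="(*)"] refl sum.cong) (simp add: co_def)
        also have "\<dots> = u n" unfolding cosum u_def by simp
        finally show ?thesis .
      qed
      have "u \<longlonglongrightarrow> (real CARD('m))^3 * (\<Sum>j\<in>(UNIV::'m set). 0)"
        unfolding u_def
      proof (intro tendsto_intros)
        fix j
        have "(\<lambda>n. 9 * \<alpha> j ^ 4 * inverse (real (K n j))) \<longlonglongrightarrow> 9 * \<alpha> j ^ 4 * 0"
          by (intro tendsto_intros tendsto_inverse_0_at_top tl.K_lim_real)
        then have "(\<lambda>n. 9 * \<alpha> j ^ 4 * inverse (real (K n j))) \<longlonglongrightarrow> 0" by simp
        then show "(\<lambda>n. real (N n j) * ((\<alpha> j / sqrt (K n j))^4 * (9 * exp (- tl.s0 j n)))) \<longlonglongrightarrow> 0"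
        proof (rule Lim_transform_eventually)
          show "\<forall>\<^sub>F n in sequentially. 9 * \<alpha> j ^ 4 * inverse (real (K n j)) = real (N n j) * ((\<alpha> j / sqrt (K n j))^4 * (9 * exp (- tl.s0 j n)))"
            using tl.eventually_exp_s0[of j] tl.eventually_K_N[of j]
          proof eventually_elim
            case (elim n)
            have "sqrt (real (K n j))^4 = (real (K n j))\<^sup>2"
              using power_mult[of "sqrt (real (K n j))" 2 2] by simp
            then show ?case using elim by (simp add: power_divide power2_eq_square field_simps)
          qed
        qed
      qed
      then have u0: "u \<longlonglongrightarrow> 0" by simp
      show ?thesis
        by (rule tendsto_sandwich[OF always_eventually always_eventually tendsto_const u0])
          (auto intro!: sum_nonneg le)
    qed
  qed
  then show ?thesis by (simp add: S_eq)
qed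

end

section \<open>Optimal weights\<close>

lemma matrix_inv_right:
  fixes A :: "real^'n^'n"
  assumes "det A \<noteq> 0" shows "A ** matrix_inv A = mat 1"
proof -
  have "\<exists>C. A ** C = mat 1 \<and> C ** A = mat 1"
    using assms by (simp add: invertible_det_nz[symmetric] invertible_def)
  then show ?thesis unfolding matrix_inv_def by (rule someI2_ex) simp
qed

text \<open>Cramer's rule expresses the inverse through determinants, which are polynomials in the
  entries; limits and measurability of the weights come from it.\<close>

lemma matrix_inv_vector_cramer:
  fixes A :: "real^'n^'n"
  assumes "det A \<noteq> 0"
  shows "matrix_inv A *v b = (\<chi> k. det (\<chi> i j. if j = k then b $ i else A $ i $ j) / det A)"
proof -
  from matrix_inv_right[OF assms] have "A *v (matrix_inv A *v b) = b" by (simp add: matrix_vector_mul_assoc)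
  then show ?thesis using cramer[OF assms] by blast
qed

text \<open>\<open>matrix_inv\<close> is a choice from a predicate that is identically false for
  singular arguments, so it takes one and the same value on all of them. This keeps the weights
  measurable across the event where the estimated matrix is singular.\<close>

lemma matrix_inv_singular:
  fixes A A' :: "real^'n^'n"
  assumes "det A = 0" "det A' = 0"
  shows "matrix_inv A = matrix_inv A'"
proof -
  have "\<not> (A ** C = mat 1 \<and> C ** A = mat 1)" "\<not> (A' ** C = mat 1 \<and> C ** A' = mat 1)" for C
    using assms invertible_det_nz[of A] invertible_det_nz[of A'] by (auto simp: invertible_def)
  then have "(\<lambda>C. A ** C = mat 1 \<and> C ** A = mat 1) = (\<lambda>C. A' ** C = mat 1 \<and> C ** A' = mat 1)"
    by (auto simp: fun_eq_iff)
  then show ?thesis unfolding matrix_inv_def by (rule arg_cong)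
qed

lemma tendsto_det:
  fixes A :: "'z \<Rightarrow> real^'n^'n"
  assumes "\<And>i j. ((\<lambda>z. A z $ i $ j) \<longlongrightarrow> A0 $ i $ j) F"
  shows "((\<lambda>z. det (A z)) \<longlongrightarrow> det A0) F"
  unfolding det_def by (intro tendsto_intros assms)

lemma tendsto_matrix_inv_vector:
  fixes A :: "'z \<Rightarrow> real^'n^'n" and b :: "'z \<Rightarrow> real^'n"
  assumes A: "\<And>i j. ((\<lambda>z. A z $ i $ j) \<longlongrightarrow> A0 $ i $ j) F" and b: "(b \<longlongrightarrow> b0) F" and det: "det A0 \<noteq> 0"
  shows "((\<lambda>z. matrix_inv (A z) *v b z) \<longlongrightarrow> matrix_inv A0 *v b0) F"
proof -
  have d: "((\<lambda>z. det (A z)) \<longlongrightarrow> det A0) F" by (rule tendsto_det[OF A])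
  have ev: "\<forall>\<^sub>F z in F. det (A z) \<noteq> 0" using tendsto_imp_eventually_ne[OF d det] .
  have "((\<lambda>z. \<chi> k. det (\<chi> i j. if j = k then b z $ i else A z $ i $ j) / det (A z)) \<longlongrightarrow>
      (\<chi> k. det (\<chi> i j. if j = k then b0 $ i else A0 $ i $ j) / det A0)) F"
  proof (intro tendsto_vec_lambda tendsto_divide d det tendsto_det)
    show "((\<lambda>z. (\<chi> i j. if j = k then b z $ i else A z $ i $ j) $ i $ j) \<longlongrightarrow> (\<chi> i j. if j = k then b0 $ i else A0 $ i $ j) $ i $ j) F" for i j k
      using A tendsto_vec_nth[OF b] by simp
  qed
  then show ?thesis
    unfolding matrix_inv_vector_cramer[OF det, of b0]
    by (rule Lim_transform_eventually) (use ev in \<open>eventually_elim, simp add: matrix_inv_vector_cramer\<close>)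
qed

lemma det_measurable:
  fixes A :: "'w \<Rightarrow> real^'n^'n"
  assumes [measurable]: "\<And>i j. (\<lambda>w. A w $ i $ j) \<in> borel_measurable M"
  shows "(\<lambda>w. det (A w)) \<in> borel_measurable M"
  unfolding det_def by measurable

lemma matrix_inv_vector_measurable:
  fixes A :: "'w \<Rightarrow> real^'n^'n" and b :: "'w \<Rightarrow> real^'n"
  assumes A: "\<And>i j. (\<lambda>w. A w $ i $ j) \<in> borel_measurable M" and b: "\<And>i. (\<lambda>w. b w $ i) \<in> borel_measurable M"
  shows "(\<lambda>w. (matrix_inv (A w) *v b w) $ k) \<in> borel_measurable M"
proof -
  obtain C :: "real^'n^'n" where C: "\<And>A'. det A' = 0 \<Longrightarrow> matrix_inv A' = C"
    using matrix_inv_singular by metis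
  have eq: "(matrix_inv (A w) *v b w) $ k = (if det (A w) = 0 then (\<Sum>j\<in>UNIV. C $ k $ j * b w $ j)
      else det (\<chi> i j. if j = k then b w $ i else A w $ i $ j) / det (A w))" for w
    by (simp add: matrix_inv_vector_cramer C) (simp add: matrix_vector_mult_def)
  have [measurable]: "(\<lambda>w. det (A w)) \<in> borel_measurable M" by (rule det_measurable[OF A])
  have [measurable]: "(\<lambda>w. det (\<chi> i j. if j = k then b w $ i else A w $ i $ j)) \<in> borel_measurable M"
    using A b by (intro det_measurable) simp
  note b[measurable]
  show ?thesis unfolding eq by measurable
qed

lemma sym_inner_matrix:
  fixes V :: "real^'n^'n"
  assumes "transpose V = V"
  shows "x \<bullet> (V *v y) = y \<bullet> (V *v x)"
  using dot_lmul_matrix[of x V y] assms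
  by (metis inner_commute transpose_matrix_vector)

text \<open>A nonzero vector in the kernel would make the quadratic form vanish.\<close>

lemma pos_definite_det:
  assumes "pos_definite V" shows "det V \<noteq> 0"
proof -
  have "x = 0" if "V *v x = 0" for x
    using assms that unfolding pos_definite_def by (metis inner_zero_right less_irrefl)
  then have "\<exists>C. C ** V = mat 1" by (simp add: matrix_left_invertible_ker)
  then show ?thesis
    by (simp add: invertible_det_nz[symmetric] invertible_left_inverse)
qed

locale pd_weights =
  fixes V :: "('m::finite) rmat" and B :: "'m rvec"
  assumes pd: "pos_definite V"
begin

definition "y1 = matrix_inv V *v 1"
definition "yB = matrix_inv V *v B"
definition "qa = 1 \<bullet> y1"
definition "qb = 1 \<bullet> yB"
definition "qd = B \<bullet> yB"

lemma V_y1: "V *v y1 = 1" and V_yB: "V *v yB = B"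
proof -
  have "V ** matrix_inv V = mat 1"
    by (rule matrix_inv_right[OF pos_definite_det[OF pd]])
  then show "V *v y1 = 1" "V *v yB = B" by (simp_all add: y1_def yB_def matrix_vector_mul_assoc)
qed

lemma B_y1: "B \<bullet> y1 = qb"
  using sym_inner_matrix[of V y1 yB] pd by (simp add: V_y1 V_yB qb_def pos_definite_def inner_commute)

lemma qa_pos: "qa > 0"
proof -
  have "y1 \<noteq> 0" using V_y1 by (metis matrix_vector_mult_0_right one_index zero_index zero_neq_one)
  then have "y1 \<bullet> (V *v y1) > 0" using pd by (simp add: pos_definite_def)
  then show ?thesis by (simp add: V_y1 qa_def inner_commute)
qed

lemma inner_y: "y1 \<bullet> 1 = qa" "y1 \<bullet> B = qb" "yB \<bullet> 1 = qb" "yB \<bullet> B = qd"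
  using B_y1 by (simp_all add: qa_def qb_def qd_def inner_commute)

text \<open>Cauchy-Schwarz for the form of the inverse matrix, obtained from positivity of V at the
  combination of \<open>y1\<close> and \<open>yB\<close> that is orthogonal to 1.\<close>

lemma qb_le: "qb\<^sup>2 \<le> qa * qd"
proof -
  define x where "x = qa *\<^sub>R yB - qb *\<^sub>R y1"
  have "V *v x = qa *\<^sub>R B - qb *\<^sub>R 1"
    by (simp add: x_def matrix_vector_mult_diff_distrib matrix_vector_mult_scaleR V_y1 V_yB)
  then have "x \<bullet> (V *v x) = (qa *\<^sub>R yB - qb *\<^sub>R y1) \<bullet> (qa *\<^sub>R B - qb *\<^sub>R 1)" by (simp only: x_def)
  also have "\<dots> = qa * (qa * qd - qb * qb) - qb * (qa * qb - qb * qa)"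
    by (simp only: inner_diff_left inner_diff_right inner_scaleR_left inner_scaleR_right inner_y)
  also have "\<dots> = qa * (qa * qd - qb\<^sup>2)" by (simp add: power2_eq_square algebra_simps)
  finally have "x \<bullet> (V *v x) = qa * (qa * qd - qb\<^sup>2)" .
  moreover have "x \<bullet> (V *v x) \<ge> 0"
    using pd by (cases "x = 0") (auto simp: pos_definite_def less_imp_le)
  ultimately show ?thesis using qa_pos by (simp add: zero_le_mult_iff)
qed

definition "qD = (1 + qd) * qa - qb\<^sup>2"

text \<open>The denominator is qa plus the nonnegative gap in \<open>qb_le\<close>.\<close>

lemma qD_pos: "qD > 0"
  using qb_le qa_pos by (simp add: qD_def algebra_simps)

lemma var_Var: "weights_Var V \<bullet> (V *v weights_Var V) = 1 / qa" "1 / qa > 0"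
proof -
  have w: "weights_Var V = y1 /\<^sub>R qa" by (simp add: weights_Var_def y1_def qa_def)
  show "weights_Var V \<bullet> (V *v weights_Var V) = 1 / qa"
    using qa_pos by (simp add: w matrix_vector_mult_scaleR V_y1 inner_y inverse_eq_divide)
  show "1 / qa > 0" using qa_pos by simp
qed

lemma weights_AMSE_eq: "weights_AMSE B V = ((1 + qd) *\<^sub>R y1 - qb *\<^sub>R yB) /\<^sub>R qD"
  by (simp add: weights_AMSE_def y1_def[symmetric] yB_def[symmetric] qa_def[symmetric] qb_def[symmetric] qd_def[symmetric] qD_def)

text \<open>The quadratic form is computed from V y1 = 1 and V yB = B. For positivity it is easier
  to note that the weights sum to 1, hence are nonzero, and that V is positive definite.\<close>

lemma var_AMSE:
  "weights_AMSE B V \<bullet> (V *v weights_AMSE B V) = ((1 + qd)\<^sup>2 * qa - (2 + qd) * qb\<^sup>2) / qD\<^sup>2"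
  "((1 + qd)\<^sup>2 * qa - (2 + qd) * qb\<^sup>2) / qD\<^sup>2 > 0"
proof -
  define w where "w = weights_AMSE B V"
  have w: "w = ((1 + qd) *\<^sub>R y1 - qb *\<^sub>R yB) /\<^sub>R qD" by (simp add: w_def weights_AMSE_eq)
  have Vw: "V *v w = ((1 + qd) *\<^sub>R 1 - qb *\<^sub>R B) /\<^sub>R qD"
    by (simp add: w matrix_vector_mult_scaleR matrix_vector_mult_diff_distrib V_y1 V_yB)
  have "w \<bullet> (V *v w) = (inverse qD)\<^sup>2 * (((1 + qd) *\<^sub>R y1 - qb *\<^sub>R yB) \<bullet> ((1 + qd) *\<^sub>R 1 - qb *\<^sub>R B))"
    unfolding Vw unfolding w by (simp add: power2_eq_square)
  also have "((1 + qd) *\<^sub>R y1 - qb *\<^sub>R yB) \<bullet> ((1 + qd) *\<^sub>R 1 - qb *\<^sub>R B) =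
      (1 + qd) * ((1 + qd) * qa - qb * qb) - qb * ((1 + qd) * qb - qb * qd)"
    by (simp only: inner_diff_left inner_diff_right inner_scaleR_left inner_scaleR_right inner_y)
  also have "\<dots> = (1 + qd)\<^sup>2 * qa - (2 + qd) * qb\<^sup>2"
    by (simp add: power2_eq_square algebra_simps)
  finally show 1: "weights_AMSE B V \<bullet> (V *v weights_AMSE B V) = ((1 + qd)\<^sup>2 * qa - (2 + qd) * qb\<^sup>2) / qD\<^sup>2"
    by (simp add: w_def divide_inverse power_inverse)
  have "w \<bullet> 1 = 1"
  proof -
    have "w \<bullet> 1 = inverse qD * ((1 + qd) * qa - qb * qb)"
      unfolding w by (simp only: inner_diff_left inner_scaleR_left inner_y)
    then show ?thesis using qD_pos by (simp add: qD_def power2_eq_square)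
  qed
  then have "w \<noteq> 0" by auto
  then have "w \<bullet> (V *v w) > 0" using pd by (simp add: pos_definite_def)
  then show "((1 + qd)\<^sup>2 * qa - (2 + qd) * qb\<^sup>2) / qD\<^sup>2 > 0" using 1 by (simp add: w_def)
qed

text \<open>The exact normalisation in the second claim lets \<gamma> be subtracted inside the
  weighted sum later; it holds as soon as the denominator is nonzero.\<close>

lemma weights_Var_tendsto:
  fixes Vh :: "'z \<Rightarrow> 'm rmat"
  assumes "\<And>i j. ((\<lambda>z. Vh z $ i $ j) \<longlongrightarrow> V $ i $ j) F"
  shows "((\<lambda>z. weights_Var (Vh z)) \<longlongrightarrow> weights_Var V) F" "\<forall>\<^sub>F z in F. weights_Var (Vh z) \<bullet> 1 = 1"
proof -
  have y: "((\<lambda>z. matrix_inv (Vh z) *v 1) \<longlongrightarrow> y1) F"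
    unfolding y1_def by (rule tendsto_matrix_inv_vector[OF assms tendsto_const pos_definite_det[OF pd]])
  then have a: "((\<lambda>z. 1 \<bullet> (matrix_inv (Vh z) *v 1)) \<longlongrightarrow> qa) F" unfolding qa_def by (intro tendsto_intros)
  show "((\<lambda>z. weights_Var (Vh z)) \<longlongrightarrow> weights_Var V) F"
    unfolding weights_Var_def using qa_pos y a
    by (intro tendsto_scaleR tendsto_inverse) (auto simp: y1_def qa_def)
  have "\<forall>\<^sub>F z in F. 1 \<bullet> (matrix_inv (Vh z) *v 1) > 0" using order_tendstoD(1)[OF a] qa_pos by simp
  then show "\<forall>\<^sub>F z in F. weights_Var (Vh z) \<bullet> 1 = 1"
    by eventually_elim (simp add: weights_Var_def inner_commute)
qed

lemma weights_AMSE_tendsto: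
  fixes Vh :: "'z \<Rightarrow> 'm rmat"
  assumes "\<And>i j. ((\<lambda>z. Vh z $ i $ j) \<longlongrightarrow> V $ i $ j) F" and B: "(Bh \<longlongrightarrow> B) F"
  shows "((\<lambda>z. weights_AMSE (Bh z) (Vh z)) \<longlongrightarrow> weights_AMSE B V) F" "\<forall>\<^sub>F z in F. weights_AMSE (Bh z) (Vh z) \<bullet> 1 = 1"
proof -
  have y: "((\<lambda>z. matrix_inv (Vh z) *v 1) \<longlongrightarrow> y1) F" "((\<lambda>z. matrix_inv (Vh z) *v Bh z) \<longlongrightarrow> yB) F"
    unfolding y1_def yB_def
    by (rule tendsto_matrix_inv_vector[OF assms(1) _ pos_definite_det[OF pd]], (rule tendsto_const | rule B))+
  have D: "((\<lambda>z. (1 + Bh z \<bullet> (matrix_inv (Vh z) *v Bh z)) * (1 \<bullet> (matrix_inv (Vh z) *v 1)) - (1 \<bullet> (matrix_inv (Vh z) *v Bh z))\<^sup>2) \<longlongrightarrow> qD) F"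
    unfolding qD_def qa_def qb_def qd_def by (intro tendsto_intros y B)
  show "((\<lambda>z. weights_AMSE (Bh z) (Vh z)) \<longlongrightarrow> weights_AMSE B V) F"
    unfolding weights_AMSE_eq unfolding weights_AMSE_def qa_def qb_def qd_def
    using qD_pos by (intro tendsto_intros D y B) simp
  have "\<forall>\<^sub>F z in F. (1 + Bh z \<bullet> (matrix_inv (Vh z) *v Bh z)) * (1 \<bullet> (matrix_inv (Vh z) *v 1)) - (1 \<bullet> (matrix_inv (Vh z) *v Bh z))\<^sup>2 > 0"
    by (rule order_tendstoD(1)[OF D qD_pos])
  moreover have "\<forall>\<^sub>F z in F. det (Vh z) \<noteq> 0"
    using tendsto_imp_eventually_ne[OF tendsto_det[OF assms(1)] pos_definite_det[OF pd]] .
  ultimately show "\<forall>\<^sub>F z in F. weights_AMSE (Bh z) (Vh z) \<bullet> 1 = 1"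
  proof eventually_elim
    case (elim z)
    define a b d D where "a = 1 \<bullet> (matrix_inv (Vh z) *v 1)" and "b = 1 \<bullet> (matrix_inv (Vh z) *v Bh z)"
      and "d = Bh z \<bullet> (matrix_inv (Vh z) *v Bh z)" and "D = (1 + d) * a - b\<^sup>2"
    have "weights_AMSE (Bh z) (Vh z) \<bullet> 1 = inverse D * ((1 + d) * a - b * b)"
      unfolding weights_AMSE_def a_def[symmetric] b_def[symmetric] d_def[symmetric] D_def[symmetric]
      by (simp only: inner_commute[of _ 1] inner_diff_right inner_scaleR_right a_def[symmetric] b_def[symmetric])
    moreover have "D > 0" using elim by (simp add: D_def a_def b_def d_def)
    ultimately show ?case by (simp add: D_def power2_eq_square)
  qed
qed

end

section \<open>Centred normal laws\<close>

lemma normal_law_distr: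
  assumes "v > 0"
  shows "normal_law 0 v = distr std_normal_distribution borel (\<lambda>x. sqrt v * x)"
proof -
  interpret S: real_distribution std_normal_distribution by (rule real_dist_normal_dist)
  have "distributed std_normal_distribution lborel (\<lambda>x. x) (normal_density 0 1)"
    unfolding distributed_def by (simp add: distr_id2 cong: distr_cong)
  from S.normal_density_affine[OF this, of "sqrt v" 0] assms
  have "distributed std_normal_distribution lborel (\<lambda>x. sqrt v * x) (normal_density 0 (sqrt v))" by simp
  then have "distr std_normal_distribution lborel (\<lambda>x. sqrt v * x) = density lborel (normal_density 0 (sqrt v))"
    by (simp add: distributed_def)
  then show ?thesis unfolding normal_law_def by (metis distr_cong sets_lborel)
qed

lemma char_normal_law:
  assumes "v > 0"
  shows "char (normal_law 0 v) t = of_real (exp (- (t\<^sup>2 * v / 2)))"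
proof -
  have "char (normal_law 0 v) t = (CLINT x|std_normal_distribution. iexp (t * (sqrt v * x)))"
    unfolding normal_law_distr[OF assms] char_def by (rule integral_distr) auto
  also have "\<dots> = char std_normal_distribution (t * sqrt v)"
    by (simp add: char_def mult.assoc)
  also have "\<dots> = of_real (exp (- (t\<^sup>2 * v / 2)))"
    using assms by (simp add: char_std_normal_distribution power_mult_distrib)
  finally show ?thesis .
qed

lemma real_distribution_normal_law:
  assumes "v > 0" shows "real_distribution (normal_law 0 v)"
proof -
  interpret S: real_distribution std_normal_distribution by (rule real_dist_normal_dist)
  show ?thesis unfolding normal_law_distr[OF assms] by (rule S.real_distribution_distr) simp
qed

section \<open>Measurability of the estimators\<close>

lemma card_measurable:
  assumes "finite I" and [measurable]: "\<And>i. i \<in> I \<Longrightarrow> Measurable.pred M (P i)"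
  shows "(\<lambda>w. real (card {i\<in>I. P i w})) \<in> borel_measurable M"
proof -
  have "real (card {i\<in>I. P i w}) = (\<Sum>i\<in>I. if P i w then 1 else 0)" for w
    using assms(1) by (simp add: sum.If_cases Int_def)
  then show ?thesis by simp
qed

text \<open>Beyond the end of a list \<open>!\<close> depends on the overshoot alone, so an
  out-of-range order statistic is constant in w and hence measurable.\<close>

lemma nth_overflow: "length xs \<le> i \<Longrightarrow> xs ! i = [] ! (i - length xs)"
  by (induction xs arbitrary: i) (auto simp: nth_Cons split: nat.split)

lemma order_stat_measurable:
  assumes y: "\<And>i. i \<ge> 1 \<Longrightarrow> y i \<in> borel_measurable M"
  shows "(\<lambda>w. order_stat (\<lambda>i. y i w) n m) \<in> borel_measurable M"
proof -
  have in_range: "(\<lambda>w. order_stat (\<lambda>i. y i w) n m) \<in> borel_measurable M" if m: "1 \<le> m" "m \<le> n" for m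
  proof (subst borel_measurable_iff_greater, intro allI)
    fix s :: real
    have [measurable]: "(\<lambda>w. real (card {p\<in>{1..n}. s < y p w})) \<in> borel_measurable M"
    proof (rule card_measurable)
      fix p assume "p \<in> {1..n}"
      then have [measurable]: "y p \<in> borel_measurable M" using y by simp
      show "Measurable.pred M (\<lambda>w. s < y p w)" by measurable
    qed simp
    have "{w \<in> space M. s < order_stat (\<lambda>i. y i w) n m} = {w \<in> space M. real (n - m) < real (card {p\<in>{1..n}. s < y p w})}"
      using order_stat_pred_iff[of "\<lambda>x. s < x", OF _ m] by auto
    also have "\<dots> \<in> sets M" by measurable
    finally show "{w \<in> space M. s < order_stat (\<lambda>i. y i w) n m} \<in> sets M" .
  qed
  consider "1 \<le> m" "m \<le> n" | "m = 0" "n \<ge> 1" | "n \<le> m - 1" by linarith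
  then show ?thesis
  proof cases
    case 1
    then show ?thesis by (rule in_range)
  next
    case 2
    \<comment> \<open>Truncated subtraction makes position 0 read the same entry as position
      1.\<close>
    then have "(\<lambda>w. order_stat (\<lambda>i. y i w) n m) = (\<lambda>w. order_stat (\<lambda>i. y i w) n 1)" by (simp add: order_stat_def)
    then show ?thesis using in_range[of 1] 2 by simp
  next
    case 3
    have "order_stat (\<lambda>i. y i w) n m = [] ! (m - 1 - n)" for w
      unfolding order_stat_def using nth_overflow[of "sort (map (\<lambda>i. y i w) [1..<Suc n])" "m - 1"] 3 by (simp del: upt_Suc)
    then show ?thesis by simp
  qed
qed

lemma hill_measurable:
  assumes "\<And>i. i \<ge> 1 \<Longrightarrow> y i \<in> borel_measurable M"
  shows "(\<lambda>w. hill (\<lambda>i. y i w) n k) \<in> borel_measurable M"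
proof -
  note order_stat_measurable[OF assms, measurable]
  show ?thesis unfolding hill_def by measurable
qed

context
  fixes M :: "'w measure" and X :: "nat \<Rightarrow> 'w \<Rightarrow> ('m::{finite,linorder}) rvec"
    and nn kk :: "'m \<Rightarrow> nat" and \<beta>h \<rho>h :: "'w \<Rightarrow> 'm rvec" and \<omega>0 :: "'m rvec"
  assumes X: "\<And>i j. i \<ge> 1 \<Longrightarrow> (\<lambda>w. X i w $ j) \<in> borel_measurable M"
    and \<beta>h[measurable]: "\<And>j. (\<lambda>w. \<beta>h w $ j) \<in> borel_measurable M"
    and \<rho>h[measurable]: "\<And>j. (\<lambda>w. \<rho>h w $ j) \<in> borel_measurable M"
begin

lemma gamma_hat_measurable:
  assumes [measurable]: "\<And>j. (\<lambda>w. om w $ j) \<in> borel_measurable M"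
  shows "(\<lambda>w. gamma_hat nn kk (\<lambda>i. X i w) (om w)) \<in> borel_measurable M"
proof -
  have [measurable]: "(\<lambda>w. hill (\<lambda>i. X i w $ j) n k) \<in> borel_measurable M" for j n k
    by (rule hill_measurable[OF X])
  show ?thesis unfolding gamma_hat_def by measurable
qed

lemma R_hat_measurable: "(\<lambda>w. R_hat nn kk (\<lambda>i. X i w) j l u v) \<in> borel_measurable M"
proof -
  have [measurable]: "(\<lambda>w. real (rank (\<lambda>p. X p w $ q) n i)) \<in> borel_measurable M" if "i \<ge> 1" for q n i
    unfolding rank_def
  proof (rule card_measurable)
    fix p assume "p \<in> {1..n}"
    then have [measurable]: "(\<lambda>w. X p w $ q) \<in> borel_measurable M" "(\<lambda>w. X i w $ q) \<in> borel_measurable M"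
      using that by (auto intro: X)
    show "Measurable.pred M (\<lambda>w. X p w $ q \<le> X i w $ q)" by measurable
  qed simp
  show ?thesis
    unfolding R_hat_def Let_def
    by (intro borel_measurable_times borel_measurable_const card_measurable) simp_all
qed

lemma V_hat_measurable: "(\<lambda>w. V_hat nn kk (\<lambda>i. X i w) \<omega>0 $ j $ l) \<in> borel_measurable M"
proof -
  note gamma_hat_measurable[of "\<lambda>_. \<omega>0", OF borel_measurable_const, measurable] R_hat_measurable[measurable]
  show ?thesis unfolding V_hat_def sym_matrix_def by simp
qed

lemma B_hat_measurable: "(\<lambda>w. B_hat nn kk (\<lambda>i. X i w) \<omega>0 (\<beta>h w) (\<rho>h w) $ j) \<in> borel_measurable M"
proof -
  note gamma_hat_measurable[of "\<lambda>_. \<omega>0", OF borel_measurable_const, measurable]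
  have [measurable]: "(\<lambda>w. c powr (\<rho>h w $ j)) \<in> borel_measurable M" for c :: real
    unfolding powr_def by measurable
  show ?thesis unfolding B_hat_def lambda_hat_def by simp
qed

lemma inner_measurable:
  fixes f g :: "'w \<Rightarrow> 'm rvec"
  assumes [measurable]: "\<And>j. (\<lambda>w. f w $ j) \<in> borel_measurable M" "\<And>j. (\<lambda>w. g w $ j) \<in> borel_measurable M"
  shows "(\<lambda>w. f w \<bullet> g w) \<in> borel_measurable M"
  unfolding inner_vec_def by simp

lemma omega_hat_Var_measurable: "(\<lambda>w. omega_hat_Var nn kk (\<lambda>i. X i w) \<omega>0 $ j) \<in> borel_measurable M"
proof -
  have 1[measurable]: "(\<lambda>w. (matrix_inv (V_hat nn kk (\<lambda>i. X i w) \<omega>0) *v 1) $ j) \<in> borel_measurable M" for j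
    by (rule matrix_inv_vector_measurable[OF V_hat_measurable]) simp
  have [measurable]: "(\<lambda>w. 1 \<bullet> (matrix_inv (V_hat nn kk (\<lambda>i. X i w) \<omega>0) *v 1)) \<in> borel_measurable M"
    by (rule inner_measurable[OF _ 1]) simp
  show ?thesis unfolding omega_hat_Var_def weights_Var_def by simp
qed

lemma omega_hat_AMSE_measurable:
  "(\<lambda>w. omega_hat_AMSE nn kk (\<lambda>i. X i w) \<omega>0 (\<beta>h w) (\<rho>h w) $ j) \<in> borel_measurable M"
proof -
  have 1[measurable]: "(\<lambda>w. (matrix_inv (V_hat nn kk (\<lambda>i. X i w) \<omega>0) *v 1) $ j) \<in> borel_measurable M" for j
    by (rule matrix_inv_vector_measurable[OF V_hat_measurable]) simp
  have 2[measurable]: "(\<lambda>w. (matrix_inv (V_hat nn kk (\<lambda>i. X i w) \<omega>0) *v B_hat nn kk (\<lambda>i. X i w) \<omega>0 (\<beta>h w) (\<rho>h w)) $ j) \<in> borel_measurable M" for j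
    by (rule matrix_inv_vector_measurable[OF V_hat_measurable B_hat_measurable])
  have [measurable]: "(\<lambda>w. 1 \<bullet> (matrix_inv (V_hat nn kk (\<lambda>i. X i w) \<omega>0) *v 1)) \<in> borel_measurable M"
    by (rule inner_measurable[OF _ 1]) simp
  have [measurable]: "(\<lambda>w. 1 \<bullet> (matrix_inv (V_hat nn kk (\<lambda>i. X i w) \<omega>0) *v B_hat nn kk (\<lambda>i. X i w) \<omega>0 (\<beta>h w) (\<rho>h w))) \<in> borel_measurable M"
    by (rule inner_measurable[OF _ 2]) simp
  have [measurable]: "(\<lambda>w. B_hat nn kk (\<lambda>i. X i w) \<omega>0 (\<beta>h w) (\<rho>h w) \<bullet> (matrix_inv (V_hat nn kk (\<lambda>i. X i w) \<omega>0) *v B_hat nn kk (\<lambda>i. X i w) \<omega>0 (\<beta>h w) (\<rho>h w))) \<in> borel_measurable M"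
    by (rule inner_measurable[OF B_hat_measurable 2])
  show ?thesis unfolding omega_hat_AMSE_def weights_AMSE_def by simp
qed

lemma gamma_bar_measurable:
  assumes [measurable]: "\<And>j. (\<lambda>w. om w $ j) \<in> borel_measurable M"
  shows "(\<lambda>w. gamma_bar nn kk (\<lambda>i. X i w) \<omega>0 (\<beta>h w) (\<rho>h w) (om w)) \<in> borel_measurable M"
proof -
  have [measurable]: "(\<lambda>w. gamma_hat nn kk (\<lambda>i. X i w) (om w)) \<in> borel_measurable M"
    by (rule gamma_hat_measurable) measurable
  have [measurable]: "(\<lambda>w. om w \<bullet> B_hat nn kk (\<lambda>i. X i w) \<omega>0 (\<beta>h w) (\<rho>h w)) \<in> borel_measurable M"
    by (rule inner_measurable[OF _ B_hat_measurable]) measurable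
  show ?thesis unfolding gamma_bar_def by measurable
qed

end

section \<open>Pooled Hill estimators\<close>

text \<open>The interface between the single samples and the pooled estimators:
  \<open>hill_lin\<close> carries the Hill expansion with its bias, and \<open>order\<close> makes
  ranks computable on the exponential scale.\<close>

locale pooled = exp_family M X D \<epsilon> N K g
  for M :: "'w measure" and X :: "nat \<Rightarrow> 'w \<Rightarrow> ('m::{finite,linorder}) rvec"
    and D :: "'m rvec measure" and \<epsilon> :: "'m \<Rightarrow> 'm rvec \<Rightarrow> real" and N K :: "nat \<Rightarrow> 'm \<Rightarrow> nat"
    and g :: "'m \<Rightarrow> 'm \<Rightarrow> real \<Rightarrow> real \<Rightarrow> real" +
  fixes \<gamma> :: real and \<rho> \<beta> b c lam \<omega>0 :: "'m rvec" and \<beta>h \<rho>h :: "nat \<Rightarrow> 'w \<Rightarrow> 'm rvec"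
  assumes \<gamma>_pos: "\<gamma> > 0" and \<beta>_nz: "\<And>j. \<beta> $ j \<noteq> 0" and \<rho>_neg: "\<And>j. \<rho> $ j < 0"
    and order: "AE w in M. \<forall>q. \<forall>i\<ge>1. \<forall>p\<ge>1. X p w $ q \<le> X i w $ q \<longleftrightarrow> \<epsilon> q (X p w) \<le> \<epsilon> q (X i w)"
    and hill_lin: "\<And>j. ((\<lambda>z. sqrt (K (fst z) j) * (hill (\<lambda>i. X i (snd z) $ j) (N (fst z) j) (K (fst z) j) - \<gamma>)
        - \<gamma> * tl.lin j (fst z) (snd z)) \<longlongrightarrow> lam $ j / (1 - \<rho> $ j)) (prob_filter M)"
    and b_lim: "\<And>j. (\<lambda>n. real (N n first_idx) / real (N n j)) \<longlonglongrightarrow> b $ j" and b_pos: "\<And>j. 0 < b $ j"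
    and c_lim: "\<And>j. (\<lambda>n. real (K n first_idx) / real (K n j)) \<longlonglongrightarrow> c $ j" and c_pos: "\<And>j. 0 < c $ j"
    and mu_lim: "\<And>j. (\<lambda>n. sqrt (K n j) * (real (N n j) / real (K n j)) powr (\<rho> $ j)) \<longlonglongrightarrow> lam $ j / (\<gamma> * \<beta> $ j)"
    and pilot: "\<omega>0 \<bullet> 1 = 1"
    and X_rv: "\<And>i j. i \<ge> 1 \<Longrightarrow> (\<lambda>w. X i w $ j) \<in> borel_measurable M"
    and \<beta>h_rv: "\<And>n j. (\<lambda>w. \<beta>h n w $ j) \<in> borel_measurable M"
    and \<rho>h_rv: "\<And>n j. (\<lambda>w. \<rho>h n w $ j) \<in> borel_measurable M"
    and \<beta>h_lim: "\<And>j. ((\<lambda>z. \<beta>h (fst z) (snd z) $ j) \<longlongrightarrow> \<beta> $ j) (prob_filter M)"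
    and \<rho>h_lim: "\<And>j. ((\<lambda>z. (\<rho>h (fst z) (snd z) $ j - \<rho> $ j) * ln (real (N (fst z) j))) \<longlongrightarrow> 0) (prob_filter M)"
begin

definition "S = (\<Sum>i\<in>UNIV. 1 / c $ i)"
definition "V = sym_matrix (\<lambda>j. S * \<gamma>\<^sup>2 * c $ j) (\<lambda>j l. S * \<gamma>\<^sup>2 * c $ j * g j l (- ln (c $ l / c $ j)) (- ln (b $ l / b $ j)))"
definition "B = B_asym c lam \<rho>"
text \<open>This is the limit of K n j / K n l. Likewise \<open>d j l\<close> is the limit of the
  gap between the intermediate levels of samples l and j.\<close>

definition "\<kappa> j l = c $ l / c $ j"
definition "d j l = ln (b $ j / b $ l * (c $ l / c $ j))"

abbreviation "gh z \<equiv> gamma_hat (N (fst z)) (K (fst z)) (\<lambda>i. X i (snd z)) \<omega>0"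
abbreviation "Vh z \<equiv> V_hat (N (fst z)) (K (fst z)) (\<lambda>i. X i (snd z)) \<omega>0"
abbreviation "Bh z \<equiv> B_hat (N (fst z)) (K (fst z)) (\<lambda>i. X i (snd z)) \<omega>0 (\<beta>h (fst z) (snd z)) (\<rho>h (fst z) (snd z))"
abbreviation "hl j z \<equiv> hill (\<lambda>i. X i (snd z) $ j) (N (fst z) j) (K (fst z) j)"

lemma S_pos: "S > 0"
  unfolding S_def using c_pos by (intro sum_pos) auto

lemma K_ratio: "(\<lambda>n. real (K n j) / real (K n l)) \<longlonglongrightarrow> \<kappa> j l"
proof (rule Lim_transform_eventually)
  show "(\<lambda>n. (real (K n first_idx) / real (K n l)) / (real (K n first_idx) / real (K n j))) \<longlonglongrightarrow> \<kappa> j l"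
    unfolding \<kappa>_def using c_pos[of j] by (intro tendsto_divide c_lim) auto
  show "\<forall>\<^sub>F n in sequentially. (real (K n first_idx) / real (K n l)) / (real (K n first_idx) / real (K n j)) = real (K n j) / real (K n l)"
    using tl.eventually_K_N[of first_idx] tl.eventually_K_N[of j] by eventually_elim simp
qed

lemma N_ratio: "(\<lambda>n. real (N n j) / real (N n l)) \<longlonglongrightarrow> b $ l / b $ j"
proof (rule Lim_transform_eventually)
  show "(\<lambda>n. (real (N n first_idx) / real (N n l)) / (real (N n first_idx) / real (N n j))) \<longlonglongrightarrow> b $ l / b $ j"
    using b_pos[of j] by (intro tendsto_divide b_lim) auto
  show "\<forall>\<^sub>F n in sequentially. (real (N n first_idx) / real (N n l)) / (real (N n first_idx) / real (N n j)) = real (N n j) / real (N n l)"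
    using tl.eventually_K_N[of first_idx] tl.eventually_K_N[of j] by eventually_elim simp
qed

lemma s0_diff: "(\<lambda>n. tl.s0 l n - tl.s0 j n) \<longlonglongrightarrow> d j l"
proof (rule Lim_transform_eventually)
  show "(\<lambda>n. ln (real (N n l) / real (N n j) * (real (K n j) / real (K n l)))) \<longlonglongrightarrow> d j l"
    unfolding d_def \<kappa>_def[symmetric] using b_pos c_pos
    by (intro tendsto_ln tendsto_mult N_ratio K_ratio) (auto simp: \<kappa>_def less_imp_neq[THEN not_sym])
  show "\<forall>\<^sub>F n in sequentially. ln (real (N n l) / real (N n j) * (real (K n j) / real (K n l))) = tl.s0 l n - tl.s0 j n"
    using tl.eventually_s0[of l] tl.eventually_s0[of j] tl.eventually_K_N[of l] tl.eventually_K_N[of j]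
    by eventually_elim (simp add: ln_div ln_mult)
qed

lemma k_ratio: "(\<lambda>n. k_total (K n) / real (K n j)) \<longlonglongrightarrow> c $ j * S"
proof -
  have "(\<lambda>n. \<Sum>i\<in>UNIV. real (K n i) / real (K n j)) \<longlonglongrightarrow> (\<Sum>i\<in>UNIV. \<kappa> i j)"
    by (intro tendsto_sum K_ratio)
  then show ?thesis by (simp add: k_total_def sum_divide_distrib \<kappa>_def S_def sum_distrib_left)
qed

lemma k_pos: "\<forall>\<^sub>F n in sequentially. 0 < k_total (K n)"
  using tl.eventually_K_N[of first_idx]
proof eventually_elim
  case (elim n)
  have "K n first_idx \<le> (\<Sum>j\<in>UNIV. K n j)" by (rule member_le_sum) auto
  with elim have "0 < (\<Sum>j\<in>UNIV. K n j)" by simp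
  then show ?case unfolding k_total_def by (simp only: of_nat_0_less_iff)
qed

lemma lin_tight:
  "tl.lin j n \<in> borel_measurable M" "integrable M (\<lambda>w. (tl.lin j n w)\<^sup>2)"
  "\<forall>\<^sub>F n in sequentially. expectation (\<lambda>w. (tl.lin j n w)\<^sup>2) \<le> 1"
  using tl.tail_sum_second_moment[of "\<lambda>x. x - 1" 0 1 j, OF _ std_exp_minus_one(1,2)]
  by (simp_all add: tl.lin_def[abs_def])

text \<open>The linear part of the expansion is tight, so dividing by sqrt K gives
  consistency.\<close>

lemma hill_lim: "(hl j \<longlongrightarrow> \<gamma>) (prob_filter M)"
proof -
  have "(\<lambda>n. 1 / sqrt (K n j)) \<longlonglongrightarrow> 0"
    by (rule real_tendsto_divide_at_top[OF tendsto_const tl.sqrt_K_lim])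
  note i = tendsto_fst_prob_filter[OF this]
  let ?f = "\<lambda>z. 1 / sqrt (K (fst z) j) * (sqrt (K (fst z) j) * (hl j z - \<gamma>) - \<gamma> * tl.lin j (fst z) (snd z))
      + \<gamma> * (1 / sqrt (K (fst z) j) * tl.lin j (fst z) (snd z)) + \<gamma>"
  have "(?f \<longlongrightarrow> 0 * (lam $ j / (1 - \<rho> $ j)) + \<gamma> * 0 + \<gamma>) (prob_filter M)"
    by (intro tendsto_intros i hill_lin tight_mult_tendsto_0[OF lin_tight])
  then have "(?f \<longlongrightarrow> \<gamma>) (prob_filter M)" by simp
  then show ?thesis
    by (rule Lim_transform_eventually)
      (use eventually_fst_prob_filter[OF tl.eventually_K_N[of j]] in \<open>eventually_elim, simp add: right_diff_distrib\<close>)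
qed

lemma gamma_hat_lim: "(gh \<longlongrightarrow> \<gamma>) (prob_filter M)"
proof -
  have "(gh \<longlongrightarrow> (\<Sum>j\<in>UNIV. \<omega>0 $ j * \<gamma>)) (prob_filter M)"
    unfolding gamma_hat_def by (intro tendsto_intros hill_lim)
  moreover have "(\<Sum>j\<in>UNIV. \<omega>0 $ j * \<gamma>) = \<gamma>"
    using pilot by (simp add: inner_vec_def flip: sum_distrib_right)
  ultimately show ?thesis by simp
qed

text \<open>The assumed rate implies consistency because ln N tends to infinity.\<close>

lemma rho_hat_lim: "((\<lambda>z. \<rho>h (fst z) (snd z) $ j) \<longlongrightarrow> \<rho> $ j) (prob_filter M)"
proof -
  have lnN: "filterlim (\<lambda>n. ln (real (N n j))) at_top sequentially"
    by (intro filterlim_compose[OF ln_at_top] filterlim_compose[OF filterlim_real_sequentially] N_lim)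
  let ?f = "\<lambda>z. (\<rho>h (fst z) (snd z) $ j - \<rho> $ j) * ln (real (N (fst z) j)) * inverse (ln (real (N (fst z) j))) + \<rho> $ j"
  have "(?f \<longlongrightarrow> 0 * 0 + \<rho> $ j) (prob_filter M)"
    by (intro tendsto_intros \<rho>h_lim tendsto_fst_prob_filter[OF tendsto_inverse_0_at_top[OF lnN]])
  then have "(?f \<longlongrightarrow> \<rho> $ j) (prob_filter M)" by simp
  then show ?thesis
  proof (rule Lim_transform_eventually)
    have "\<forall>\<^sub>F n in sequentially. 0 < ln (real (N n j))" using filterlim_at_top_dense[THEN iffD1, OF lnN] by blast
    from eventually_fst_prob_filter[OF this]
    show "\<forall>\<^sub>F z in prob_filter M. ?f z = \<rho>h (fst z) (snd z) $ j"
    proof eventually_elim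
      case (elim z)
      then have "ln (real (N (fst z) j)) \<noteq> 0" by linarith
      then show ?case by (simp only: mult.assoc right_inverse) simp
    qed
  qed
qed

text \<open>The power is exp ((\<rho>h - \<rho>) ln (N / K)), and ln (N / K) lies between 0 and ln
  N. This is where the logarithmic rate of the estimator is used in full.\<close>

lemma powr_diff_lim:
  "((\<lambda>z. (real (N (fst z) j) / real (K (fst z) j)) powr (\<rho>h (fst z) (snd z) $ j - \<rho> $ j)) \<longlongrightarrow> 1) (prob_filter M)"
proof -
  have "((\<lambda>z. (\<rho>h (fst z) (snd z) $ j - \<rho> $ j) * ln (real (N (fst z) j) / real (K (fst z) j))) \<longlongrightarrow> 0) (prob_filter M)"
  proof (rule Lim_null_comparison[OF _ tendsto_rabs_zero[OF \<rho>h_lim]])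
    show "\<forall>\<^sub>F z in prob_filter M. norm ((\<rho>h (fst z) (snd z) $ j - \<rho> $ j) * ln (real (N (fst z) j) / real (K (fst z) j)))
      \<le> \<bar>(\<rho>h (fst z) (snd z) $ j - \<rho> $ j) * ln (real (N (fst z) j))\<bar>"
      using eventually_fst_prob_filter[OF tl.eventually_K_N[of j]]
    proof eventually_elim
      case (elim z)
      have "0 \<le> ln (real (K (fst z) j))" "ln (real (K (fst z) j)) \<le> ln (real (N (fst z) j))" using elim by auto
      moreover have "ln (real (N (fst z) j) / real (K (fst z) j)) = ln (real (N (fst z) j)) - ln (real (K (fst z) j))"
        using elim by (simp add: ln_div)
      ultimately have "\<bar>ln (real (N (fst z) j) / real (K (fst z) j))\<bar> \<le> \<bar>ln (real (N (fst z) j))\<bar>" by simp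
      then show ?case by (simp add: abs_mult mult_left_mono)
    qed
  qed
  from tendsto_exp[OF this] have "((\<lambda>z. exp ((\<rho>h (fst z) (snd z) $ j - \<rho> $ j) * ln (real (N (fst z) j) / real (K (fst z) j)))) \<longlongrightarrow> 1) (prob_filter M)" by simp
  then show ?thesis
    by (rule Lim_transform_eventually)
      (use eventually_fst_prob_filter[OF tl.eventually_K_N[of j]] in \<open>eventually_elim, simp add: powr_def\<close>)
qed

lemma sqrt_k_ratio: "((\<lambda>z. sqrt (k_total (K (fst z)) / real (K (fst z) j))) \<longlongrightarrow> sqrt (c $ j * S)) (prob_filter M)"
  by (intro tendsto_real_sqrt tendsto_fst_prob_filter[OF k_ratio])

lemma B_hat_lim: "(Bh \<longlongrightarrow> B) (prob_filter M)"
proof (rule vec_tendstoI)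
  fix j
  \<comment> \<open>The estimated power is split into the true one, whose product with sqrt K
    converges, and the ratio treated in \<open>powr_diff_lim\<close>.\<close>
  let ?f = "\<lambda>z. sqrt (k_total (K (fst z)) / real (K (fst z) j)) *
      (sqrt (K (fst z) j) * (real (N (fst z) j) / real (K (fst z) j)) powr (\<rho> $ j)) *
      (real (N (fst z) j) / real (K (fst z) j)) powr (\<rho>h (fst z) (snd z) $ j - \<rho> $ j) *
      gh z * \<beta>h (fst z) (snd z) $ j / (1 - \<rho>h (fst z) (snd z) $ j)"
  have "(?f \<longlongrightarrow>
      sqrt (c $ j * S) * (lam $ j / (\<gamma> * \<beta> $ j)) * 1 * \<gamma> * \<beta> $ j / (1 - \<rho> $ j)) (prob_filter M)"
    using \<rho>_neg[of j]
    by (intro tendsto_intros sqrt_k_ratio tendsto_fst_prob_filter[OF mu_lim] powr_diff_lim gamma_hat_lim \<beta>h_lim rho_hat_lim) auto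
  moreover have "sqrt (c $ j * S) * (lam $ j / (\<gamma> * \<beta> $ j)) * 1 * \<gamma> * \<beta> $ j / (1 - \<rho> $ j) = B $ j"
    using \<gamma>_pos \<beta>_nz[of j] by (simp add: B_def B_asym_def S_def real_sqrt_mult mult_ac)
  ultimately have "(?f \<longlongrightarrow> B $ j) (prob_filter M)" by simp
  then show "((\<lambda>z. Bh z $ j) \<longlongrightarrow> B $ j) (prob_filter M)"
  proof (rule Lim_transform_eventually)
    show "\<forall>\<^sub>F z in prob_filter M. ?f z = Bh z $ j"
      using eventually_fst_prob_filter[OF tl.eventually_K_N[of j]]
    proof eventually_elim
      case (elim z)
      let ?r = "real (N (fst z) j) / real (K (fst z) j)"
      have p: "?r powr (\<rho> $ j) * ?r powr (\<rho>h (fst z) (snd z) $ j - \<rho> $ j) = ?r powr (\<rho>h (fst z) (snd z) $ j)"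
        by (simp flip: powr_add)
      have "sqrt (k_total (K (fst z)) / real (K (fst z) j)) * (sqrt (K (fst z) j) * ?r powr (\<rho> $ j)) *
        ?r powr (\<rho>h (fst z) (snd z) $ j - \<rho> $ j) * gh z * \<beta>h (fst z) (snd z) $ j / (1 - \<rho>h (fst z) (snd z) $ j)
        = sqrt (k_total (K (fst z))) * (?r powr (\<rho> $ j) * ?r powr (\<rho>h (fst z) (snd z) $ j - \<rho> $ j)) * gh z * \<beta>h (fst z) (snd z) $ j / (1 - \<rho>h (fst z) (snd z) $ j)"
        using elim by (simp add: real_sqrt_divide)
      also have "\<dots> = Bh z $ j" unfolding p using elim by (simp add: B_hat_def lambda_hat_def)
      finally show ?case .
    qed
  qed
qed

lemma V_hat_lim: "((\<lambda>z. Vh z $ j $ l) \<longlongrightarrow> V $ j $ l) (prob_filter M)"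
proof -
  have off: "((\<lambda>z. k_total (K (fst z)) * (gh z)\<^sup>2 * (1 / real (K (fst z) j)) *
      R_hat (N (fst z)) (K (fst z)) (\<lambda>i. X i (snd z)) j l (real (K (fst z) j) / real (K (fst z) l)) (real (N (fst z) j) / real (N (fst z) l)))
      \<longlongrightarrow> S * \<gamma>\<^sup>2 * c $ j * g j l (- ln (c $ l / c $ j)) (- ln (b $ l / b $ j))) (prob_filter M)" if "j < l" for j l
  proof -
    let ?R = "\<lambda>z. R_hat (N (fst z)) (K (fst z)) (\<lambda>i. X i (snd z)) j l (real (K (fst z) j) / real (K (fst z) l)) (real (N (fst z) j) / real (N (fst z) l))"
    have R: "(?R \<longlongrightarrow> g j l (- ln (c $ l / c $ j)) (- ln (b $ l / b $ j))) (prob_filter M)"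
      using that order b_pos[of j] b_pos[of l] c_pos[of j] c_pos[of l]
      by (intro R_hat_lim[where x="\<lambda>w i. X i w"] K_ratio[unfolded \<kappa>_def] N_ratio) auto
    have "((\<lambda>z. k_total (K (fst z)) / real (K (fst z) j) * (gh z)\<^sup>2 * ?R z)
      \<longlongrightarrow> c $ j * S * \<gamma>\<^sup>2 * g j l (- ln (c $ l / c $ j)) (- ln (b $ l / b $ j))) (prob_filter M)"
      by (intro tendsto_intros tendsto_fst_prob_filter[OF k_ratio] gamma_hat_lim R)
    then show ?thesis by (simp add: mult_ac)
  qed
  have diag: "((\<lambda>z. k_total (K (fst z)) * (gh z)\<^sup>2 / real (K (fst z) j)) \<longlongrightarrow> S * \<gamma>\<^sup>2 * c $ j) (prob_filter M)" for j
  proof -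
    have "((\<lambda>z. k_total (K (fst z)) / real (K (fst z) j) * (gh z)\<^sup>2) \<longlongrightarrow> c $ j * S * \<gamma>\<^sup>2) (prob_filter M)"
      by (intro tendsto_intros tendsto_fst_prob_filter[OF k_ratio] gamma_hat_lim)
    then show ?thesis by (simp add: mult_ac)
  qed
  consider "j = l" | "j < l" | "l < j" by (rule linorder_cases)
  then show ?thesis
  proof cases
    case 1
    then show ?thesis using diag[of j] by (simp add: V_def V_hat_def sym_matrix_def)
  next
    case 2
    then show ?thesis using off[OF 2] by (auto simp: V_def V_hat_def sym_matrix_def)
  next
    case 3
    then show ?thesis using off[OF 3] by (auto simp: V_def V_hat_def sym_matrix_def)
  qed
qed

text \<open>V evaluates the tail copula at (c l / c j, b l / b j), the central limit theorem at (1,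
  exp (- d j l)); the two points lie on one ray, at ratio c l / c j.\<close>

lemma g_homogeneous:
  assumes "j \<noteq> l"
  shows "g j l (- ln (c $ l / c $ j)) (- ln (b $ l / b $ j)) = c $ l / c $ j * g j l 0 (d j l)"
proof -
  interpret P: exp_pair_limit D "\<epsilon> j" "\<epsilon> l" "g j l" by (rule exp_pair_limit_D[OF assms])
  have "d j l + - ln (c $ l / c $ j) = - ln (b $ l / b $ j)"
    using b_pos[of j] b_pos[of l] c_pos[of j] c_pos[of l] by (simp add: d_def ln_mult ln_div)
  moreover have "exp (- (- ln (c $ l / c $ j))) = c $ l / c $ j"
    using c_pos[of j] c_pos[of l] by simp
  ultimately show ?thesis
    using P.g_shift[of 0 "- ln (c $ l / c $ j)" "d j l"] by (simp only: add_0)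
qed

text \<open>sqrt (c j S) is the limit of sqrt (k / K n j), which brings sample j to the common rate
  sqrt k. With the factor sqrt (c l / c j) of the covariance limit these roots multiply to S times c
  l, and homogeneity turns the result into the entry of V.\<close>

lemma variance_eq_V:
  fixes \<omega> :: "'m rvec"
  defines "\<alpha> \<equiv> \<lambda>j. \<omega> $ j * \<gamma> * sqrt (c $ j * S)"
  defines "\<sigma> \<equiv> \<lambda>j l. if j = l then 1 else if j < l then sqrt (\<kappa> j l) * g j l 0 (d j l) else sqrt (\<kappa> l j) * g l j 0 (d l j)"
  shows "(\<Sum>j\<in>UNIV. \<Sum>l\<in>UNIV. \<alpha> j * \<alpha> l * \<sigma> j l) = \<omega> \<bullet> (V *v \<omega>)"
proof -
  have sq: "sqrt (c $ j * S) * sqrt (c $ l * S) * sqrt (c $ l / c $ j) = S * c $ l" for j l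
  proof -
    have "c $ j * S * (c $ l * S) * (c $ l / c $ j) = (S * c $ l)\<^sup>2"
      using c_pos[of j] by (simp add: power2_eq_square)
    then have "sqrt (c $ j * S * (c $ l * S) * (c $ l / c $ j)) = S * c $ l"
      using S_pos c_pos[of l] by (simp del: real_sqrt_mult)
    then show ?thesis by (simp only: real_sqrt_mult)
  qed
  have less: "\<alpha> j * \<alpha> l * (sqrt (\<kappa> j l) * g j l 0 (d j l)) = \<omega> $ j * \<omega> $ l * (S * \<gamma>\<^sup>2 * c $ j * g j l (- ln (c $ l / c $ j)) (- ln (b $ l / b $ j)))"
    if "j < l" for j l
  proof -
    have "\<alpha> j * \<alpha> l * (sqrt (\<kappa> j l) * g j l 0 (d j l)) = \<omega> $ j * \<omega> $ l * \<gamma>\<^sup>2 * g j l 0 (d j l) * (sqrt (c $ j * S) * sqrt (c $ l * S) * sqrt (c $ l / c $ j))"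
      by (simp only: \<alpha>_def \<kappa>_def power2_eq_square mult_ac)
    also have "\<dots> = \<omega> $ j * \<omega> $ l * \<gamma>\<^sup>2 * g j l 0 (d j l) * (S * c $ l)" unfolding sq ..
    also have "\<dots> = \<omega> $ j * \<omega> $ l * (S * \<gamma>\<^sup>2 * c $ j * (c $ l / c $ j * g j l 0 (d j l)))"
      using c_pos[of j] by simp
    finally show ?thesis using that by (simp add: g_homogeneous)
  qed
  have "\<alpha> j * \<alpha> l * \<sigma> j l = \<omega> $ j * (V $ j $ l * \<omega> $ l)" for j l
  proof -
    consider "j = l" | "j < l" | "l < j" by (rule linorder_cases)
    then show ?thesis
    proof cases
      case 1
      have "sqrt (c $ j * S) * sqrt (c $ j * S) = c $ j * S" using c_pos[of j] S_pos by simp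
      then have "\<alpha> j * \<alpha> j = \<omega> $ j * \<omega> $ j * \<gamma>\<^sup>2 * (c $ j * S)"
        unfolding \<alpha>_def power2_eq_square by (metis (no_types, lifting) mult.assoc mult.left_commute)
      then show ?thesis using 1 by (simp add: \<sigma>_def V_def sym_matrix_def mult_ac)
    next
      case 2
      then show ?thesis using less[OF 2] by (auto simp: \<sigma>_def V_def sym_matrix_def mult_ac)
    next
      case 3
      then show ?thesis using less[OF 3] by (auto simp: \<sigma>_def V_def sym_matrix_def mult_ac)
    qed
  qed
  then show ?thesis by (simp add: inner_vec_def matrix_vector_mult_def sum_distrib_left)
qed

text \<open>Estimating the weights has no effect in the limit because their error multiplies tight
  linear parts. The bias left by the Hill expansions tends to \<omega> \<bullet> B, which is also
  the limit of the subtracted correction.\<close>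

theorem weighted_clt:
  fixes om :: "nat \<Rightarrow> 'w \<Rightarrow> 'm rvec" and \<omega> :: "'m rvec"
  assumes om: "((\<lambda>z. om (fst z) (snd z)) \<longlongrightarrow> \<omega>) (prob_filter M)"
    and om1: "\<forall>\<^sub>F z in prob_filter M. om (fst z) (snd z) \<bullet> 1 = 1"
    and om_rv: "\<And>n j. (\<lambda>w. om n w $ j) \<in> borel_measurable M"
    and v: "\<omega> \<bullet> (V *v \<omega>) > 0"
  shows "tendsto_in_distr M (\<lambda>n w. sqrt (k_total (K n)) *
      (gamma_bar (N n) (K n) (\<lambda>i. X i w) \<omega>0 (\<beta>h n w) (\<rho>h n w) (om n w) - \<gamma>)) (normal_law 0 (\<omega> \<bullet> (V *v \<omega>)))"
proof -
  define Y where "Y n w = sqrt (k_total (K n)) *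
      (gamma_bar (N n) (K n) (\<lambda>i. X i w) \<omega>0 (\<beta>h n w) (\<rho>h n w) (om n w) - \<gamma>)" for n w
  define \<alpha> where "\<alpha> = (\<lambda>j. \<omega> $ j * \<gamma> * sqrt (c $ j * S))"
  define L where "L n w = (\<Sum>j\<in>UNIV. \<alpha> j * tl.lin j n w)" for n w
  have Y_rv[measurable]: "Y n \<in> borel_measurable M" for n
    unfolding Y_def[abs_def] using gamma_bar_measurable[OF X_rv \<beta>h_rv \<rho>h_rv om_rv] by measurable
  have L_rv: "L n \<in> borel_measurable M" for n
  proof -
    note lin_tight(1)[measurable]
    show ?thesis unfolding L_def[abs_def] by measurable
  qed
  note omj = tendsto_vec_nth[OF om]
  \<comment> \<open>\<open>?T1\<close> collects the biases and remainders of the Hill expansions,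
    \<open>?T2\<close> the error of the weights; what is left of the estimator is the linear
    statistic L.\<close>
  let ?T1 = "\<lambda>z. \<Sum>j\<in>UNIV. om (fst z) (snd z) $ j * sqrt (k_total (K (fst z)) / real (K (fst z) j)) *
      (sqrt (K (fst z) j) * (hl j z - \<gamma>) - \<gamma> * tl.lin j (fst z) (snd z))"
  let ?T2 = "\<lambda>z. \<Sum>j\<in>UNIV. \<gamma> * ((om (fst z) (snd z) $ j * sqrt (k_total (K (fst z)) / real (K (fst z) j)) - \<omega> $ j * sqrt (c $ j * S))
      * tl.lin j (fst z) (snd z))"
  have t1: "(?T1 \<longlongrightarrow>
      (\<Sum>j\<in>UNIV. \<omega> $ j * sqrt (c $ j * S) * (lam $ j / (1 - \<rho> $ j)))) (prob_filter M)"
    by (intro tendsto_intros omj sqrt_k_ratio hill_lin)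
  have t2: "(?T2 \<longlongrightarrow> (\<Sum>j\<in>(UNIV::'m set). \<gamma> * 0)) (prob_filter M)"
  proof (intro tendsto_sum tendsto_mult tendsto_const tight_mult_tendsto_0[OF lin_tight])
    fix j
    let ?f = "\<lambda>z. om (fst z) (snd z) $ j * sqrt (k_total (K (fst z)) / real (K (fst z) j)) - \<omega> $ j * sqrt (c $ j * S)"
    have "(?f \<longlongrightarrow>
       \<omega> $ j * sqrt (c $ j * S) - \<omega> $ j * sqrt (c $ j * S)) (prob_filter M)"
      by (intro tendsto_intros omj sqrt_k_ratio)
    then show "(?f \<longlongrightarrow> 0) (prob_filter M)"
      by simp
  qed
  have t3: "((\<lambda>z. om (fst z) (snd z) \<bullet> Bh z) \<longlongrightarrow> \<omega> \<bullet> B) (prob_filter M)"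
    by (intro tendsto_intros om B_hat_lim)
  have "(\<Sum>j\<in>UNIV. \<omega> $ j * sqrt (c $ j * S) * (lam $ j / (1 - \<rho> $ j))) = \<omega> \<bullet> B"
    by (simp add: inner_vec_def B_def B_asym_def S_def real_sqrt_mult mult_ac)
  with tendsto_diff[OF tendsto_add[OF t1 t2] t3]
  have lim0: "((\<lambda>z. ?T1 z + ?T2 z - om (fst z) (snd z) \<bullet> Bh z) \<longlongrightarrow> 0) (prob_filter M)" by simp
  have evK: "\<forall>\<^sub>F n in sequentially. \<forall>j\<in>UNIV. 0 < K n j"
  proof (intro eventually_ball_finite ballI)
    show "\<forall>\<^sub>F n in sequentially. 0 < K n j" for j
      by (rule eventually_mono[OF tl.eventually_K_N[of j]]) simp
  qed simp
  have D: "((\<lambda>z. Y (fst z) (snd z) - L (fst z) (snd z)) \<longlongrightarrow> 0) (prob_filter M)"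
  proof (rule Lim_transform_eventually[OF lim0])
    show "\<forall>\<^sub>F z in prob_filter M. ?T1 z + ?T2 z - om (fst z) (snd z) \<bullet> Bh z = Y (fst z) (snd z) - L (fst z) (snd z)"
      using eventually_fst_prob_filter[OF evK] eventually_fst_prob_filter[OF k_pos] om1
    proof eventually_elim
      case (elim z)
      obtain n w where z: "z = (n, w)" by force
      define k where "k = k_total (K n)"
      define o' where "o' = om n w"
      have K: "0 < K n j" for j using elim by (simp add: z)
      have k: "0 < k" and o1: "(\<Sum>j\<in>UNIV. o' $ j) = 1"
        using elim by (auto simp: z k_def o'_def inner_vec_def)
      have r: "sqrt (k / K n j) * sqrt (K n j) = sqrt k" for j using K[of j] by (simp add: real_sqrt_divide)
      have "Y n w = sqrt k * ((\<Sum>j\<in>UNIV. o' $ j * hl j z) - \<gamma>) - o' \<bullet> Bh z"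
        using k by (simp add: Y_def gamma_bar_def gamma_hat_def z k_def[symmetric] o'_def[symmetric] algebra_simps)
      also have "(\<Sum>j\<in>UNIV. o' $ j * hl j z) - \<gamma> = (\<Sum>j\<in>UNIV. o' $ j * (hl j z - \<gamma>))"
        using o1 by (simp add: right_diff_distrib sum_subtractf flip: sum_distrib_right)
      also have "sqrt k * (\<Sum>j\<in>UNIV. o' $ j * (hl j z - \<gamma>)) = (\<Sum>j\<in>UNIV. o' $ j * sqrt (k / K n j) * (sqrt (K n j) * (hl j z - \<gamma>)))"
        unfolding sum_distrib_left
      proof (intro sum.cong refl)
        fix j show "sqrt k * (o' $ j * (hl j z - \<gamma>)) = o' $ j * sqrt (k / K n j) * (sqrt (K n j) * (hl j z - \<gamma>))"
          unfolding r[of j, symmetric] by (simp only: mult_ac)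
      qed
      finally have Y: "Y n w = (\<Sum>j\<in>UNIV. o' $ j * sqrt (k / K n j) * (sqrt (K n j) * (hl j z - \<gamma>))) - o' \<bullet> Bh z" .
      show ?case
        unfolding z fst_conv snd_conv Y L_def \<alpha>_def k_def[symmetric] o'_def[symmetric]
        by (simp add: algebra_simps sum_subtractf sum.distrib z)
    qed
  qed
  have "tendsto_in_distr M Y (normal_law 0 (\<omega> \<bullet> (V *v \<omega>)))"
    unfolding tendsto_in_distr_def
  proof (rule levy_continuity)
    show "real_distribution (distr M borel (Y n))" for n by (rule real_distribution_distr) measurable
    show "real_distribution (normal_law 0 (\<omega> \<bullet> (V *v \<omega>)))" by (rule real_distribution_normal_law[OF v])
    fix t
    have "(\<lambda>n. char (distr M borel (L n)) t) \<longlonglongrightarrow> of_real (exp (- (t\<^sup>2 * (\<omega> \<bullet> (V *v \<omega>)) / 2)))"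
    proof -
      have "(\<Sum>j\<in>UNIV. \<Sum>l\<in>UNIV. \<alpha> j * \<alpha> l * (if j = l then 1 else if j < l then sqrt (\<kappa> j l) * g j l 0 (d j l)
          else sqrt (\<kappa> l j) * g l j 0 (d l j))) = \<omega> \<bullet> (V *v \<omega>)"
        unfolding \<alpha>_def by (rule variance_eq_V)
      then show ?thesis
        using lin_comb_clt[OF K_ratio s0_diff, of \<alpha> t] by (simp only: L_def[abs_def])
    qed
    from char_slutsky[OF Y_rv L_rv D this]
    show "(\<lambda>n. char (distr M borel (Y n)) t) \<longlonglongrightarrow> char (normal_law 0 (\<omega> \<bullet> (V *v \<omega>))) t"
      unfolding char_normal_law[OF v] .
  qed
  then show ?thesis by (simp add: Y_def[abs_def])
qed

end

section \<open>The tail quantile function as inverse of the survival function\<close>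

context continuous_df
begin

definition tq :: "real \<Rightarrow> real" where
  "tq t = Inf {x. 1 / ereal (sf x) \<ge> ereal t}"

text \<open>Where \<open>sf\<close> vanishes the extended quotient is infinite, so such points
  belong to both sets.\<close>

lemma tq_eq:
  assumes "t > 0" shows "tq t = Inf {x. sf x \<le> 1 / t}"
proof -
  have "1 / ereal (sf x) \<ge> ereal t \<longleftrightarrow> sf x \<le> 1 / t" for x
  proof (cases "sf x = 0")
    case False
    then have "sf x > 0" using sf_bounds[of x] by simp
    then have "1 / ereal (sf x) = ereal (1 / sf x)" by (simp add: one_ereal_def)
    then show ?thesis using assms \<open>sf x > 0\<close> by (simp add: field_simps)
  qed (use assms in \<open>simp add: divide_ereal_def zero_ereal_def[symmetric]\<close>)
  then show ?thesis by (simp add: tq_def)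
qed

text \<open>\<open>Inf\<close> on the reals is antitone only for nonempty sets bounded below; levels
  above 1 guarantee the lower bound.\<close>

lemma tq_mono:
  assumes "1 < s" "s \<le> t" shows "tq s \<le> tq t"
proof -
  have "Inf {x. sf x \<le> 1 / s} \<le> Inf {x. sf x \<le> 1 / t}"
  proof (rule cInf_superset_mono)
    have "1 - 1 / t < 1" using assms by simp
    from order_tendstoD(1)[OF cdf_lim_at_top_prob this]
    obtain y where "1 - 1 / t < cdf M y" by (auto simp: eventually_at_top_linorder)
    then have "y \<in> {x. sf x \<le> 1 / t}" by (simp add: sf_def)
    then show "{x. sf x \<le> 1 / t} \<noteq> {}" by blast
    have "0 < 1 - 1 / s" using assms by simp
    from order_tendstoD(2)[OF cdf_lim_at_bot this]
    obtain a where "cdf M a < 1 - 1 / s" by (auto simp: eventually_at_bot_linorder)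
    then have "1 / s < sf a" by (simp add: sf_def)
    then have "a \<le> x" if "sf x \<le> 1 / s" for x using that sf_antimono[of x a] by linarith
    then show "bdd_below {x. sf x \<le> 1 / s}" by (intro bdd_belowI[of _ a]) auto
    have "1 / t \<le> 1 / s" using assms by (simp add: frac_le)
    then show "{x. sf x \<le> 1 / t} \<subseteq> {x. sf x \<le> 1 / s}" by auto
  qed
  then show ?thesis using assms by (simp add: tq_eq)
qed

text \<open>Strictness to the left makes x the least point with its survival value;
  \<open>AE_sf_strict\<close> supplies it almost surely.\<close>

lemma tq_inverse:
  assumes "0 < sf x" "sf x < 1" and strict: "\<forall>y<x. sf x < sf y"
  shows "0 < - ln (sf x)" "tq (exp (- ln (sf x))) = x"
proof -
  show "0 < - ln (sf x)" using assms by (simp add: ln_less_zero)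
  have "{y. sf y \<le> sf x} = {x..}" using strict sf_antimono[of x] by (auto simp: not_less[symmetric])
  then have "Inf {y. sf y \<le> sf x} = x" by simp
  moreover have "exp (- ln (sf x)) = 1 / sf x" using assms by (simp add: exp_minus inverse_eq_divide)
  ultimately show "tq (exp (- ln (sf x))) = x" using assms by (simp add: tq_eq)
qed

end

theorem corollary2:
  fixes M :: "'w measure"
    and X0 :: "'w \<Rightarrow> ('m::{finite,linorder}) rvec"
    and X :: "nat \<Rightarrow> 'w \<Rightarrow> 'm rvec"
    and N K :: "nat \<Rightarrow> 'm \<Rightarrow> nat"
    and \<gamma> :: real
    and \<rho> \<beta> b c lam \<omega>0 :: "'m rvec"
    and A :: "'m \<Rightarrow> real \<Rightarrow> real"
    and R :: "'m \<Rightarrow> 'm \<Rightarrow> ennreal \<Rightarrow> ennreal \<Rightarrow> real"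
    and \<beta>h \<rho>h :: "nat \<Rightarrow> 'w \<Rightarrow> 'm rvec"
    and V :: "'m rmat" and B :: "'m rvec"
  defines "V \<equiv> V_asym \<gamma> c b R"
    and "B \<equiv> B_asym c lam \<rho>"
  assumes prob: "prob_space M"
    and X0_rv: "X0 \<in> borel_measurable M"
    and indep: "prob_space.indep_vars M (\<lambda>_. borel) X {1..}"
    and copies: "\<And>i. i \<ge> 1 \<Longrightarrow> distr M borel (X i) = distr M borel X0"
    and cont_df: "\<And>j. continuous_on UNIV (marg_df M X0 j)"
    and C2: "condition_C2 M X0 (\<gamma> *\<^sub>R 1) \<rho> A"
    and J: "condition_J M X0 R"
    and rho_neg: "\<And>j. \<rho> $ j < 0"
    and A_eq: "\<And>j t. t > 0 \<Longrightarrow> A j t = \<gamma> * \<beta> $ j * t powr (\<rho> $ j)"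
    and N_sum: "\<And>n. (\<Sum>j\<in>UNIV. N n j) = n"
    and N_lim: "\<And>j. filterlim (\<lambda>n. N n j) at_top sequentially"
    and N_mono: "\<And>n. mono (N n)"
    and K_lim: "\<And>j. filterlim (\<lambda>n. K n j) at_top sequentially"
    and K_N_lim: "\<And>j. (\<lambda>n. real (K n j) / real (N n j)) \<longlonglongrightarrow> 0"
    and b_lim: "\<And>j. (\<lambda>n. real (N n first_idx) / real (N n j)) \<longlonglongrightarrow> b $ j"
    and b_range: "\<And>j. 0 < b $ j \<and> b $ j \<le> 1"
    and c_lim: "\<And>j. (\<lambda>n. real (K n first_idx) / real (K n j)) \<longlonglongrightarrow> c $ j"
    and c_pos: "\<And>j. 0 < c $ j"
    and lam_lim: "\<And>j. (\<lambda>n. sqrt (real (K n j)) * A j (real (N n j) / real (K n j)))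
                          \<longlonglongrightarrow> lam $ j"
    and V_pd: "pos_definite V"
    and pilot: "\<omega>0 \<bullet> 1 = 1"
    and beta_rv: "\<And>n. \<beta>h n \<in> borel_measurable M"
    and rho_rv: "\<And>n. \<rho>h n \<in> borel_measurable M"
    and beta_consistent: "\<And>j. tendsto_in_prob M (\<lambda>n w. \<beta>h n w $ j) (\<beta> $ j)"
    and rho_rate: "\<And>j. tendsto_in_prob M
                     (\<lambda>n w. (\<rho>h n w $ j - \<rho> $ j) * ln (real (N n j))) 0"
  shows "tendsto_in_distr M
           (\<lambda>n w. let x = (\<lambda>i. X i w) in
              sqrt (k_total (K n)) *
              (gamma_bar (N n) (K n) x \<omega>0 (\<beta>h n w) (\<rho>h n w)
                 (omega_hat_Var (N n) (K n) x \<omega>0) - \<gamma>))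
           (normal_law 0 (1 / (1 \<bullet> (matrix_inv V *v 1)))) \<and>
         tendsto_in_distr M
           (\<lambda>n w. let x = (\<lambda>i. X i w) in
              sqrt (k_total (K n)) *
              (gamma_bar (N n) (K n) x \<omega>0 (\<beta>h n w) (\<rho>h n w)
                 (omega_hat_AMSE (N n) (K n) x \<omega>0 (\<beta>h n w) (\<rho>h n w)) - \<gamma>))
           (normal_law 0
             (((1 + B \<bullet> (matrix_inv V *v B))\<^sup>2 * (1 \<bullet> (matrix_inv V *v 1))
                - (2 + B \<bullet> (matrix_inv V *v B)) * (1 \<bullet> (matrix_inv V *v B))\<^sup>2)
              / ((1 + B \<bullet> (matrix_inv V *v B)) * (1 \<bullet> (matrix_inv V *v 1))
                - (1 \<bullet> (matrix_inv V *v B))\<^sup>2)\<^sup>2))"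
  proof -
  interpret prob_space M by (rule prob)
  have nth[measurable]: "(\<lambda>x::'m rvec. x $ j) \<in> borel_measurable borel" for j
    by (intro borel_measurable_continuous_onI continuous_intros)
  note X0_rv[measurable]
  have X_rv: "X i \<in> borel_measurable M" if "i \<ge> 1" for i
    using indep that by (auto simp: indep_vars_def2)
  define D where "D = distr M borel X0"
  define \<mu> where "\<mu> j = distr M borel (\<lambda>w. X0 w $ j)" for j
  have cdf\<mu>: "marg_df M X0 j = cdf (\<mu> j)" for j by (simp add: marg_df_def \<mu>_def)
  have cdj: "continuous_df (\<mu> j)" for j
    unfolding continuous_df_def continuous_df_axioms_def
  proof
    show "real_distribution (\<mu> j)" unfolding \<mu>_def by (rule real_distribution_distr) measurable
    show "continuous_on UNIV (cdf (\<mu> j))" using cont_df[of j] by (simp add: cdf\<mu>)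
  qed
  interpret cd: continuous_df "\<mu> j" for j by (rule cdj)
  have sf: "marg_sf M X0 j x = cd.sf j x" for j x by (simp add: marg_sf_def cdf\<mu> cd.sf_def)
  have tq: "tail_quantile M X0 j = cd.tq j" for j by (simp add: fun_eq_iff tail_quantile_def cd.tq_def sf)
  define \<epsilon> where "\<epsilon> j x = - ln (cd.sf j (x $ j))" for j and x :: "'m rvec"
  \<comment> \<open>The tail copula in logarithmic coordinates; both arguments are finite, so
    \<open>condition_J\<close> applies to them.\<close>
  define g where "g j l a b' = R j l (ennreal (exp (- a))) (ennreal (exp (- b')))" for j l a b'
  have \<mu>D: "\<mu> j = distr D borel (\<lambda>x. x $ j)" for j
    unfolding \<mu>_def D_def by (subst distr_distr) (auto simp: comp_def)
  have \<epsilon>_rv[measurable]: "\<epsilon> j \<in> borel_measurable borel" for j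
    unfolding \<epsilon>_def[abs_def] by measurable
  have \<epsilon>_exp: "distr D borel (\<epsilon> j) = std_exp" for j
  proof -
    define f where "f x = - ln (cd.sf j x)" for x
    have [measurable]: "f \<in> borel_measurable borel" unfolding f_def[abs_def] by measurable
    have "distr (\<mu> j) borel f = distr D borel (\<lambda>x. f (x $ j))"
      unfolding \<mu>D by (subst distr_distr) (auto simp: comp_def D_def)
    then show ?thesis using cd.distr_neg_ln_sf[of j] by (simp add: f_def[abs_def] \<epsilon>_def[abs_def])
  qed
  have \<gamma>_pos: "\<gamma> > 0" using C2 by (auto simp: condition_C2_def)
  have \<beta>_nz: "\<beta> $ j \<noteq> 0" for j
  proof -
    have "A j 1 \<noteq> 0" using C2 unfolding condition_C2_def by (metis less_irrefl zero_less_one)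
    then show ?thesis using A_eq[of 1 j] by auto
  qed
  have AE_D: "AE x in D. P (x $ j)" if "AE x in \<mu> j. P x" for P j
    by (rule AE_distrD[of "\<lambda>x. x $ j" D borel P], simp add: D_def, rule that[unfolded \<mu>D])
  have AE_X: "AE w in M. P (X i w)" if "AE x in D. P x" "i \<ge> 1" for P i
    by (rule AE_distrD[OF X_rv[OF that(2)]], subst copies[OF that(2)], rule that(1)[unfolded D_def])
  \<comment> \<open>One almost sure event on which every survival value lies strictly between 0 and
    1 and every observation can be recovered from its own.\<close>
  have regular: "AE w in M. \<forall>i\<ge>1. \<forall>j. 0 < cd.sf j (X i w $ j) \<and> cd.sf j (X i w $ j) < 1 \<and>
      (\<forall>y<X i w $ j. cd.sf j (X i w $ j) < cd.sf j y)"
  proof -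
    have "AE x in \<mu> j. 0 < cd.sf j x \<and> cd.sf j x < 1 \<and> (\<forall>y<x. cd.sf j x < cd.sf j y)" for j
      using cd.AE_sf_range[of j] cd.AE_sf_strict[of j] by eventually_elim simp
    from AE_D[OF this] have "AE x in D. \<forall>j\<in>UNIV. 0 < cd.sf j (x $ j) \<and> cd.sf j (x $ j) < 1 \<and>
      (\<forall>y<x $ j. cd.sf j (x $ j) < cd.sf j y)" by (subst AE_finite_all) auto
    from AE_X[OF this] have "AE w in M. i \<ge> 1 \<longrightarrow> (\<forall>j. 0 < cd.sf j (X i w $ j) \<and> cd.sf j (X i w $ j) < 1 \<and>
      (\<forall>y<X i w $ j. cd.sf j (X i w $ j) < cd.sf j y))" for i by (cases "i \<ge> 1") auto
    then show ?thesis by (simp add: AE_all_countable)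
  qed
  \<comment> \<open>On this event \<epsilon> neither reorders nor merges observations, so ranks,
    ties included, are the same on both scales.\<close>
  have order: "AE w in M. \<forall>q. \<forall>i\<ge>1. \<forall>p\<ge>1. X p w $ q \<le> X i w $ q \<longleftrightarrow> \<epsilon> q (X p w) \<le> \<epsilon> q (X i w)"
    using regular
  proof eventually_elim
    case (elim w)
    show ?case
    proof (intro allI impI)
      fix q and i p :: nat assume ip: "i \<ge> 1" "p \<ge> 1"
      have pos: "0 < cd.sf q (X i w $ q)" "0 < cd.sf q (X p w $ q)" using elim ip by auto
      have "X p w $ q \<le> X i w $ q \<longleftrightarrow> cd.sf q (X i w $ q) \<le> cd.sf q (X p w $ q)"
      proof
        assume "cd.sf q (X i w $ q) \<le> cd.sf q (X p w $ q)"
        then show "X p w $ q \<le> X i w $ q" using elim ip by (meson not_less)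
      qed (rule cd.sf_antimono)
      then show "X p w $ q \<le> X i w $ q \<longleftrightarrow> \<epsilon> q (X p w) \<le> \<epsilon> q (X i w)"
        using pos by (simp add: \<epsilon>_def)
    qed
  qed
  have g_lim: "((\<lambda>h. exp h * (LINT x|D. indicator {h + a<..} (\<epsilon> j x) * indicator {h + b'<..} (\<epsilon> l x))) \<longlongrightarrow> g j l a b') at_top"
    if "j \<noteq> l" for j l a b'
  proof -
    have eq: "(LINT x|D. indicator {h + a<..} (\<epsilon> j x) * indicator {h + b'<..} (\<epsilon> l x)) =
      surv_copula M X0 j l (ennreal (exp (- a)) / ennreal (exp h)) (ennreal (exp (- b')) / ennreal (exp h))" for h
    proof -
      define E where "E = {w \<in> space M. cd.sf j (X0 w $ j) \<le> exp (- (h + a)) \<and> cd.sf l (X0 w $ l) \<le> exp (- (h + b'))}"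
      have [measurable]: "E \<in> sets M" unfolding E_def by measurable
      have X0_AE: "AE w in M. P (X0 w $ q)" if "AE x in \<mu> q. P x" for P q
        by (rule AE_distrD[of "\<lambda>w. X0 w $ q" M borel P], measurable, rule that[unfolded \<mu>_def])
      \<comment> \<open>Exceedance is strict on the exponential scale but weak in
        \<open>surv_copula\<close>; the two differ at a single value, excluded almost surely by
        \<open>AE_sf_neq\<close>.\<close>
      have ind: "indicator {h + a<..} (- ln s) = (indicator {..exp (- (h + a))} s :: real)"
        if "0 < s" "s \<noteq> exp (- (h + a))" for s h a :: real
      proof -
        have "exp (ln s) < exp (- (h + a)) \<longleftrightarrow> ln s < - (h + a)" by (rule exp_less_cancel_iff)
        then have "h + a < - ln s \<longleftrightarrow> s < exp (- (h + a))" using that by auto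
        then show ?thesis using that by (auto simp: indicator_def)
      qed
      have "(LINT x|D. indicator {h + a<..} (\<epsilon> j x) * indicator {h + b'<..} (\<epsilon> l x)) =
        expectation (\<lambda>w. indicator {h + a<..} (\<epsilon> j (X0 w)) * indicator {h + b'<..} (\<epsilon> l (X0 w)) :: real)"
        unfolding D_def by (rule integral_distr) measurable
      also have "\<dots> = expectation (indicator E)"
      proof (rule integral_cong_AE)
        show "AE w in M. indicator {h + a<..} (\<epsilon> j (X0 w)) * indicator {h + b'<..} (\<epsilon> l (X0 w)) = (indicator E w :: real)"
          using X0_AE[OF cd.AE_sf_range[of j]] X0_AE[OF cd.AE_sf_range[of l]]
            X0_AE[OF cd.AE_sf_neq[of j "exp (- (h + a))"]] X0_AE[OF cd.AE_sf_neq[of l "exp (- (h + b'))"]] AE_space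
          by eventually_elim (simp add: \<epsilon>_def ind, auto simp: E_def indicator_def)
      qed measurable
      also have "\<dots> = measure M E" by simp
      also have "E = {w \<in> space M. ennreal (marg_sf M X0 j (X0 w $ j)) \<le> ennreal (exp (- a)) / ennreal (exp h) \<and>
          ennreal (marg_sf M X0 l (X0 w $ l)) \<le> ennreal (exp (- b')) / ennreal (exp h)}"
        by (simp add: E_def sf divide_ennreal exp_diff exp_minus exp_add divide_inverse mult.commute)
      finally show ?thesis by (simp add: surv_copula_def)
    qed
    have "((\<lambda>s::real. s * surv_copula M X0 j l (ennreal (exp (- a)) / ennreal s) (ennreal (exp (- b')) / ennreal s)) \<longlongrightarrow> g j l a b') at_top"
      using J that unfolding condition_J_def g_def by auto
    from filterlim_compose[OF this exp_at_top] show ?thesis by (simp add: eq)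
  qed
  interpret F: exp_family M X D \<epsilon> N K g
    by unfold_locales (use indep copies \<epsilon>_exp N_lim K_lim K_N_lim N_mono g_lim in \<open>auto simp: D_def\<close>)
  have mu_lim: "(\<lambda>n. sqrt (K n j) * (real (N n j) / real (K n j)) powr (\<rho> $ j)) \<longlonglongrightarrow> lam $ j / (\<gamma> * \<beta> $ j)" for j
  proof -
    have "(\<lambda>n. sqrt (K n j) * A j (real (N n j) / real (K n j)) / (\<gamma> * \<beta> $ j)) \<longlonglongrightarrow> lam $ j / (\<gamma> * \<beta> $ j)"
      using \<gamma>_pos \<beta>_nz[of j] by (intro tendsto_divide lam_lim tendsto_const) auto
    then show ?thesis
      by (rule Lim_transform_eventually)
        (use F.tl.eventually_K_N[of j] in \<open>eventually_elim, use \<gamma>_pos \<beta>_nz[of j] in \<open>simp add: A_eq\<close>\<close>)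
  qed
  have hill_lin: "((\<lambda>z. sqrt (K (fst z) j) * (hill (\<lambda>i. X i (snd z) $ j) (N (fst z) j) (K (fst z) j) - \<gamma>)
        - \<gamma> * F.tl.lin j (fst z) (snd z)) \<longlongrightarrow> lam $ j / (1 - \<rho> $ j)) (prob_filter M)" for j
  proof -
    have "(\<forall>\<^sub>F t in at_top. 0 < cd.tq j t) \<and>
      (\<exists>c0. ((\<lambda>t. (ln (cd.tq j t) - c0 - \<gamma> * ln t) / t powr (\<rho> $ j)) \<longlongrightarrow> \<gamma> * \<beta> $ j / \<rho> $ j) at_top)"
    \<comment> \<open>Here C is \<gamma> \<beta>, so the coefficient of the expansion is \<gamma>
      \<beta> / \<rho>. Against the limit in \<open>mu_lim\<close> the factors cancel and the bias
      of the Hill estimator becomes lam / (1 - \<rho>).\<close>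
    proof (rule second_order_ln_expansion[OF \<gamma>_pos rho_neg _ cd.tq_mono])
      show "\<gamma> * \<beta> $ j \<noteq> 0" using \<gamma>_pos \<beta>_nz by simp
      fix x :: real assume x: "x > 0"
      have "((\<lambda>t. 1 / A j t * (cd.tq j (t * x) / cd.tq j t - x powr \<gamma>)) \<longlongrightarrow> x powr \<gamma> * ((x powr (\<rho> $ j) - 1) / \<rho> $ j)) at_top"
        using C2 x rho_neg[of j] unfolding condition_C2_def tq by (auto dest!: spec[of _ j] spec[of _ x])
      then show "((\<lambda>t. 1 / (\<gamma> * \<beta> $ j * t powr (\<rho> $ j)) * (cd.tq j (t * x) / cd.tq j t - x powr \<gamma>)) \<longlongrightarrow> x powr \<gamma> * ((x powr (\<rho> $ j) - 1) / \<rho> $ j)) at_top"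
        by (rule Lim_transform_eventually)
          (use eventually_gt_at_top[of "0::real"] in \<open>eventually_elim, simp add: A_eq\<close>)
    qed
    then obtain c0 where tpos: "\<forall>\<^sub>F t in at_top. 0 < cd.tq j t"
      and c0: "((\<lambda>t. (ln (cd.tq j t) - c0 - \<gamma> * ln t) / t powr (\<rho> $ j)) \<longlongrightarrow> \<gamma> * \<beta> $ j / \<rho> $ j) at_top" by blast
    have "((\<lambda>z. sqrt (K (fst z) j) * (hill (\<lambda>i. X i (snd z) $ j) (N (fst z) j) (K (fst z) j) - \<gamma>)
        - \<gamma> * F.tl.lin j (fst z) (snd z)) \<longlongrightarrow> \<gamma> * \<beta> $ j / \<rho> $ j * (lam $ j / (\<gamma> * \<beta> $ j)) * \<rho> $ j / (1 - \<rho> $ j)) (prob_filter M)"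
    proof (rule F.tl.hill_expansion[where q="\<lambda>e. cd.tq j (exp e)" and y="\<lambda>i w. X i w $ j"])
      show "AE w in M. \<forall>i\<ge>1. 0 < \<epsilon> j (X i w) \<and> X i w $ j = cd.tq j (exp (\<epsilon> j (X i w)))"
        using regular by eventually_elim (simp add: \<epsilon>_def cd.tq_inverse)
      show "cd.tq j (exp a) \<le> cd.tq j (exp b')" if "0 < a" "a \<le> b'" for a b'
        using that by (intro cd.tq_mono) auto
      show "\<forall>\<^sub>F x in at_top. 0 < cd.tq j (exp x)" using tpos exp_at_top by (auto simp: filterlim_iff)
      show "((\<lambda>x. (ln (cd.tq j (exp x)) - c0 - \<gamma> * x) / exp (\<rho> $ j * x)) \<longlongrightarrow> \<gamma> * \<beta> $ j / \<rho> $ j) at_top"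
        using filterlim_compose[OF c0 exp_at_top] by (simp add: powr_def)
      show "(\<lambda>n. sqrt (K n j) * exp (\<rho> $ j * F.tl.s0 j n)) \<longlonglongrightarrow> lam $ j / (\<gamma> * \<beta> $ j)"
        by (rule Lim_transform_eventually[OF mu_lim])
          (use F.tl.eventually_s0[of j] F.tl.eventually_K_N[of j] in \<open>eventually_elim, simp add: powr_def\<close>)
    qed (rule rho_neg)
    moreover have "\<gamma> * \<beta> $ j / \<rho> $ j * (lam $ j / (\<gamma> * \<beta> $ j)) * \<rho> $ j / (1 - \<rho> $ j) = lam $ j / (1 - \<rho> $ j)"
      using \<gamma>_pos \<beta>_nz[of j] rho_neg[of j] by simp
    ultimately show ?thesis by (simp only:)
  qed
  interpret P: pooled M X D \<epsilon> N K g \<gamma> \<rho> \<beta> b c lam \<omega>0 \<beta>h \<rho>h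
  proof
    show "(\<lambda>w. X i w $ j) \<in> borel_measurable M" if "i \<ge> 1" for i j
      using measurable_compose[OF X_rv[OF that] nth] .
    show \<beta>h_rv: "(\<lambda>w. \<beta>h n w $ j) \<in> borel_measurable M" for n j
      using measurable_compose[OF beta_rv nth] .
    show \<rho>h_rv: "(\<lambda>w. \<rho>h n w $ j) \<in> borel_measurable M" for n j
      using measurable_compose[OF rho_rv nth] .
    show "((\<lambda>z. \<beta>h (fst z) (snd z) $ j) \<longlongrightarrow> \<beta> $ j) (prob_filter M)" for j
      using tendsto_in_prob_imp_prob_filter[OF beta_consistent \<beta>h_rv] .
    show "((\<lambda>z. (\<rho>h (fst z) (snd z) $ j - \<rho> $ j) * ln (real (N (fst z) j))) \<longlongrightarrow> 0) (prob_filter M)" for j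
    proof (rule tendsto_in_prob_imp_prob_filter[OF rho_rate])
      show "(\<lambda>w. (\<rho>h n w $ j - \<rho> $ j) * ln (real (N n j))) \<in> borel_measurable M" for n
        using \<rho>h_rv[of n j] by measurable
    qed
  qed (use \<gamma>_pos \<beta>_nz rho_neg order hill_lin b_lim b_range c_lim c_pos mu_lim pilot in auto)
  \<comment> \<open>The ratios of c and of b are positive, so g at their negative logarithms is R at
    the ratios themselves.\<close>
  have VP: "V = P.V"
    unfolding V_def V_asym_def P.V_def P.S_def g_def sym_matrix_def using c_pos b_range by (simp add: vec_eq_iff)
  have BP: "B = P.B" by (simp add: B_def P.B_def)
  interpret W: pd_weights V B by unfold_locales (rule V_pd)
  note wr = P.X_rv P.\<beta>h_rv P.\<rho>h_rv
  have Vh: "((\<lambda>z. V_hat (N (fst z)) (K (fst z)) (\<lambda>i. X i (snd z)) \<omega>0 $ i $ j) \<longlongrightarrow> V $ i $ j) (prob_filter M)" for i j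
    unfolding VP by (rule P.V_hat_lim)
  have Bh: "((\<lambda>z. B_hat (N (fst z)) (K (fst z)) (\<lambda>i. X i (snd z)) \<omega>0 (\<beta>h (fst z) (snd z)) (\<rho>h (fst z) (snd z))) \<longlongrightarrow> B) (prob_filter M)"
    unfolding BP by (rule P.B_hat_lim)
  have v1: "weights_Var V \<bullet> (V *v weights_Var V) = 1 / (1 \<bullet> (matrix_inv V *v 1))"
    using W.var_Var(1) by (simp add: W.qa_def W.y1_def)
  have v2: "weights_AMSE B V \<bullet> (V *v weights_AMSE B V) =
      ((1 + B \<bullet> (matrix_inv V *v B))\<^sup>2 * (1 \<bullet> (matrix_inv V *v 1))
                - (2 + B \<bullet> (matrix_inv V *v B)) * (1 \<bullet> (matrix_inv V *v B))\<^sup>2)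
              / ((1 + B \<bullet> (matrix_inv V *v B)) * (1 \<bullet> (matrix_inv V *v 1))
                - (1 \<bullet> (matrix_inv V *v B))\<^sup>2)\<^sup>2"
    unfolding W.var_AMSE(1) by (simp add: W.qa_def W.qb_def W.qd_def W.qD_def W.y1_def W.yB_def)
  show ?thesis
  proof
    have "tendsto_in_distr M
           (\<lambda>n w. sqrt (k_total (K n)) *
              (gamma_bar (N n) (K n) (\<lambda>i. X i w) \<omega>0 (\<beta>h n w) (\<rho>h n w)
                 (omega_hat_Var (N n) (K n) (\<lambda>i. X i w) \<omega>0) - \<gamma>))
           (normal_law 0 (weights_Var V \<bullet> (P.V *v weights_Var V)))"
    proof (rule P.weighted_clt)
      show "((\<lambda>z. omega_hat_Var (N (fst z)) (K (fst z)) (\<lambda>i. X i (snd z)) \<omega>0) \<longlongrightarrow> weights_Var V) (prob_filter M)"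
        "\<forall>\<^sub>F z in prob_filter M. omega_hat_Var (N (fst z)) (K (fst z)) (\<lambda>i. X i (snd z)) \<omega>0 \<bullet> 1 = 1"
        unfolding omega_hat_Var_def by (rule W.weights_Var_tendsto[OF Vh])+
      show "(\<lambda>w. omega_hat_Var (N n) (K n) (\<lambda>i. X i w) \<omega>0 $ j) \<in> borel_measurable M" for n j
        by (rule omega_hat_Var_measurable[OF wr])
      show "weights_Var V \<bullet> (P.V *v weights_Var V) > 0"
        using W.var_Var unfolding VP[symmetric] by simp
    qed
    then show "tendsto_in_distr M
           (\<lambda>n w. let x = (\<lambda>i. X i w) in
              sqrt (k_total (K n)) *
              (gamma_bar (N n) (K n) x \<omega>0 (\<beta>h n w) (\<rho>h n w)
                 (omega_hat_Var (N n) (K n) x \<omega>0) - \<gamma>))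
           (normal_law 0 (1 / (1 \<bullet> (matrix_inv V *v 1))))"
      unfolding VP[symmetric] v1 Let_def .
    have "tendsto_in_distr M
           (\<lambda>n w. sqrt (k_total (K n)) *
              (gamma_bar (N n) (K n) (\<lambda>i. X i w) \<omega>0 (\<beta>h n w) (\<rho>h n w)
                 (omega_hat_AMSE (N n) (K n) (\<lambda>i. X i w) \<omega>0 (\<beta>h n w) (\<rho>h n w)) - \<gamma>))
           (normal_law 0 (weights_AMSE B V \<bullet> (P.V *v weights_AMSE B V)))"
    proof (rule P.weighted_clt)
      show "((\<lambda>z. omega_hat_AMSE (N (fst z)) (K (fst z)) (\<lambda>i. X i (snd z)) \<omega>0 (\<beta>h (fst z) (snd z)) (\<rho>h (fst z) (snd z))) \<longlongrightarrow> weights_AMSE B V) (prob_filter M)"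
        "\<forall>\<^sub>F z in prob_filter M. omega_hat_AMSE (N (fst z)) (K (fst z)) (\<lambda>i. X i (snd z)) \<omega>0 (\<beta>h (fst z) (snd z)) (\<rho>h (fst z) (snd z)) \<bullet> 1 = 1"
        unfolding omega_hat_AMSE_def by (rule W.weights_AMSE_tendsto[OF Vh Bh])+
      show "(\<lambda>w. omega_hat_AMSE (N n) (K n) (\<lambda>i. X i w) \<omega>0 (\<beta>h n w) (\<rho>h n w) $ j) \<in> borel_measurable M" for n j
        by (rule omega_hat_AMSE_measurable[OF wr])
      show "weights_AMSE B V \<bullet> (P.V *v weights_AMSE B V) > 0"
        using W.var_AMSE unfolding VP[symmetric] by simp
    qed
    then show "tendsto_in_distr M
           (\<lambda>n w. let x = (\<lambda>i. X i w) in
              sqrt (k_total (K n)) *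
              (gamma_bar (N n) (K n) x \<omega>0 (\<beta>h n w) (\<rho>h n w)
                 (omega_hat_AMSE (N n) (K n) x \<omega>0 (\<beta>h n w) (\<rho>h n w)) - \<gamma>))
           (normal_law 0
             (((1 + B \<bullet> (matrix_inv V *v B))\<^sup>2 * (1 \<bullet> (matrix_inv V *v 1))
                - (2 + B \<bullet> (matrix_inv V *v B)) * (1 \<bullet> (matrix_inv V *v B))\<^sup>2)
              / ((1 + B \<bullet> (matrix_inv V *v B)) * (1 \<bullet> (matrix_inv V *v 1))
                - (1 \<bullet> (matrix_inv V *v B))\<^sup>2)\<^sup>2))"
      unfolding VP[symmetric] v2 Let_def .
  qed
qed

end
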